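(* Let $\mathcal{A}$ be an associative $\mathbb{C}$-algebra, let $n \geq 1$, and let $\lambda$ be a self-conjugate partition of $n$. Let $A \in \operatorname{Mat}_{L,M}(\mathcal{A})$ and $B \in \operatorname{Mat}_{M,N}(\mathcal{A})$, and assume that the entries of $A$ and $B$ commute with each other (i.e. any two elements of the set of all entries of $A$ and of $B$ commute). Then, for all $I \in [L]^n$ and $K \in [N]^n$, \begin{align*} \operatorname{imm}^{\lambda} (AB)_{IK} &= \frac{\chi^{\lambda}(1)}{n!} \sum_{J \in [M]^n} \operatorname{imm}^{\lambda} A_{IJ} \, \operatorname{imm}^{\lambda} B_{JK} = \frac{\chi^{\lambda}(1)}{n!} \sum_{J \in [M]^n} \operatorname{imm}^{*\lambda} A_{IJ} \, \operatorname{imm}^{*\lambda} B_{JK}, \\ \operatorname{imm}^{*\lambda} (AB)_{IK} &= \frac{\chi^{\lambda}(1)}{n!} \sum_{J \in [M]^n} \operatorname{imm}^{\lambda} A_{IJ} \, \operatorname{imm}^{*\lambda} B_{JK} = \frac{\chi^{\lambda}(1)}{n!} \sum_{J \in [M]^n} \operatorname{imm}^{*\lambda} A_{IJ} \, \operatorname{imm}^{\lambda} B_{JK}. \end{align*}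
   Context: $\operatorname{Mat}_{m,n}(\mathcal{A})$ is the set of $m\times n$ matrices with entries in $\mathcal{A}$, and $[k]=\{1,\ldots,k\}$. For an $M\times N$ matrix $X=(x_{ij})$, $I=(i_1,\ldots,i_n)\in[M]^n$ and $J=(j_1,\ldots,j_n)\in[N]^n$, put $X_{IJ}=(x_{i_s j_t})_{1\leq s,t\leq n}$ (repetitions of indices allowed). For a partition $\lambda$ of $n$, $\chi^\lambda$ denotes the irreducible character of the symmetric group $\mathfrak{S}_n$ determined by $\lambda$. Definition of $\chi^{*\lambda}$. Let $\lambda$ be a self-conjugate partition of $n$ ($\lambda=\lambda'$), and let $r$ be its rank (the length of its main diagonal). Put $m(\lambda)=\frac12(n-r)$ (an integer) and $\mu=h(\lambda)=(\mu_1,\ldots,\mu_r)=(2\lambda_1-1,2\lambda_2-3,\ldots,2\lambda_r-(2r-1))$, the sequence of lengths of the diagonal hooks of $\lambda$; it is a partition of $n$ into distinct odd parts. For $\sigma\in\mathfrak{S}_n$ of cycle type $\mu$, write $\sigma=(i_{11}\ i_{12}\ \ldots\ i_{1\mu_1})(i_{21}\ \ldots\ i_{2\mu_2})\cdots(i_{r1}\ \ldots\ i_{r\mu_r})$ with cycles ordered by decreasing length, and let $f(\sigma)=1$ (resp. $-1$) if the number of inversions of the sequence $(i_{11},\ldots,i_{1\mu_1},i_{21},\ldots,i_{2\mu_2},\ldots,i_{r1},\ldots,i_{r\mu_r})$ is even (resp. odd); this is well defined since the $\mu_k$ are odd and distinct. Define $\chi^{*\lambda}:\mathfrak{S}_n\to\mathbb{C}$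 by $$\chi^{*\lambda}(\sigma)=\begin{cases} f(\sigma)\, i^{m(\lambda)}\sqrt{\mu_1\cdots\mu_r}, & \text{if } \sigma \text{ has cycle type } \mu=h(\lambda),\\ 0,&\text{otherwise,}\end{cases}$$ where $i$ is the imaginary unit. (For $n\ge 2$, this is the difference of the characters of the two irreducible constituents of the restriction to $\mathfrak{A}_n$ of the representation with character $\chi^\lambda$, extended by $0$ outside $\mathfrak{A}_n$.) For an $n\times n$ matrix $X=(x_{ij})$ over $\mathcal{A}$, the immanant and the twisted immanant are $$\operatorname{imm}^{\lambda}X=\sum_{\sigma\in\mathfrak{S}_n}\chi^{\lambda}(\sigma)\,x_{1\sigma(1)}\cdots x_{n\sigma(n)},\qquad \operatorname{imm}^{*\lambda}X=\sum_{\sigma\in\mathfrak{S}_n}\chi^{*\lambda}(\sigma)\,x_{1\sigma(1)}\cdots x_{n\sigma(n)}.$$ *)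

theory Defs
  imports
    "HOL-Library.Function_Algebras"
    "HOL-Combinatorics.Cycles"
    "Jordan_Normal_Form.Matrix"
    Complex_Main
begin

text \<open>
  Indices are zero-based, as in \<^theory>\<open>Jordan_Normal_Form.Matrix\<close>: the set $[k]$ becomes
  \<open>{0..<k}\<close>, and a permutation of degree \<open>n\<close> is a function \<open>\<sigma>\<close> with \<open>\<sigma> permutes {0..<n}\<close>.
\<close>


section \<open>Partitions\<close>

definition is_partition :: "nat \<Rightarrow> nat list \<Rightarrow> bool" where
  "is_partition n lam \<longleftrightarrow> sorted_wrt (\<ge>) lam \<and> 0 \<notin> set lam \<and> sum_list lam = n"

definition conjugate_partition :: "nat list \<Rightarrow> nat list" where
  "conjugate_partition lam =
     map (\<lambda>j. card {i. i < length lam \<and> j < lam ! i}) [0..<(if lam = [] then 0 else hd lam)]"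

definition partition_rank :: "nat list \<Rightarrow> nat" where
  "partition_rank lam = card {i. i < length lam \<and> i < lam ! i}"

text \<open>With zero-based \<open>i\<close>, the \<open>i\<close>-th diagonal hook has length $2\lambda_{i+1} - (2i+1)$.\<close>

definition diagonal_hooks :: "nat list \<Rightarrow> nat list" where
  "diagonal_hooks lam = map (\<lambda>i. 2 * lam ! i - (2 * i + 1)) [0..<partition_rank lam]"


section \<open>The group algebra of the symmetric group\<close>

text \<open>
  Elements of $\mathbb{C}\mathfrak{S}_n$ are complex functions on \<open>nat \<Rightarrow> nat\<close> that vanish outside
  the permutations of \<open>{0..<n}\<close>.
\<close>

definition group_algebra :: "nat \<Rightarrow> ((nat \<Rightarrow> nat) \<Rightarrow> complex) set" where
  "group_algebra n = {x. \<forall>\<sigma>. \<not> \<sigma> permutes {0..<n} \<longrightarrow> x \<sigma> = 0}"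

definition group_elem :: "(nat \<Rightarrow> nat) \<Rightarrow> (nat \<Rightarrow> nat) \<Rightarrow> complex" where
  "group_elem \<sigma> = (\<lambda>\<tau>. if \<tau> = \<sigma> then 1 else 0)"

definition group_algebra_mult ::
  "nat \<Rightarrow> ((nat \<Rightarrow> nat) \<Rightarrow> complex) \<Rightarrow> ((nat \<Rightarrow> nat) \<Rightarrow> complex) \<Rightarrow> (nat \<Rightarrow> nat) \<Rightarrow> complex" where
  "group_algebra_mult n x y =
     (\<lambda>\<sigma>. \<Sum>(\<tau>, \<rho>) | \<tau> permutes {0..<n} \<and> \<rho> permutes {0..<n} \<and> \<tau> \<circ> \<rho> = \<sigma>. x \<tau> * y \<rho>)"


section \<open>The trace of an endomorphism of a finite-dimensional space of functions\<close>

global_interpretation fun_space: vector_space "\<lambda>(c::complex) (f::'b \<Rightarrow> complex) x. c * f x"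
  by unfold_locales (auto simp: fun_eq_iff algebra_simps)

text \<open>For \<open>T\<close> mapping \<open>V\<close> into itself; the value does not depend on the chosen basis.\<close>

definition trace_on :: "('b \<Rightarrow> complex) set \<Rightarrow> (('b \<Rightarrow> complex) \<Rightarrow> ('b \<Rightarrow> complex)) \<Rightarrow> complex" where
  "trace_on V T =
     (let B = (SOME B. fun_space.independent B \<and> fun_space.span B = V)
      in \<Sum>b\<in>B. fun_space.representation B (T b) b)"


section \<open>Irreducible characters of the symmetric group\<close>

text \<open>
  Cells of the Young diagram are filled row by row with \<open>0, 1, 2, \<dots>\<close>; the \<open>i\<close>-th row and the
  \<open>j\<close>-th column of this tableau are given as sets of entries.
\<close>

definition tableau_entry :: "nat list \<Rightarrow> nat \<Rightarrow> nat \<Rightarrow> nat" where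
  "tableau_entry lam i j = sum_list (take i lam) + j"

definition tableau_row :: "nat list \<Rightarrow> nat \<Rightarrow> nat set" where
  "tableau_row lam i = {tableau_entry lam i j | j. i < length lam \<and> j < lam ! i}"

definition tableau_column :: "nat list \<Rightarrow> nat \<Rightarrow> nat set" where
  "tableau_column lam j = {tableau_entry lam i j | i. i < length lam \<and> j < lam ! i}"

definition row_group :: "nat list \<Rightarrow> (nat \<Rightarrow> nat) set" where
  "row_group lam =
     {p. p permutes {0..<sum_list lam} \<and> (\<forall>i. p ` tableau_row lam i = tableau_row lam i)}"

definition column_group :: "nat list \<Rightarrow> (nat \<Rightarrow> nat) set" where
  "column_group lam =
     {q. q permutes {0..<sum_list lam} \<and> (\<forall>j. q ` tableau_column lam j = tableau_column lam j)}"

definition young_symmetrizer :: "nat list \<Rightarrow> (nat \<Rightarrow> nat) \<Rightarrow> complex" where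
  "young_symmetrizer lam =
     group_algebra_mult (sum_list lam)
       (\<lambda>\<sigma>. if \<sigma> \<in> row_group lam then 1 else 0)
       (\<lambda>\<sigma>. if \<sigma> \<in> column_group lam then of_int (sign \<sigma>) else 0)"

text \<open>
  The irreducible representation of $\mathfrak{S}_n$ determined by $\lambda$ is the left ideal
  $\mathbb{C}\mathfrak{S}_n\, c_\lambda$, where $c_\lambda = a_\lambda b_\lambda$ is the Young
  symmetrizer; its character is the trace of left multiplication.
\<close>

definition specht_module :: "nat list \<Rightarrow> ((nat \<Rightarrow> nat) \<Rightarrow> complex) set" where
  "specht_module lam =
     {group_algebra_mult (sum_list lam) x (young_symmetrizer lam) | x.
        x \<in> group_algebra (sum_list lam)}"

definition irr_char :: "nat list \<Rightarrow> (nat \<Rightarrow> nat) \<Rightarrow> complex" where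
  "irr_char lam \<sigma> =
     trace_on (specht_module lam) (group_algebra_mult (sum_list lam) (group_elem \<sigma>))"


section \<open>The function $\chi^{*\lambda}$\<close>

text \<open>
  \<open>cycle_notation mu \<sigma> cs\<close>: \<open>cs\<close> is a way of writing \<open>\<sigma>\<close> as a product of disjoint cycles of lengths
  \<open>mu ! 0, mu ! 1, \<dots>\<close> (in this order), fixed points being written as cycles of length one. The
  entry following \<open>a\<close> in its cycle is \<open>\<sigma> a\<close>.
\<close>

definition cycle_notation :: "nat list \<Rightarrow> (nat \<Rightarrow> nat) \<Rightarrow> nat list list \<Rightarrow> bool" where
  "cycle_notation mu \<sigma> cs \<longleftrightarrow>
     map length cs = mu \<and> distinct (concat cs) \<and> set (concat cs) = {0..<sum_list mu} \<and>
     \<sigma> = foldr (\<circ>) (map cycle_of_list cs) id"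

definition has_cycle_type :: "nat list \<Rightarrow> (nat \<Rightarrow> nat) \<Rightarrow> bool" where
  "has_cycle_type mu \<sigma> \<longleftrightarrow> (\<exists>cs. cycle_notation mu \<sigma> cs)"

definition inversions :: "nat list \<Rightarrow> nat" where
  "inversions w = card {(s, t). s < t \<and> t < length w \<and> w ! s > w ! t}"

text \<open>
  The value does not depend on the chosen notation when the entries of \<open>mu\<close> are odd and distinct:
  rotating an odd cycle does not change the parity of the number of inversions.
\<close>

definition cycle_sign :: "nat list \<Rightarrow> (nat \<Rightarrow> nat) \<Rightarrow> complex" where
  "cycle_sign mu \<sigma> =
     (if even (inversions (concat (SOME cs. cycle_notation mu \<sigma> cs))) then 1 else -1)"

definition twisted_char :: "nat list \<Rightarrow> (nat \<Rightarrow> nat) \<Rightarrow> complex" where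
  "twisted_char lam \<sigma> =
     (let mu = diagonal_hooks lam; m = (sum_list lam - partition_rank lam) div 2
      in if has_cycle_type mu \<sigma>
         then cycle_sign mu \<sigma> * \<i> ^ m * of_real (sqrt (real (prod_list mu)))
         else 0)"


section \<open>Immanants over an associative algebra\<close>

text \<open>The algebra is neither assumed to be commutative nor to have a unit.\<close>

locale complex_algebra = vector_space scale
  for scale :: "complex \<Rightarrow> 'a::ring \<Rightarrow> 'a" +
  assumes scale_mult_left: "scale c x * y = scale c (x * y)"
    and scale_mult_right: "x * scale c y = scale c (x * y)"

text \<open>The product $x_0 x_1 \cdots x_{n-1}$ in this order, for $n \ge 1$.\<close>

definition ordered_prod :: "nat \<Rightarrow> (nat \<Rightarrow> 'a::ring) \<Rightarrow> 'a" where
  "ordered_prod n x = foldl (\<lambda>p s. p * x s) (x 0) [1..<n]"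

definition gen_immanant ::
  "(complex \<Rightarrow> 'a::ring \<Rightarrow> 'a) \<Rightarrow> ((nat \<Rightarrow> nat) \<Rightarrow> complex) \<Rightarrow> 'a mat \<Rightarrow> 'a" where
  "gen_immanant scale \<chi> X =
     (\<Sum>\<sigma> | \<sigma> permutes {0..<dim_row X}.
        scale (\<chi> \<sigma>) (ordered_prod (dim_row X) (\<lambda>s. X $$ (s, \<sigma> s))))"

definition imm :: "(complex \<Rightarrow> 'a::ring \<Rightarrow> 'a) \<Rightarrow> nat list \<Rightarrow> 'a mat \<Rightarrow> 'a" where
  "imm scale lam X = gen_immanant scale (irr_char lam) X"

definition twisted_imm :: "(complex \<Rightarrow> 'a::ring \<Rightarrow> 'a) \<Rightarrow> nat list \<Rightarrow> 'a mat \<Rightarrow> 'a" where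
  "twisted_imm scale lam X = gen_immanant scale (twisted_char lam) X"

definition index_tuples :: "nat \<Rightarrow> nat \<Rightarrow> nat list set" where
  "index_tuples M n = {J. set J \<subseteq> {0..<M} \<and> length J = n}"

definition multi_index_mat :: "'a mat \<Rightarrow> nat list \<Rightarrow> nat list \<Rightarrow> 'a mat" where
  "multi_index_mat X I J = mat (length I) (length J) (\<lambda>(s, t). X $$ (I ! s, J ! t))"

end

theory Submission
  imports Defs "HOL-Library.Poly_Mapping"
begin

text \<open>Let \<open>X = \<Sum> \<chi>\<^sup>\<lambda>(\<sigma>) \<sigma>\<close> and \<open>Z = \<Sum> \<chi>\<^sup>*\<^sup>\<lambda>(\<sigma>) \<sigma>\<close> in the group algebra and \<open>\<kappa> = n! / \<chi>\<^sup>\<lambda>(1)\<close>.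
  Expanding \<open>(AB)\<^sub>I\<^sub>K\<close> entrywise, the four identities reduce to \<open>X X = Z Z = \<kappa> X\<close> and
  \<open>X Z = Z X = \<kappa> Z\<close>. The first one is classical, as \<open>X\<close> is an average of the conjugates of a Young
  symmetrizer. The element \<open>Z\<close> is twisted central, \<open>g Z = sgn(g) Z g\<close>, so \<open>Z Z\<close> is central; once
  \<open>Z\<close> is known to lie in the block of \<open>\<lambda>\<close>, i.e. \<open>X Z = \<kappa> Z\<close>, it follows that \<open>Z Z\<close> is a multiple of
  \<open>X\<close>, and the factor is read off at the identity.

  To place \<open>Z\<close> in the block, take the row symmetrizer \<open>a\<close> of a tableau of shape \<open>\<lambda>\<close> and the
  permutation \<open>w\<close> transposing this tableau. Then \<open>Y = \<Sum> sgn(g) g a w g\<^sup>-\<^sup>1\<close> is a nonzero twisted central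
  element of the block. Twisted central elements live on the classes whose cycle lengths are odd
  and distinct, i.e. on the classes \<open>h(\<nu>)\<close> with \<open>\<nu>\<close> self-conjugate. A Garnir argument excludes the
  classes lexicographically larger than \<open>h(\<lambda>)\<close> from the support of \<open>Y\<close>; for the smaller ones, the
  twisted class sum of \<open>h(\<nu>)\<close> lies by induction in the block of \<open>\<nu>\<close>, which is orthogonal to \<open>Y\<close>. So \<open>Y\<close>
  is supported on the class \<open>h(\<lambda>)\<close> and is a multiple of \<open>Z\<close>.\<close>

section \<open>Finite permutations and the group algebra\<close>

text \<open>In representation theory \<open>Z\<close> is the difference of two irreducible
  characters of the alternating group. Here it is given only by its values on one class, and the
  obstacle is to show that a function so described lies in a single block. No value of the
  irreducible character away from the identity is ever computed. Every self-conjugate shape supplies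
  one twisted central element, and so does every class of distinct odd cycle lengths. Matching the
  two families is a triangularity argument that needs both halves: the Garnir relations say nothing
  about the smaller classes, and the induction says nothing about the larger ones. Positivity of
  \<open>tau (x * star x)\<close> takes the place of complete reducibility. The constant in the
  twisted character is forced. An element of the class is conjugate to its inverse by a permutation
  of sign (-1)^m, and its centralizer is even of order \<open>prod_list mu\<close>. The signed class
  sum therefore has a square whose coefficient at the identity is (-1)^m n! divided by
  \<open>prod_list mu\<close>. Multiplying by the square of i^m sqrt(\<open>prod_list mu\<close>)
  leaves n!, which is the coefficient of \<kappa> X at the identity.\<close>

text \<open>Finitely supported permutations, with composition written additively: the multiplication of
  \<open>fperm \<Rightarrow>\<^sub>0 complex\<close> is then the convolution product of the group algebra.\<close>

typedef fperm = "{p :: nat \<Rightarrow> nat. permutation p}" morphisms ap Fperm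
  by (auto intro: exI[of _ id])

lemma permutation_ap [simp]: "permutation (ap g)"
  using ap by auto

lemma bij_ap [simp]: "bij (ap g)"
  by (simp add: permutation_bijective)

lemma ap_Fperm: "permutation p \<Longrightarrow> ap (Fperm p) = p"
  by (simp add: Fperm_inverse)

lemma fperm_eqI: "(\<And>x. ap g x = ap h x) \<Longrightarrow> g = h"
  by (metis ap_inverse ext)

instantiation fperm :: group_add
begin
definition zero_fperm :: fperm where "zero_fperm = Fperm id"
definition plus_fperm :: "fperm \<Rightarrow> fperm \<Rightarrow> fperm" where "plus_fperm g h = Fperm (ap g \<circ> ap h)"
definition uminus_fperm :: "fperm \<Rightarrow> fperm" where "uminus_fperm g = Fperm (inv_into UNIV (ap g))"
definition minus_fperm :: "fperm \<Rightarrow> fperm \<Rightarrow> fperm" where "minus_fperm g h = g + - h"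

lemma ap_zero [simp]: "ap 0 = id"
  by (simp add: zero_fperm_def ap_Fperm)

lemma ap_plus: "ap (g + h) = ap g \<circ> ap h"
  by (simp add: plus_fperm_def ap_Fperm permutation_compose)

lemma ap_uminus: "ap (- g) = inv_into UNIV (ap g)"
  by (simp add: uminus_fperm_def ap_Fperm permutation_inverse)

instance
proof
  fix a b c :: fperm
  show "a + b + c = a + (b + c)" by (rule fperm_eqI) (simp add: ap_plus)
  show "0 + a = a" by (rule fperm_eqI) (simp add: ap_plus)
  show "a + 0 = a" by (rule fperm_eqI) (simp add: ap_plus)
  show "- a + a = 0"
    by (rule fperm_eqI) (simp add: ap_plus ap_uminus bij_is_inj)
  show "a + - b = a - b" by (simp add: minus_fperm_def)
qed
end

lemma ap_plus_apply [simp]: "ap (g + h) x = ap g (ap h x)"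
  by (simp add: ap_plus)

lemma ap_uminus_ap [simp]: "ap (- g) (ap g x) = x"
  by (simp add: ap_uminus bij_is_inj)

lemma ap_ap_uminus [simp]: "ap g (ap (- g) x) = x"
  by (metis ap_plus_apply ap_zero id_apply right_minus)

lemma ap_eq_iff [simp]: "ap g x = ap g y \<longleftrightarrow> x = y"
  by (metis ap_uminus_ap)

lemma ap_uminus_eq_iff: "ap (- g) x = y \<longleftrightarrow> x = ap g y"
  by (metis ap_uminus_ap ap_ap_uminus)

section \<open>Signs, transpositions and the symmetric groups of subsets\<close>

definition sg :: "fperm \<Rightarrow> complex" where "sg g = of_int (sign (ap g))"

lemma sg_zero [simp]: "sg 0 = 1"
  by (simp add: sg_def)

lemma sg_plus [simp]: "sg (g + h) = sg g * sg h"
  by (simp add: sg_def ap_plus sign_compose)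

lemma sg_uminus [simp]: "sg (- g) = sg g"
  by (simp add: sg_def ap_uminus sign_inverse)

lemma sg_mult_self [simp]: "sg g * sg g = 1" "sg g * (sg g * z) = z"
  by (simp_all add: sg_def flip: of_int_mult mult.assoc)

lemma sg_cases: "sg g = 1 \<or> sg g = -1"
  by (cases "ap g" rule: sign_cases) (simp_all add: sg_def)

lemma sg_nonzero [simp]: "sg g \<noteq> 0"
  using sg_cases[of g] by auto

lemma cnj_sg [simp]: "cnj (sg g) = sg g"
  by (simp add: sg_def)

definition transp :: "nat \<Rightarrow> nat \<Rightarrow> fperm" where
  "transp x y = Fperm (Transposition.transpose x y)"

lemma ap_transp: "ap (transp x y) = Transposition.transpose x y"
  by (simp add: transp_def ap_Fperm permutation_swap_id)

lemma sg_transp: "x \<noteq> y \<Longrightarrow> sg (transp x y) = -1"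
  by (simp add: sg_def ap_transp sign_swap_id)

lemma transp_self [simp]: "transp x y + transp x y = 0" "- transp x y = transp x y"
proof -
  show "transp x y + transp x y = 0" by (rule fperm_eqI) (simp add: ap_transp)
  then show "- transp x y = transp x y" by (simp add: minus_unique)
qed

lemma conj_transp: "g + transp x y = transp (ap g x) (ap g y) + g"
  by (rule fperm_eqI) (auto simp: ap_transp Transposition.transpose_def)

definition Sym :: "nat set \<Rightarrow> fperm set" where "Sym A = {g. ap g permutes A}"

lemma Sym_zero [simp]: "0 \<in> Sym A"
  by (simp add: Sym_def permutes_id)

lemma Sym_plus: "g \<in> Sym A \<Longrightarrow> h \<in> Sym A \<Longrightarrow> g + h \<in> Sym A"
  by (simp add: Sym_def ap_plus permutes_compose)

lemma Sym_uminus: "g \<in> Sym A \<Longrightarrow> - g \<in> Sym A"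
  by (simp add: Sym_def ap_uminus permutes_inv)

lemma Sym_uminus_iff [simp]: "- g \<in> Sym A \<longleftrightarrow> g \<in> Sym A"
  using Sym_uminus[of "- g"] Sym_uminus by auto

lemma Sym_plus_iff: "g \<in> Sym A \<Longrightarrow> g + h \<in> Sym A \<longleftrightarrow> h \<in> Sym A"
  by (metis Sym_plus Sym_uminus minus_add_cancel)

lemma Sym_in: "g \<in> Sym A \<Longrightarrow> ap g x \<in> A \<longleftrightarrow> x \<in> A"
  by (simp add: Sym_def permutes_in_image)

lemma Sym_notin: "g \<in> Sym A \<Longrightarrow> x \<notin> A \<Longrightarrow> ap g x = x"
  by (simp add: Sym_def permutes_not_in)

lemma transp_Sym: "x \<in> A \<Longrightarrow> y \<in> A \<Longrightarrow> transp x y \<in> Sym A"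
  by (simp add: Sym_def ap_transp permutes_swap_id)

lemma Sym_eqI: "g \<in> Sym A \<Longrightarrow> h \<in> Sym A \<Longrightarrow> (\<And>x. x \<in> A \<Longrightarrow> ap g x = ap h x) \<Longrightarrow> g = h"
  by (metis Sym_notin fperm_eqI)

lemma bij_betw_Sym: "g \<in> Sym A \<Longrightarrow> bij_betw (ap g) A A"
  by (simp add: Sym_def permutes_imp_bij)

lemma Fperm_Sym: "finite A \<Longrightarrow> p permutes A \<Longrightarrow> Fperm p \<in> Sym A"
  by (metis Sym_def ap_Fperm mem_Collect_eq permutation_permutes)

lemma ap_Fperm_permutes: "finite A \<Longrightarrow> p permutes A \<Longrightarrow> ap (Fperm p) = p"
  by (metis ap_Fperm permutation_permutes)

lemma bij_betw_ap_Sym: "finite A \<Longrightarrow> bij_betw ap (Sym A) {p. p permutes A}"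
  by (rule bij_betwI[of _ _ _ Fperm])
    (auto simp: Sym_def ap_Fperm_permutes ap_inverse)

lemma finite_Sym [simp]: "finite A \<Longrightarrow> finite (Sym A)"
  using bij_betw_finite[OF bij_betw_ap_Sym] finite_permutations by blast

lemma card_Sym: "finite A \<Longrightarrow> card (Sym A) = fact (card A)"
  using bij_betw_same_card[OF bij_betw_ap_Sym] card_permutations by metis

lemma fperm_of_bij:
  assumes "finite A" "bij_betw f A A"
  obtains g where "g \<in> Sym A" "\<And>x. x \<in> A \<Longrightarrow> ap g x = f x"
proof
  let ?p = "\<lambda>x. if x \<in> A then f x else x"
  have p: "?p permutes A"
    by (rule bij_imp_permutes) (use assms(2) in \<open>auto cong: bij_betw_cong\<close>)
  show "Fperm ?p \<in> Sym A" by (rule Fperm_Sym[OF assms(1) p])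
  show "x \<in> A \<Longrightarrow> ap (Fperm ?p) x = f x" for x
    by (simp add: ap_Fperm_permutes[OF assms(1) p])
qed

lemma sum_Sym_left: "h \<in> Sym A \<Longrightarrow> (\<Sum>g\<in>Sym A. f (h + g)) = sum f (Sym A)"
  by (rule sum.reindex_bij_witness[of _ "\<lambda>g. - h + g" "\<lambda>g. h + g"])
    (auto simp: Sym_plus Sym_uminus add.assoc[symmetric])

lemma sum_Sym_right: "h \<in> Sym A \<Longrightarrow> (\<Sum>g\<in>Sym A. f (g + h)) = sum f (Sym A)"
  by (rule sum.reindex_bij_witness[of _ "\<lambda>g. g - h" "\<lambda>g. g + h"])
    (auto simp: Sym_plus Sym_uminus diff_conv_add_uminus simp del: add_uminus_conv_diff simp: add.assoc)

lemma sum_Sym_uminus: "(\<Sum>g\<in>Sym A. f (- g)) = sum f (Sym A)"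
  by (rule sum.reindex_bij_witness[of _ uminus uminus]) auto

section \<open>The group algebra, its scalars and its finite subalgebras\<close>

type_synonym ga = "fperm \<Rightarrow>\<^sub>0 complex"

abbreviation lk :: "ga \<Rightarrow> fperm \<Rightarrow> complex" where "lk \<equiv> Poly_Mapping.lookup"

definition G :: "fperm \<Rightarrow> ga" where "G g = Poly_Mapping.single g 1"
text \<open>Scalars are the multiples of the unit, so \<open>scl_mult\<close> is associativity and
  only their centrality, \<open>mult_scl\<close>, needs a look at coefficients.\<close>

definition scl :: "complex \<Rightarrow> ga \<Rightarrow> ga" where "scl c x = Poly_Mapping.single 0 c * x"

lemma G_plus: "G (g + h) = G g * G h"
  by (simp add: G_def mult_single)

lemma G_minus: "G (g - h) = G g * G (- h)"
  by (metis G_plus diff_conv_add_uminus)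

lemma G_mult_assoc: "G g * (G h * x) = G (g + h) * x"
  by (simp add: G_plus mult.assoc)

lemma G_zero [simp]: "G 0 = 1"
  by (simp add: G_def)

lemma G_inverse [simp]: "G g * G (- g) = 1" "G (- g) * G g = 1"
  "G g * (G (- g) * x) = x" "G (- g) * (G g * x) = x"
  by (simp_all add: G_mult_assoc flip: G_plus)

lemma single_eq: "Poly_Mapping.single g c = scl c (G g)"
  by (simp add: G_def scl_def mult_single)

lemma lk_G: "lk (G g) h = (if g = h then 1 else 0)"
  by (simp add: G_def lookup_single when_def)

lemma ga_sum_keys:
  assumes "finite S" "Poly_Mapping.keys x \<subseteq> S"
  shows "x = (\<Sum>g\<in>S. Poly_Mapping.single g (lk x g))"
proof (rule poly_mapping_eqI)
  fix h
  have "lk (\<Sum>g\<in>S. Poly_Mapping.single g (lk x g)) h = (\<Sum>g\<in>S. if h = g then lk x g else 0)"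
    by (auto simp: lookup_sum lookup_single when_def intro!: sum.cong)
  also have "\<dots> = lk x h"
    using assms by (auto simp: sum.delta' not_in_keys_iff_lookup_eq_zero[symmetric])
  finally show "lk x h = lk (\<Sum>g\<in>S. Poly_Mapping.single g (lk x g)) h" ..
qed

lemma lk_single_mult: "lk (Poly_Mapping.single g c * x) h = c * lk x (- g + h)"
proof -
  have *: "(c * lk x k when g + k = h) = (if k = - g + h then c * lk x k else 0)" for k
    by (auto simp: when_def add.assoc[symmetric])
  have "lk (Poly_Mapping.single g c * x) h
      = lk (Poly_Mapping.single g c * (\<Sum>k\<in>Poly_Mapping.keys x. Poly_Mapping.single k (lk x k))) h"
    using ga_sum_keys[of "Poly_Mapping.keys x" x] by simp
  also have "\<dots> = (\<Sum>k\<in>Poly_Mapping.keys x. c * lk x k when g + k = h)"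
    by (simp add: sum_distrib_left mult_single lookup_sum lookup_single)
  also have "\<dots> = c * lk x (- g + h)"
    unfolding * by (auto simp: sum.delta not_in_keys_iff_lookup_eq_zero[symmetric])
  finally show ?thesis .
qed

lemma lk_mult_single: "lk (x * Poly_Mapping.single g c) h = lk x (h - g) * c"
proof -
  have *: "(lk x k * c when k + g = h) = (if k = h - g then lk x k * c else 0)" for k
    by (auto simp: when_def)
  have "lk (x * Poly_Mapping.single g c) h
      = lk ((\<Sum>k\<in>Poly_Mapping.keys x. Poly_Mapping.single k (lk x k)) * Poly_Mapping.single g c) h"
    using ga_sum_keys[of "Poly_Mapping.keys x" x] by simp
  also have "\<dots> = (\<Sum>k\<in>Poly_Mapping.keys x. lk x k * c when k + g = h)"
    by (simp add: sum_distrib_right mult_single lookup_sum lookup_single)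
  also have "\<dots> = lk x (h - g) * c"
    unfolding * by (auto simp: sum.delta not_in_keys_iff_lookup_eq_zero[symmetric])
  finally show ?thesis .
qed

lemma lk_G_mult [simp]: "lk (G g * x) h = lk x (- g + h)"
  by (simp add: G_def lk_single_mult)

lemma lk_mult_G [simp]: "lk (x * G g) h = lk x (h - g)"
  by (simp add: G_def lk_mult_single)

lemma lk_scl [simp]: "lk (scl c x) h = c * lk x h"
  by (simp add: scl_def lk_single_mult)

lemma scl_mult [simp]: "scl c x * y = scl c (x * y)"
  by (simp add: scl_def mult.assoc)

lemma mult_scl [simp]: "x * scl c y = scl c (x * y)"
proof -
  have "x * Poly_Mapping.single 0 c = Poly_Mapping.single 0 c * x"
    by (rule poly_mapping_eqI) (simp add: lk_single_mult lk_mult_single)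
  then show ?thesis by (simp add: scl_def flip: mult.assoc)
qed

lemma scl_scl [simp]: "scl c (scl d x) = scl (c * d) x"
  by (rule poly_mapping_eqI) simp

lemma scl_1 [simp]: "scl 1 x = x" and scl_0 [simp]: "scl 0 x = 0" "scl c 0 = 0"
  by (rule poly_mapping_eqI; simp)+

lemma scl_add [simp]: "scl c (x + y) = scl c x + scl c y"
  by (rule poly_mapping_eqI) (simp add: lookup_add algebra_simps)

lemma scl_add_left: "scl (c + d) x = scl c x + scl d x"
  by (rule poly_mapping_eqI) (simp add: lookup_add algebra_simps)

lemma scl_minus1: "scl (- 1) x = - x"
  by (rule poly_mapping_eqI) simp

lemma scl_sum: "scl c (sum f S) = (\<Sum>i\<in>S. scl c (f i))"
  by (rule poly_mapping_eqI) (simp add: lookup_sum sum_distrib_left)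

lemma scl_sum_left: "scl (sum f S) x = (\<Sum>i\<in>S. scl (f i) x)"
  by (rule poly_mapping_eqI) (simp add: lookup_sum sum_distrib_right)

lemma scl_eq_0_iff: "c \<noteq> 0 \<Longrightarrow> scl c x = 0 \<longleftrightarrow> x = 0"
  by (metis scl_1 scl_scl left_inverse scl_0(2))

lemma scl_cancel: "c \<noteq> 0 \<Longrightarrow> scl c x = scl c y \<longleftrightarrow> x = y"
  by (metis scl_1 scl_scl left_inverse)

lemma ga_induct [case_names zero single add]:
  assumes "P 0" "\<And>c g. P (scl c (G g))" "\<And>x y. P x \<Longrightarrow> P y \<Longrightarrow> P (x + y)"
  shows "P (x :: ga)"
proof -
  have "P (\<Sum>g\<in>S. Poly_Mapping.single g (lk x g))" if "finite S" for S
    using that by (induction S) (auto simp: assms single_eq)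
  then show ?thesis
    by (metis finite_keys ga_sum_keys subset_refl)
qed

definition Alg :: "nat set \<Rightarrow> ga set" where "Alg A = {x. \<forall>g. g \<notin> Sym A \<longrightarrow> lk x g = 0}"

lemma Alg_keys: "x \<in> Alg A \<longleftrightarrow> Poly_Mapping.keys x \<subseteq> Sym A"
  by (auto simp: Alg_def in_keys_iff)

lemma Alg_zero [simp]: "0 \<in> Alg A" and Alg_add: "x \<in> Alg A \<Longrightarrow> y \<in> Alg A \<Longrightarrow> x + y \<in> Alg A"
  by (auto simp: Alg_def lookup_add)

lemma Alg_sum: "(\<And>i. i \<in> I \<Longrightarrow> f i \<in> Alg A) \<Longrightarrow> sum f I \<in> Alg A"
  by (induction I rule: infinite_finite_induct) (auto intro: Alg_add)

lemma Alg_G: "g \<in> Sym A \<Longrightarrow> G g \<in> Alg A"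
  by (auto simp: Alg_def lk_G)

lemma Alg_scl: "x \<in> Alg A \<Longrightarrow> scl c x \<in> Alg A"
  by (auto simp: Alg_def)

lemma Alg_expand:
  assumes "finite A" "x \<in> Alg A"
  shows "x = (\<Sum>g\<in>Sym A. scl (lk x g) (G g))"
  using ga_sum_keys[of "Sym A" x] assms by (simp add: Alg_keys single_eq)

lemma Alg_mult: 
  assumes "x \<in> Alg A" "y \<in> Alg A" shows "x * y \<in> Alg A"
proof -
  have "x * y = (\<Sum>g\<in>Poly_Mapping.keys x. Poly_Mapping.single g (lk x g) * y)"
    using ga_sum_keys[of "Poly_Mapping.keys x" x] by (simp flip: sum_distrib_right)
  also have "\<dots> \<in> Alg A"
  proof (rule Alg_sum)
    fix g assume "g \<in> Poly_Mapping.keys x"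
    then have "g \<in> Sym A" using assms by (auto simp: Alg_keys)
    then show "Poly_Mapping.single g (lk x g) * y \<in> Alg A"
      using assms(2) by (auto simp: Alg_def lk_single_mult Sym_plus_iff)
  qed
  finally show ?thesis .
qed

lemma Alg_induct [consumes 2, case_names G add scale]:
  assumes "finite A" "x \<in> Alg A"
    and "\<And>g. g \<in> Sym A \<Longrightarrow> P (G g)" "\<And>x y. P x \<Longrightarrow> P y \<Longrightarrow> P (x + y)" "\<And>c x. P x \<Longrightarrow> P (scl c x)"
  shows "P x"
proof -
  have P0: "P 0" using assms(3)[OF Sym_zero] assms(5)[of 1 0] by simp
  have "P (\<Sum>g\<in>S. scl (lk x g) (G g))" if "finite S" "S \<subseteq> Sym A" for S
    using that by (induction S) (auto simp: assms P0)
  then show ?thesis using Alg_expand[OF assms(1,2)] assms(1) by (metis finite_Sym subset_refl)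
qed

section \<open>Trace form, adjoint and sign automorphism\<close>

definition tau :: "ga \<Rightarrow> complex" where "tau x = lk x 0"

lemma tau_add [simp]: "tau (x + y) = tau x + tau y"
  by (simp add: tau_def lookup_add)

lemma tau_scl [simp]: "tau (scl c x) = c * tau x"
  by (simp add: tau_def)

lemma tau_zero [simp]: "tau 0 = 0"
  by (simp add: tau_def)

lemma tau_sum: "tau (sum f S) = (\<Sum>i\<in>S. tau (f i))"
  by (simp add: tau_def lookup_sum)

lemma tau_mult_G: "tau (x * G g) = lk x (- g)" "tau (G g * x) = lk x (- g)"
  by (simp_all add: tau_def)

lemma tau_commute: "tau (x * y) = tau (y * x)"
  by (induction y rule: ga_induct) (simp_all add: distrib_left distrib_right mult.assoc tau_mult_G)

text \<open>The adjoint for the inner product \<open>tau (x * star y)\<close>; on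
  \<open>Alg A\<close> with \<open>A\<close> finite, \<open>tau\<close> is the trace of the regular
  representation divided by the group order. Positive definiteness,
  \<open>tau_mult_star_eq_0\<close>, is what makes \<open>kap\<close> nonzero later.\<close>

definition star :: "ga \<Rightarrow> ga" where
  "star x = (\<Sum>g\<in>Poly_Mapping.keys x. scl (cnj (lk x g)) (G (- g)))"

lemma lk_star [simp]: "lk (star x) h = cnj (lk x (- h))"
proof -
  have "lk (star x) h = (\<Sum>g\<in>Poly_Mapping.keys x. if g = - h then cnj (lk x g) else 0)"
    unfolding star_def lookup_sum lk_scl lk_G by (rule sum.cong) auto
  also have "\<dots> = cnj (lk x (- h))"
    by (auto simp: sum.delta not_in_keys_iff_lookup_eq_zero[symmetric])
  finally show ?thesis .
qed

lemma star_add [simp]: "star (x + y) = star x + star y"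
  by (rule poly_mapping_eqI) (simp add: lookup_add)

lemma star_zero [simp]: "star 0 = 0"
  by (rule poly_mapping_eqI) simp

lemma star_G [simp]: "star (G g) = G (- g)"
  by (rule poly_mapping_eqI) (auto simp: lk_G)

lemma star_scl [simp]: "star (scl c x) = scl (cnj c) (star x)"
  by (rule poly_mapping_eqI) simp

lemma star_star [simp]: "star (star x) = x"
  by (rule poly_mapping_eqI) simp

lemma star_sum: "star (sum f S) = (\<Sum>i\<in>S. star (f i))"
  by (induction S rule: infinite_finite_induct) auto

lemma star_mult: "star (x * y) = star y * star x"
proof (induction x rule: ga_induct)
  case (single c g)
  have "star (G g * y) = star y * G (- g)"
    by (rule poly_mapping_eqI) (simp add: minus_add)
  then show ?case by (simp add: mult.assoc)
qed (simp_all add: distrib_left distrib_right)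

lemma star_Alg: "x \<in> Alg A \<Longrightarrow> star x \<in> Alg A"
  by (auto simp: Alg_def)

lemma tau_mult_star: "tau (x * star x) = (\<Sum>g\<in>Poly_Mapping.keys x. of_real ((cmod (lk x g))\<^sup>2))"
proof -
  have "x * star x = (\<Sum>g\<in>Poly_Mapping.keys x. scl (cnj (lk x g)) (x * G (- g)))"
    by (subst star_def) (simp add: sum_distrib_left mult_scl)
  then show ?thesis
    by (simp add: tau_sum tau_mult_G complex_norm_square mult.commute del: of_real_power)
qed

lemma tau_mult_star_eq_0: "tau (x * star x) = 0 \<Longrightarrow> x = 0"
proof -
  assume "tau (x * star x) = 0"
  then have "(\<Sum>g\<in>Poly_Mapping.keys x. (cmod (lk x g))\<^sup>2) = 0"
    unfolding tau_mult_star by (metis of_real_eq_0_iff of_real_sum)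
  then have "\<forall>g\<in>Poly_Mapping.keys x. lk x g = 0"
    by (subst (asm) sum_nonneg_eq_0_iff) auto
  then show "x = 0" by (metis in_keys_iff lookup_zero poly_mapping_eqI)
qed

text \<open>Tensoring with the sign representation: an automorphism of the algebra that exchanges
  symmetrizers and antisymmetrizers.\<close>

definition eps :: "ga \<Rightarrow> ga" where
  "eps x = (\<Sum>g\<in>Poly_Mapping.keys x. scl (sg g * lk x g) (G g))"

lemma lk_eps [simp]: "lk (eps x) h = sg h * lk x h"
proof -
  have "lk (eps x) h = (\<Sum>g\<in>Poly_Mapping.keys x. if g = h then sg g * lk x g else 0)"
    unfolding eps_def lookup_sum lk_scl lk_G by (rule sum.cong) auto
  also have "\<dots> = sg h * lk x h"
    by (auto simp: sum.delta not_in_keys_iff_lookup_eq_zero[symmetric])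
  finally show ?thesis .
qed

lemma eps_add [simp]: "eps (x + y) = eps x + eps y"
  by (rule poly_mapping_eqI) (simp add: lookup_add algebra_simps)

lemma eps_zero [simp]: "eps 0 = 0"
  by (rule poly_mapping_eqI) simp

lemma eps_scl [simp]: "eps (scl c x) = scl c (eps x)"
  by (rule poly_mapping_eqI) simp

lemma eps_G [simp]: "eps (G g) = scl (sg g) (G g)"
  by (rule poly_mapping_eqI) (auto simp: lk_G)

lemma eps_sum: "eps (sum f S) = (\<Sum>i\<in>S. eps (f i))"
  by (induction S rule: infinite_finite_induct) auto

lemma eps_mult: "eps (x * y) = eps x * eps y"
proof (induction x rule: ga_induct)
  case (single c g)
  have "eps (G g * y) = scl (sg g) (G g) * eps y"
    by (rule poly_mapping_eqI) (simp add: mult.assoc)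
  then show ?case by (simp add: mult.assoc mult.commute[of c])
qed (simp_all add: distrib_left distrib_right)

section \<open>Sums over conjugates, plain and twisted by the sign\<close>

definition psi :: "nat set \<Rightarrow> ga \<Rightarrow> ga" where
  "psi A x = (\<Sum>g\<in>Sym A. G g * x * G (- g))"

text \<open>Divided by the group order, \<open>psi\<close> and \<open>phi\<close> project
  \<open>Alg A\<close> onto the central and the twisted central elements
  (\<open>twisted_eq_phi\<close>). The sums are left unnormalised, which is where factors such as
  \<open>fact n\<close> come from.\<close>

definition phi :: "nat set \<Rightarrow> ga \<Rightarrow> ga" where
  "phi A x = (\<Sum>g\<in>Sym A. scl (sg g) (G g * x * G (- g)))"

lemma psi_add: "psi A (x + y) = psi A x + psi A y"
  by (simp add: psi_def distrib_left distrib_right sum.distrib)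

lemma phi_add: "phi A (x + y) = phi A x + phi A y"
  by (simp add: phi_def distrib_left distrib_right sum.distrib)

lemma psi_scl: "psi A (scl c x) = scl c (psi A x)"
  by (simp add: psi_def scl_sum)

lemma phi_scl: "phi A (scl c x) = scl c (phi A x)"
  by (simp add: phi_def scl_sum mult.commute[of c])

lemma phi_zero [simp]: "phi A 0 = 0"
  by (simp add: phi_def)

lemma phi_sum: "phi A (sum f S) = (\<Sum>i\<in>S. phi A (f i))"
  by (induction S rule: infinite_finite_induct) (auto simp: phi_add)

lemma psi_Alg: "x \<in> Alg A \<Longrightarrow> psi A x \<in> Alg A"
  unfolding psi_def by (intro Alg_sum Alg_mult Alg_G) (auto)

lemma phi_Alg: "x \<in> Alg A \<Longrightarrow> phi A x \<in> Alg A"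
  unfolding phi_def by (intro Alg_sum Alg_mult Alg_G Alg_scl) (auto)

lemma psi_G_mult: 
  assumes "h \<in> Sym A" shows "psi A (G h * x) = psi A (x * G h)"
proof -
  have "psi A (x * G h) = (\<Sum>g\<in>Sym A. G (g + h) * (x * G h) * G (- (g + h)))"
    unfolding psi_def by (rule sum_Sym_right[OF assms, symmetric])
  also have "\<dots> = psi A (G h * x)"
    by (simp add: psi_def G_plus G_minus minus_add mult.assoc)
  finally show ?thesis ..
qed

lemma phi_G_mult: 
  assumes "h \<in> Sym A" shows "phi A (G h * x) = scl (sg h) (phi A (x * G h))"
proof -
  have "phi A (x * G h) = (\<Sum>g\<in>Sym A. scl (sg (g + h)) (G (g + h) * (x * G h) * G (- (g + h))))"
    unfolding phi_def by (rule sum_Sym_right[OF assms, symmetric])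
  also have "\<dots> = scl (sg h) (phi A (G h * x))"
    by (simp add: phi_def G_plus G_minus minus_add mult.assoc scl_sum mult.commute[of "sg h"])
  finally show ?thesis by (simp add: scl_scl)
qed

lemma psi_commute: "finite A \<Longrightarrow> x \<in> Alg A \<Longrightarrow> psi A (x * y) = psi A (y * x)"
  by (induction rule: Alg_induct)
    (simp_all add: psi_G_mult distrib_left distrib_right psi_add psi_scl mult.assoc)

text \<open>A factor carried around the twisted sum picks up the sign automorphism. In this way an
  antisymmetrizer on the left becomes a symmetrizer on the right, see
  \<open>phi_alternating\<close>.\<close>

lemma phi_commute: "finite A \<Longrightarrow> x \<in> Alg A \<Longrightarrow> phi A (x * y) = phi A (y * eps x)"
  by (induction rule: Alg_induct)
    (simp_all add: phi_G_mult distrib_left distrib_right phi_add phi_scl mult.assoc)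

lemma G_psi: 
  assumes "h \<in> Sym A" shows "G h * psi A x = psi A x * G h"
proof -
  have "psi A x = (\<Sum>g\<in>Sym A. G (h + g) * x * G (- (h + g)))"
    unfolding psi_def by (rule sum_Sym_left[OF assms, symmetric])
  also have "\<dots> = G h * psi A x * G (- h)"
    by (simp add: psi_def G_plus G_minus minus_add mult.assoc sum_distrib_left sum_distrib_right)
  finally have "psi A x * G h = G h * psi A x * G (- h) * G h" by simp
  then show ?thesis by (simp add: mult.assoc)
qed

lemma G_phi: 
  assumes "h \<in> Sym A" shows "G h * phi A x = scl (sg h) (phi A x * G h)"
proof -
  have "phi A x = (\<Sum>g\<in>Sym A. scl (sg (h + g)) (G (h + g) * x * G (- (h + g))))"
    unfolding phi_def by (rule sum_Sym_left[OF assms, symmetric])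
  also have "\<dots> = scl (sg h) (G h * phi A x * G (- h))"
    by (simp add: phi_def G_plus G_minus minus_add mult.assoc sum_distrib_left sum_distrib_right scl_sum)
  finally have "scl (sg h) (phi A x * G h) = scl (sg h) ((scl (sg h) (G h * phi A x * G (- h))) * G h)" by simp
  also have "\<dots> = G h * phi A x" by (simp add: mult.assoc)
  finally show ?thesis ..
qed

lemma psi_central: "finite A \<Longrightarrow> x \<in> Alg A \<Longrightarrow> x * psi A y = psi A y * x"
  by (induction rule: Alg_induct) (simp_all add: G_psi distrib_left distrib_right mult.assoc)

lemma psi_mult_central:
  assumes "finite A" "\<And>x. x \<in> Alg A \<Longrightarrow> x * z = z * x"
  shows "psi A (x * z) = psi A x * z" "psi A (z * x) = z * psi A x"
proof -
  have c: "G g * z = z * G g" if "g \<in> Sym A" for g using assms that by (simp add: Alg_G)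
  show "psi A (x * z) = psi A x * z"
    unfolding psi_def sum_distrib_right
    by (rule sum.cong) (simp_all add: mult.assoc c)
  show "psi A (z * x) = z * psi A x"
    unfolding psi_def sum_distrib_left
    by (rule sum.cong) (simp_all add: mult.assoc[symmetric] c)
qed

lemma phi_mult_central:
  assumes "finite A" "\<And>x. x \<in> Alg A \<Longrightarrow> x * z = z * x"
  shows "phi A (z * x) = z * phi A x"
proof -
  have c: "G g * z = z * G g" if "g \<in> Sym A" for g using assms that by (simp add: Alg_G)
  show "phi A (z * x) = z * phi A x"
    unfolding phi_def sum_distrib_left
    by (rule sum.cong) (simp_all add: c flip: mult.assoc)
qed

section \<open>Young symmetrizers\<close>

definition ssum :: "fperm set \<Rightarrow> ga" where "ssum H = (\<Sum>g\<in>H. G g)"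
definition asum :: "fperm set \<Rightarrow> ga" where "asum H = (\<Sum>g\<in>H. scl (sg g) (G g))"

definition subgrp :: "nat set \<Rightarrow> fperm set \<Rightarrow> bool" where
  "subgrp A H \<longleftrightarrow> finite A \<and> H \<subseteq> Sym A \<and> 0 \<in> H \<and> (\<forall>g\<in>H. \<forall>h\<in>H. g + h \<in> H) \<and> (\<forall>g\<in>H. - g \<in> H)"

lemma subgrpD:
  assumes "subgrp A H"
  shows "finite A" "finite H" "H \<subseteq> Sym A" "0 \<in> H" "g \<in> H \<Longrightarrow> h \<in> H \<Longrightarrow> g + h \<in> H"
    "g \<in> H \<Longrightarrow> - g \<in> H" "g \<in> H \<Longrightarrow> g \<in> Sym A" "card H > 0"
  using assms finite_subset[of H "Sym A"] by (auto simp: subgrp_def card_gt_0_iff)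

lemma sum_subgrp_left: "subgrp A H \<Longrightarrow> h \<in> H \<Longrightarrow> (\<Sum>g\<in>H. f (h + g)) = sum f H"
  by (rule sum.reindex_bij_witness[of _ "\<lambda>g. - h + g" "\<lambda>g. h + g"])
    (auto simp: subgrpD add.assoc[symmetric])

lemma sum_subgrp_right: "subgrp A H \<Longrightarrow> h \<in> H \<Longrightarrow> (\<Sum>g\<in>H. f (g + h)) = sum f H"
  by (rule sum.reindex_bij_witness[of _ "\<lambda>g. g + - h" "\<lambda>g. g + h"])
    (auto simp: subgrpD add.assoc simp del: add_uminus_conv_diff)

lemma sum_subgrp_uminus: "subgrp A H \<Longrightarrow> (\<Sum>g\<in>H. f (- g)) = sum f H"
  by (rule sum.reindex_bij_witness[of _ uminus uminus]) (auto simp: subgrpD)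

lemma ssum_Alg: "subgrp A H \<Longrightarrow> ssum H \<in> Alg A"
  unfolding ssum_def by (intro Alg_sum Alg_G) (auto dest: subgrpD)

lemma asum_Alg: "subgrp A H \<Longrightarrow> asum H \<in> Alg A"
  unfolding asum_def by (intro Alg_sum Alg_scl Alg_G) (auto dest: subgrpD)

lemma G_ssum:
  assumes "subgrp A H" "h \<in> H" shows "G h * ssum H = ssum H" "ssum H * G h = ssum H"
  using sum_subgrp_left[OF assms, of G] sum_subgrp_right[OF assms, of G]
  by (simp_all add: ssum_def sum_distrib_left sum_distrib_right flip: G_plus)

lemma G_asum:
  assumes "subgrp A H" "h \<in> H" shows "G h * asum H = scl (sg h) (asum H)" "asum H * G h = scl (sg h) (asum H)"
proof -
  have "scl (sg h) (asum H) = scl (sg h) (\<Sum>g\<in>H. scl (sg (h + g)) (G (h + g)))"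
    unfolding asum_def by (subst sum_subgrp_left[OF assms]) simp
  then show "G h * asum H = scl (sg h) (asum H)"
    by (simp add: asum_def sum_distrib_left scl_sum G_plus)
  have "scl (sg h) (asum H) = scl (sg h) (\<Sum>g\<in>H. scl (sg (g + h)) (G (g + h)))"
    unfolding asum_def by (subst sum_subgrp_right[OF assms]) simp
  then show "asum H * G h = scl (sg h) (asum H)"
    by (simp add: asum_def sum_distrib_right scl_sum G_plus mult.commute[of "sg h"] mult.assoc)
qed

lemma ssum_ssum: 
  assumes "subgrp A H" shows "ssum H * ssum H = scl (of_nat (card H)) (ssum H)"
proof -
  have "ssum H * ssum H = (\<Sum>h\<in>H. G h * ssum H)"
    by (subst ssum_def) (simp add: sum_distrib_right)
  also have "\<dots> = (\<Sum>h\<in>H. scl 1 (ssum H))" using G_ssum[OF assms] by simp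
  also have "\<dots> = scl (of_nat (card H)) (ssum H)" by (simp only: scl_sum_left[symmetric]) simp
  finally show ?thesis .
qed

lemma ssum_ssum_sub: 
  assumes "subgrp A H" "subgrp A K" "K \<subseteq> H" shows "ssum K * ssum H = scl (of_nat (card K)) (ssum H)"
proof -
  have "ssum K * ssum H = (\<Sum>h\<in>K. G h * ssum H)"
    by (subst ssum_def) (simp add: sum_distrib_right)
  also have "\<dots> = (\<Sum>h\<in>K. scl 1 (ssum H))" using G_ssum[OF assms(1)] assms(3) by (intro sum.cong) auto
  also have "\<dots> = scl (of_nat (card K)) (ssum H)" by (simp only: scl_sum_left[symmetric]) simp
  finally show ?thesis .
qed

lemma asum_asum: 
  assumes "subgrp A H" shows "asum H * asum H = scl (of_nat (card H)) (asum H)"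
proof -
  have "asum H * asum H = (\<Sum>h\<in>H. scl (sg h) (G h * asum H))"
    by (subst asum_def) (simp add: sum_distrib_right)
  also have "\<dots> = (\<Sum>h\<in>H. scl 1 (asum H))" using G_asum[OF assms] by simp
  also have "\<dots> = scl (of_nat (card H)) (asum H)" by (simp only: scl_sum_left[symmetric]) simp
  finally show ?thesis .
qed

lemma star_ssum: "subgrp A H \<Longrightarrow> star (ssum H) = ssum H"
  using sum_subgrp_uminus[of A H G] by (simp add: ssum_def star_sum)

lemma star_asum: "subgrp A H \<Longrightarrow> star (asum H) = asum H"
  using sum_subgrp_uminus[of A H "\<lambda>g. scl (sg g) (G g)"] by (simp add: asum_def star_sum)

lemma eps_ssum [simp]: "eps (ssum H) = asum H" and eps_asum [simp]: "eps (asum H) = ssum H"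
  by (simp_all add: ssum_def asum_def eps_sum)

lemma lk_asum: "finite H \<Longrightarrow> lk (asum H) g = (if g \<in> H then sg g else 0)"
  by (simp add: asum_def lookup_sum lk_G if_distrib[of "(*) _"] sum.delta cong: if_cong)

text \<open>Young subgroups are encoded by a labelling of the points. A transposition then belongs
  to the group as soon as its two points carry the same label, and row groups, column groups and the
  groups of hook arms are all instances.\<close>

definition Stab :: "nat set \<Rightarrow> (nat \<Rightarrow> 'b) \<Rightarrow> fperm set" where
  "Stab A f = {g \<in> Sym A. \<forall>x\<in>A. f (ap g x) = f x}"

lemma subgrp_Stab: "finite A \<Longrightarrow> subgrp A (Stab A f)"
proof -
  assume A: "finite A"
  have "f (ap (- g) x) = f x" if "g \<in> Stab A f" "x \<in> A" for g x
    using that Sym_in[of "- g" A x] by (auto simp: Stab_def)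
  then show ?thesis using A by (auto simp: subgrp_def Stab_def Sym_plus Sym_in)
qed

lemma StabD: "g \<in> Stab A f \<Longrightarrow> x \<in> A \<Longrightarrow> f (ap g x) = f x" "g \<in> Stab A f \<Longrightarrow> g \<in> Sym A"
  by (auto simp: Stab_def)

lemma transp_Stab: "x \<in> A \<Longrightarrow> y \<in> A \<Longrightarrow> f x = f y \<Longrightarrow> transp x y \<in> Stab A f"
  by (auto simp: Stab_def transp_Sym ap_transp Transposition.transpose_def)

lemma eq_uminus_zero: "(x :: ga) = - x \<Longrightarrow> x = 0"
proof -
  assume "x = - x"
  then have "lk x g = - lk x g" for g by (metis lookup_uminus)
  then show "x = 0" by (intro poly_mapping_eqI) simp
qed

text \<open>The transposition is absorbed by \<open>ssum H\<close> with factor 1; carried through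
  \<open>G g\<close> it is absorbed by \<open>asum K\<close> with factor -1.\<close>

lemma ssum_asum_zero:
  assumes "subgrp A H" "subgrp A K" "transp x y \<in> H" "transp (ap (- g) x) (ap (- g) y) \<in> K" "x \<noteq> y"
  shows "ssum H * G g * asum K = 0"
proof -
  have "ssum H * G g * asum K = ssum H * G (transp x y) * G g * asum K"
    using G_ssum[OF assms(1,3)] by simp
  also have "G (transp x y) * G g = G g * G (transp (ap (- g) x) (ap (- g) y))"
    using conj_transp[of g "ap (- g) x" "ap (- g) y"] by (simp flip: G_plus)
  then have "ssum H * G (transp x y) * G g * asum K = ssum H * G g * (G (transp (ap (- g) x) (ap (- g) y)) * asum K)"
    by (metis mult.assoc)
  also have "\<dots> = - (ssum H * G g * asum K)"
    using G_asum(1)[OF assms(2,4)] assms(5) by (simp add: sg_transp ap_uminus_eq_iff scl_minus1)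
  finally show ?thesis by (rule eq_uminus_zero)
qed

text \<open>Otherwise some \<open>x\<close> beyond the segment could be exchanged for a missing
  smaller \<open>y\<close>, and the sum would drop below the least sum possible for this
  cardinality.\<close>

lemma set_eq_initial_segment:
  assumes "finite (S :: nat set)" "\<Sum>S \<le> \<Sum>{0..<card S}"
  shows "S = {0..<card S}"
proof (rule ccontr)
  assume ne: "S \<noteq> {0..<card S}"
  have "\<not> S \<subseteq> {0..<card S}" using ne card_subset_eq[of "{0..<card S}" S] by auto
  then obtain x where x: "x \<in> S" "x \<ge> card S" by (meson atLeastLessThan_iff le0 not_le subsetI)
  have "\<not> {0..<card S} \<subseteq> S" using ne card_subset_eq[of S "{0..<card S}"] assms(1) by auto
  then obtain y where y: "y \<notin> S" "y < card S" by (meson atLeastLessThan_iff subsetI)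
  let ?S = "insert y (S - {x})"
  have "card ?S = card S" using x y assms(1) by (simp add: card.insert_remove card_Diff_singleton)
  then have "\<Sum>{0..<card S} \<le> \<Sum>?S" using card_sum_le_nat_sum[of ?S] by simp
  moreover have "\<Sum>?S + x = \<Sum>S + y"
    using x y assms(1) by (simp add: sum.remove[of S x])
  ultimately show False using x y assms(2) by simp
qed

section \<open>Tableaux of an arbitrary diagram and the lemma of von Neumann\<close>

locale tableau =
  fixes n :: nat and D :: "(nat \<times> nat) set" and r k :: "nat \<Rightarrow> nat"
  assumes bij: "bij_betw (\<lambda>x. (r x, k x)) {0..<n} D"
    and row_down: "(i, j) \<in> D \<Longrightarrow> j' \<le> j \<Longrightarrow> (i, j') \<in> D"
    and col_down: "(i, j) \<in> D \<Longrightarrow> i' \<le> i \<Longrightarrow> (i', j) \<in> D"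
begin

abbreviation "A \<equiv> {0..<n}"
abbreviation "R \<equiv> Stab A r"
abbreviation "C \<equiv> Stab A k"
abbreviation "a \<equiv> ssum R"
abbreviation "b \<equiv> asum C"
abbreviation "c \<equiv> a * b"

lemma R: "subgrp A R" and C: "subgrp A C"
  by (simp_all add: subgrp_Stab)

lemma in_D: "x < n \<Longrightarrow> (r x, k x) \<in> D"
  using bij by (auto simp: bij_betw_def)

lemma D_cell: "(i, j) \<in> D \<Longrightarrow> \<exists>x<n. r x = i \<and> k x = j"
  using bij by (auto simp: bij_betw_def image_iff)

lemma cell_eq: "x < n \<Longrightarrow> y < n \<Longrightarrow> r x = r y \<Longrightarrow> k x = k y \<Longrightarrow> x = y"
  using bij by (auto simp: bij_betw_def inj_on_def)

lemma finite_D: "finite D"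
  using bij bij_betw_finite by blast

lemma card_D: "card D = n"
  using bij_betw_same_card[OF bij] by simp

definition row :: "nat \<Rightarrow> nat set" where "row i = {x. x < n \<and> r x = i}"

lemma finite_row [simp]: "finite (row i)"
  by (auto simp: row_def)

lemma k_inj_row: "inj_on k (row i)"
  by (auto simp: inj_on_def row_def intro: cell_eq)

lemma k_row: "k ` row i = {0..<card (row i)}"
proof -
  have 1: "j' \<in> k ` row i" if "j \<in> k ` row i" "j' \<le> j" for j j'
  proof -
    from that(1) obtain x where x: "x < n" "r x = i" "k x = j" by (auto simp: row_def)
    then have "(i, j') \<in> D" using in_D[of x] row_down that(2) by auto
    then obtain y where "y < n" "r y = i" "k y = j'" using D_cell by blast
    then show ?thesis by (auto simp: row_def)
  qed
  have fin: "finite (k ` row i)" by simp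
  obtain m where "k ` row i = {0..<m}"
  proof -
    have "\<exists>m. k ` row i = {0..<m}"
    proof (cases "k ` row i = {}")
      case False
      have "k ` row i = {0..<Suc (Max (k ` row i))}"
      proof
        show "k ` row i \<subseteq> {0..<Suc (Max (k ` row i))}"
          using Max_ge[OF fin] by (auto simp del: Max_less_iff simp: less_Suc_eq_le)
        show "{0..<Suc (Max (k ` row i))} \<subseteq> k ` row i"
          using 1[OF Max_in[OF fin False]] by (auto simp: less_Suc_eq_le)
      qed
      then show ?thesis ..
    qed auto
    then show ?thesis using that by blast
  qed
  then show ?thesis using card_image[OF k_inj_row[of i]] by simp
qed

lemma row_cell: "j < card (row i) \<longleftrightarrow> (i, j) \<in> D"
proof -
  have "j < card (row i) \<longleftrightarrow> j \<in> k ` row i" by (simp add: k_row)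
  also have "\<dots> \<longleftrightarrow> (i, j) \<in> D" using in_D D_cell[of i j] by (auto simp: row_def)
  finally show ?thesis .
qed

text \<open>A numerical substitute for the dominance order. In each row the labels \<open>kk\<close>
  are distinct, so their sum is at least that of an initial segment, which is the sum of
  \<open>k\<close>. The bound on the total forces equality in every row, and then each row is
  labelled by an initial segment.\<close>

lemma dominant_columns:
  assumes inj: "inj_on (\<lambda>x. (r x, kk x)) A" and le: "sum kk A \<le> sum k A"
  shows "bij_betw (\<lambda>x. (r x, kk x)) A D"
proof -
  have kk_inj: "inj_on kk (row i)" for i
    using inj by (auto simp: inj_on_def row_def)
  have A: "A = (\<Union>i\<in>r ` A. row i)" by (auto simp: row_def)
  have sumA: "sum f A = (\<Sum>i\<in>r ` A. sum f (row i))" for f :: "nat \<Rightarrow> nat"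
    by (subst A, rule sum.UNION_disjoint) (auto simp: row_def)
  have k_sum: "sum k (row i) = \<Sum>{0..<card (row i)}" for i
    using sum.reindex[OF k_inj_row[of i], of id] k_row[of i] by simp
  have kk_sum: "sum kk (row i) = \<Sum>(kk ` row i)" for i
    using sum.reindex[OF kk_inj[of i], of id] by simp
  have card_kk: "card (kk ` row i) = card (row i)" for i
    by (rule card_image[OF kk_inj])
  have ge: "sum k (row i) \<le> sum kk (row i)" for i
    unfolding k_sum kk_sum using card_sum_le_nat_sum[of "kk ` row i"] by (simp add: card_kk)
  have eq: "sum kk (row i) \<le> sum k (row i)" if "i \<in> r ` A" for i
  proof (rule ccontr)
    assume "\<not> ?thesis"
    then have "sum k A < sum kk A"
      unfolding sumA by (intro sum_strict_mono_ex1) (use that ge in \<open>auto simp: not_le\<close>)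
    then show False using le by simp
  qed
  have kk_row: "kk ` row i = {0..<card (row i)}" if "i \<in> r ` A" for i
    using set_eq_initial_segment[of "kk ` row i"] eq[OF that] by (simp add: card_kk k_sum kk_sum)
  have "(\<lambda>x. (r x, kk x)) ` A \<subseteq> D"
  proof clarsimp
    fix x assume "x < n"
    then have "kk x < card (row (r x))" using kk_row[of "r x"] by (force simp: row_def)
    then show "(r x, kk x) \<in> D" using row_cell by simp
  qed
  moreover have "card ((\<lambda>x. (r x, kk x)) ` A) = card D"
    using card_image[OF inj] card_D by simp
  ultimately show ?thesis
    using inj card_subset_eq[OF finite_D] by (simp add: bij_betw_def)
qed

lemma R_Int_C: "g \<in> R \<Longrightarrow> g \<in> C \<Longrightarrow> g = 0"
proof (rule Sym_eqI[of _ A])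
  fix x assume "g \<in> R" "g \<in> C" "x \<in> A"
  then show "ap g x = ap 0 x" using Sym_in[of g A x] by (auto simp: Stab_def intro: cell_eq)
qed (auto simp: Stab_def)

text \<open>By the injectivity assumption no two points of a row share a column of the tableau moved
  by \<open>g\<close>. By \<open>dominant_columns\<close> the moved column labels fill the diagram
  again; \<open>p\<close> rearranges each row so that the moved labels agree with \<open>k\<close>,
  which puts \<open>- g + p\<close> into \<open>C\<close>.\<close>

lemma row_column_factor:
  assumes g: "g \<in> Sym A" and inj: "inj_on (\<lambda>x. (r x, k (ap (- g) x))) A"
  obtains p q where "p \<in> R" "q \<in> C" "g = p + q"
proof -
  have "sum (\<lambda>x. k (ap (- g) x)) A = sum k A"
    using sum.reindex_bij_betw[OF bij_betw_Sym[of "- g" A], of k] g by simp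
  then have bij': "bij_betw (\<lambda>x. (r x, k (ap (- g) x))) A D"
    using dominant_columns[OF inj] by simp
  have "bij_betw (inv_into A (\<lambda>x. (r x, k (ap (- g) x))) \<circ> (\<lambda>x. (r x, k x))) A A"
    by (rule bij_betw_trans[OF bij bij_betw_inv_into[OF bij']])
  from fperm_of_bij[OF finite_atLeastLessThan this] obtain p where p: "p \<in> Sym A"
    "\<And>x. x \<in> A \<Longrightarrow> ap p x = inv_into A (\<lambda>x. (r x, k (ap (- g) x))) (r x, k x)"
    unfolding comp_apply by blast
  have p': "(r (ap p x), k (ap (- g) (ap p x))) = (r x, k x)" if "x \<in> A" for x
    using bij_betw_inv_into_right[OF bij', of "(r x, k x)"] in_D[of x] that p(2) by auto
  have pR: "p \<in> R" using p' p(1) by (auto simp: Stab_def)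
  have "- g + p \<in> C" using p' p(1) g by (auto simp: Stab_def Sym_plus)
  then have "- (- g + p) \<in> C" by (rule subgrpD(6)[OF C])
  moreover have "g = p + - (- g + p)" by (simp add: minus_add flip: add.assoc)
  ultimately show ?thesis using that[OF pR] by blast
qed

text \<open>Either \<open>g\<close> factors through rows and columns and both factors are absorbed,
  or two points of one row share a moved column and their transposition kills the product.\<close>

lemma von_Neumann_G:
  assumes "g \<in> Sym A" shows "\<exists>s. a * G g * b = scl s c"
proof (cases "inj_on (\<lambda>x. (r x, k (ap (- g) x))) A")
  case True
  then obtain p q where pq: "p \<in> R" "q \<in> C" "g = p + q"
    using row_column_factor[OF assms] by blast
  then have "a * G g * b = (a * G p) * (G q * b)" by (simp add: G_plus mult.assoc)
  also have "\<dots> = scl (sg q) c" using G_ssum[OF R pq(1)] G_asum[OF C pq(2)] by simp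
  finally show ?thesis by blast
next
  case False
  then obtain x y where "x \<in> A" "y \<in> A" "x \<noteq> y" "r x = r y" "k (ap (- g) x) = k (ap (- g) y)"
    by (auto simp: inj_on_def)
  then have "a * G g * b = 0" using assms
    by (intro ssum_asum_zero[OF R C] transp_Stab) (simp_all add: Sym_in del: atLeastLessThan_iff)
  then show ?thesis by (auto intro: exI[of _ 0])
qed

lemma tau_c [simp]: "tau c = 1"
proof -
  have "tau c = (\<Sum>p\<in>R. lk b (- p))"
    by (subst ssum_def) (simp add: sum_distrib_right tau_sum tau_mult_G)
  also have "\<dots> = (\<Sum>p\<in>R. if p = 0 then 1 else 0)"
  proof (intro sum.cong refl)
    fix p assume "p \<in> R"
    then have "- p \<in> C \<longleftrightarrow> p = 0"
      using R_Int_C[of "- p"] subgrpD(6)[OF R] subgrpD(4)[OF C] by auto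
    then show "lk b (- p) = (if p = 0 then 1 else 0)"
      by (simp add: lk_asum subgrpD(2)[OF C])
  qed
  also have "\<dots> = 1" using subgrpD(2,4)[OF R] by simp
  finally show ?thesis .
qed

lemma von_Neumann:
  assumes "x \<in> Alg A" shows "a * x * b = scl (tau (a * x * b)) c"
proof -
  have "\<exists>s. a * x * b = scl s c"
    using finite_atLeastLessThan[of 0 n] assms
  proof (induction rule: Alg_induct)
    case (add x y)
    then obtain s t where "a * x * b = scl s c" "a * y * b = scl t c" by blast
    then show ?case by (intro exI[of _ "s + t"]) (simp add: distrib_left distrib_right scl_add_left)
  next
    case (scale d x)
    then obtain s where "a * x * b = scl s c" by blast
    then show ?case by (intro exI[of _ "d * s"]) simp
  qed (rule von_Neumann_G)
  then obtain s where s: "a * x * b = scl s c" by blast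
  then have "tau (a * x * b) = s" by simp
  then show ?thesis using s by simp
qed

text \<open>The scalar in \<open>c * c = scl kap c\<close>. It equals \<open>fact n\<close> divided
  by the degree of the character: by \<open>tau_X\<close> the character element has the value
  \<open>fact n / kap\<close> at the identity.\<close>

definition kap :: complex where "kap = tau (c * c)"

lemma a_Alg: "a \<in> Alg A" and b_Alg: "b \<in> Alg A" and c_Alg: "c \<in> Alg A"
  by (simp_all add: ssum_Alg[OF R] asum_Alg[OF C] Alg_mult)

lemma c_c: "c * c = scl kap c"
  using von_Neumann[of "b * a"] by (simp add: a_Alg b_Alg Alg_mult kap_def mult.assoc)

lemma c_nonzero: "c \<noteq> 0"
  by (metis tau_c tau_zero zero_neq_one)

lemma star_c: "star c = b * a"
  by (simp add: star_mult star_ssum[OF R] star_asum[OF C])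

text \<open>Positivity is used twice. If \<open>c * c = 0\<close>, then \<open>z = a * b * a\<close>
  satisfies \<open>z * star z = 0\<close>, so \<open>z = 0\<close>; but \<open>c * star c\<close> is
  a multiple of \<open>z\<close>, so \<open>c = 0\<close>.\<close>

lemma kap_nonzero: "kap \<noteq> 0"
proof
  assume "kap = 0"
  then have cc: "a * b * (a * b) = 0" using c_c by simp
  let ?z = "a * b * a"
  have "?z * star ?z = a * b * (a * a) * (b * a)"
    by (simp add: star_mult star_ssum[OF R] star_asum[OF C] mult.assoc)
  also have "\<dots> = scl (of_nat (card R)) ((a * b * (a * b)) * a)"
    by (simp add: ssum_ssum[OF R] mult.assoc)
  also have "\<dots> = 0" by (simp add: cc)
  finally have z: "?z = 0" by (intro tau_mult_star_eq_0) simp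
  have "c * star c = a * (b * b) * a"
    by (simp add: star_c mult.assoc)
  also have "\<dots> = scl (of_nat (card C)) ?z"
    by (simp add: asum_asum[OF C] mult.assoc)
  also have "\<dots> = 0" by (simp add: z)
  finally have "c = 0" by (intro tau_mult_star_eq_0) simp
  then show False using c_nonzero by simp
qed

text \<open>The irreducible character as an element of the group algebra. Since
  \<open>b * a = star c\<close>, this form has the coefficients of \<open>c\<close> at inverse
  elements, as the trace on the left ideal produces them in \<open>trace_left_ideal\<close>;
  averaging \<open>c\<close> gives the same element by \<open>X_eq\<close>.\<close>

definition X :: ga where "X = scl (1 / kap) (psi A (b * a))"

lemma X_central: "x \<in> Alg A \<Longrightarrow> x * X = X * x"
  by (simp add: X_def psi_central)

lemma X_eq: "X = scl (1 / kap) (psi A c)"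
  by (simp add: X_def psi_commute[OF _ b_Alg])

lemma X_Alg: "X \<in> Alg A"
  by (simp add: X_def Alg_scl psi_Alg Alg_mult a_Alg b_Alg)

text \<open>By von Neumann each \<open>c * G g * c\<close> is \<open>kap * lk c (- g)\<close> times
  \<open>c\<close>. Summing these terms times \<open>G (- g)\<close> reassembles the second factor
  of \<open>c * c\<close> from its coefficients.\<close>

lemma c_X: "c * X = scl kap c"
proof -
  have term_eq: "c * (G g * c * G (- g)) = scl (kap * lk c (- g)) (c * G (- g))" if "g \<in> Sym A" for g
  proof -
    have "tau (a * (b * G g * a) * b) = tau (G g * (c * c))"
      using tau_commute[of "a * b" "G g * (a * b)"] by (simp add: mult.assoc)
    also have "\<dots> = kap * lk c (- g)" by (simp add: c_c tau_mult_G)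
    finally have "a * (b * G g * a) * b = scl (kap * lk c (- g)) c"
      using von_Neumann[of "b * G g * a"] that by (simp add: a_Alg b_Alg Alg_mult Alg_G)
    then have "a * (b * G g * a) * b * G (- g) = scl (kap * lk c (- g)) (c * G (- g))" by simp
    then show ?thesis by (simp add: mult.assoc)
  qed
  have "c * X = (\<Sum>g\<in>Sym A. scl (lk c (- g)) (c * G (- g)))"
    using kap_nonzero by (simp add: X_eq psi_def sum_distrib_left term_eq scl_sum del: lk_mult_G lk_G_mult)
  also have "\<dots> = (\<Sum>g\<in>Sym A. scl (lk c g) (c * G g))"
    by (rule sum_Sym_uminus)
  also have "\<dots> = c * (\<Sum>g\<in>Sym A. scl (lk c g) (G g))"
    by (simp add: sum_distrib_left)
  also have "\<dots> = c * c"
    by (simp only: Alg_expand[OF finite_atLeastLessThan c_Alg, symmetric])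
  finally show ?thesis by (simp add: c_c)
qed

lemma X_X: "X * X = scl kap X"
proof -
  have "X * X = scl (1 / kap) (psi A c * X)"
    by (subst (1) X_eq) simp
  also have "psi A c * X = psi A (c * X)"
    by (rule psi_mult_central(1)[OF finite_atLeastLessThan X_central, symmetric])
  also have "scl (1 / kap) (psi A (c * X)) = scl kap X"
    unfolding c_X psi_scl by (subst X_eq) (simp add: mult.commute)
  finally show ?thesis .
qed

text \<open>Since \<open>X\<close> is central, \<open>b * (c * X) * a = X * (b * c * a)\<close>, and
  \<open>b * c * a = star (c * c)\<close> is a nonzero multiple of \<open>b * a\<close>.\<close>

lemma X_ba: "X * (b * a) = scl kap (b * a)"
proof -
  have "b * (c * X) * a = scl kap (b * c * a)" by (simp add: c_X)
  moreover have "b * c * a = star (c * c)"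
    by (simp add: star_mult star_ssum[OF R] star_asum[OF C] mult.assoc)
  moreover have "b * (c * X) * a = X * (b * c * a)"
    using X_central[of "b * c"] by (simp add: Alg_mult b_Alg a_Alg mult.assoc)
  ultimately have "scl (cnj kap) (X * (b * a)) = scl (cnj kap) (scl kap (b * a))"
    by (simp add: c_c star_c mult.commute)
  moreover have "cnj kap \<noteq> 0" using kap_nonzero by simp
  ultimately show ?thesis using scl_cancel by blast
qed

text \<open>A form of Schur's lemma. By von Neumann \<open>c * z * c\<close> is a multiple of
  \<open>c\<close>, and by centrality it is \<open>kap\<close> times \<open>c * z\<close>; so
  \<open>z\<close> acts on \<open>c\<close> by a scalar, and averaging \<open>c * z\<close> turns
  this into a multiple of \<open>X\<close>.\<close>

lemma central_in_block:
  assumes "z \<in> Alg A" "\<And>x. x \<in> Alg A \<Longrightarrow> x * z = z * x" "X * z = scl kap z"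
  shows "\<exists>s. z = scl s X"
proof -
  define s where "s = tau (a * (b * z * a) * b)"
  have "c * z * c = scl s c"
    using von_Neumann[of "b * z * a"] by (simp add: assms(1) a_Alg b_Alg Alg_mult s_def mult.assoc)
  moreover have "c * z * c = scl kap (c * z)"
  proof -
    have "c * z * c = z * (c * c)" by (subst assms(2)[OF c_Alg]) (rule mult.assoc)
    also have "\<dots> = scl kap (z * c)" unfolding c_c by simp
    finally show ?thesis using assms(2)[OF c_Alg] by simp
  qed
  ultimately have cz: "c * z = scl (s / kap) c"
    using kap_nonzero scl_cancel[of kap "c * z" "scl (s / kap) c"] by auto
  have "scl kap z = X * z" by (simp add: assms(3))
  also have "\<dots> = scl (1 / kap) (psi A c * z)" by (subst X_eq) simp
  also have "psi A c * z = psi A (c * z)"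
    by (rule psi_mult_central(1)[OF finite_atLeastLessThan assms(2), symmetric])
  also have "scl (1 / kap) (psi A (c * z)) = scl (s / kap) X"
    unfolding cz psi_scl by (subst X_eq) simp
  finally have "scl kap z = scl kap (scl (s / kap / kap) X)" using kap_nonzero by simp
  then have "z = scl (s / kap / kap) X" using kap_nonzero scl_cancel by blast
  then show ?thesis by blast
qed

lemma tau_X: "tau X = fact n / kap"
proof -
  have "tau (psi A c) = (\<Sum>g\<in>Sym A. tau c)"
    unfolding psi_def tau_sum by (rule sum.cong) (simp_all add: tau_commute[of _ "G (- _)"] del: tau_c)
  then show ?thesis by (simp add: X_eq card_Sym del: tau_c) (simp)
qed

end

section \<open>Twisted central elements\<close>

lemma initial_segment:
  fixes S :: "nat set"
  assumes "finite S" "\<And>i i'. i \<in> S \<Longrightarrow> i' \<le> i \<Longrightarrow> i' \<in> S"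
  shows "S = {0..<card S}"
proof (rule set_eq_initial_segment[OF assms(1)])
  show "\<Sum>S \<le> \<Sum>{0..<card S}"
  proof (cases "S = {}")
    case False
    have "S = {0..Max S}"
      using assms(2)[OF Max_in[OF assms(1) False]] Max_ge[OF assms(1)] by auto
    then obtain m where "S = {0..m}" by blast
    then show ?thesis by (simp add: atLeastLessThanSuc_atLeastAtMost)
  qed simp
qed

section \<open>Orthogonality of the blocks of different shapes\<close>

context tableau
begin

text \<open>Only column sizes enter the right-hand side, so two fillings with equally large columns
  have the same diagram.\<close>

lemma column_cells:
  assumes "bij_betw (\<lambda>x. (rr x, kk x)) A D"
  shows "(i, j) \<in> D \<longleftrightarrow> i < card {x \<in> A. kk x = j}"
proof -
  have "{i. (i, j) \<in> D} \<subseteq> fst ` D" by force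
  then have "finite {i. (i, j) \<in> D}" using finite_D by (meson finite_imageI finite_subset)
  then have "{i. (i, j) \<in> D} = {0..<card {i. (i, j) \<in> D}}"
    by (rule initial_segment) (auto intro: col_down)
  moreover have "bij_betw rr {x \<in> A. kk x = j} {i. (i, j) \<in> D}"
    using assms by (auto simp: bij_betw_def inj_on_def image_iff)
  ultimately have "{i. (i, j) \<in> D} = {0..<card {x \<in> A. kk x = j}}"
    using bij_betw_same_card by metis
  then show ?thesis by auto
qed

text \<open>If the moved columns of the second tableau met every row of the first at most once,
  \<open>dominant_columns\<close> would make them fill \<open>D\<close>. Moving does not change
  column sizes, so \<open>D = D'\<close> by \<open>column_cells\<close>. Hence a row and a moved
  column share two points, and their transposition kills the product.\<close>

lemma other_columns_zero:
  assumes D': "tableau n D' r' k'" "D \<noteq> D'" and le: "sum k' A \<le> sum k A" and g: "g \<in> Sym A"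
  shows "a * G g * asum (Stab A k') = 0"
proof (cases "inj_on (\<lambda>x. (r x, k' (ap (- g) x))) A")
  case True
  have g': "bij_betw (ap (- g)) A A" using bij_betw_Sym[of "- g" A] g by simp
  have "sum (\<lambda>x. k' (ap (- g) x)) A = sum k' A"
    using sum.reindex_bij_betw[OF g', of k'] by simp
  then have "bij_betw (\<lambda>x. (r x, k' (ap (- g) x))) A D"
    using dominant_columns[OF True] le by simp
  from column_cells[OF this] have D: "(i, j) \<in> D \<longleftrightarrow> i < card {x \<in> A. k' (ap (- g) x) = j}" for i j .
  have "bij_betw (ap (- g)) {x \<in> A. k' (ap (- g) x) = j} {x \<in> A. k' x = j}" for j
  proof (rule bij_betw_subset[OF g', of "{x \<in> A. k' (ap (- g) x) = j}", THEN bij_betw_cong[THEN iffD1, rotated]])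
    show "ap (- g) ` {x \<in> A. k' (ap (- g) x) = j} = {x \<in> A. k' x = j}" (is "?L = ?R")
    proof
      show "?L \<subseteq> ?R" using g' by (auto simp: bij_betw_def)
      show "?R \<subseteq> ?L"
      proof
        fix y assume "y \<in> ?R"
        then have "ap g y \<in> {x \<in> A. k' (ap (- g) x) = j}" using Sym_in[OF g, of y] by simp
        then have "ap (- g) (ap g y) \<in> ?L" by (rule imageI)
        then show "y \<in> ?L" by simp
      qed
    qed
  qed auto
  then have "card {x \<in> A. k' (ap (- g) x) = j} = card {x \<in> A. k' x = j}" for j
    by (rule bij_betw_same_card)
  then have "(i, j) \<in> D \<longleftrightarrow> (i, j) \<in> D'" for i j
    using D tableau.column_cells[OF D'(1) tableau.bij[OF D'(1)]] by simp
  then have "D = D'" by auto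
  then show ?thesis using D'(2) by simp
next
  case False
  then obtain x y where "x \<in> A" "y \<in> A" "x \<noteq> y" "r x = r y" "k' (ap (- g) x) = k' (ap (- g) y)"
    by (auto simp: inj_on_def)
  then show ?thesis using g
    by (intro ssum_asum_zero[OF R subgrp_Stab] transp_Stab) (simp_all add: Sym_in del: atLeastLessThan_iff)
qed

lemma other_columns_zero_Alg:
  assumes D': "tableau n D' r' k'" "D \<noteq> D'" and le: "sum k' A \<le> sum k A" and x: "x \<in> Alg A"
  shows "a * x * asum (Stab A k') = 0"
  using finite_atLeastLessThan[of 0 n] x
proof (induction rule: Alg_induct)
  case (G g)
  then show ?case by (rule other_columns_zero[OF D' le])
qed (simp_all add: distrib_left distrib_right)

end

text \<open>One of the two column sums is at most the other. In the second case the adjoint reverses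
  the product and exchanges the two shapes.\<close>

lemma blocks_orthogonal:
  assumes t: "tableau n D r k" and t': "tableau n D' r' k'" and "D \<noteq> D'" and x: "x \<in> Alg {0..<n}"
  shows "ssum (Stab {0..<n} r) * asum (Stab {0..<n} k) * x * (ssum (Stab {0..<n} r') * asum (Stab {0..<n} k')) = 0"
    (is "?a * ?b * x * (?a' * ?b') = 0")
proof (cases "sum k' {0..<n} \<le> sum k {0..<n}")
  case True
  have "?b * x * ?a' \<in> Alg {0..<n}"
    by (intro Alg_mult x ssum_Alg asum_Alg subgrp_Stab) auto
  then have "?a * (?b * x * ?a') * ?b' = 0"
    using tableau.other_columns_zero_Alg[OF t t' assms(3) True] by blast
  then show ?thesis by (simp add: mult.assoc)
next
  case False
  have "?a' * star x * ?b = 0"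
    using tableau.other_columns_zero_Alg[OF t' t, of "star x"] assms(3) False x by (auto intro: star_Alg)
  then have "star (?a' * star x * ?b) = 0" by simp
  then have "?b * x * ?a' = 0"
    by (simp add: star_mult star_ssum[OF subgrp_Stab] star_asum[OF subgrp_Stab] mult.assoc)
  then have "?a * (?b * x * ?a') * ?b' = 0" by simp
  then show ?thesis by (simp add: mult.assoc)
qed

section \<open>Elements that commute with permutations up to sign\<close>

definition twisted :: "nat set \<Rightarrow> ga \<Rightarrow> bool" where
  "twisted A y \<longleftrightarrow> y \<in> Alg A \<and> (\<forall>g\<in>Sym A. G g * y = scl (sg g) (y * G g))"

lemma twisted_Alg: "twisted A y \<Longrightarrow> y \<in> Alg A"
  by (simp add: twisted_def)

lemma twisted_phi: "x \<in> Alg A \<Longrightarrow> twisted A (phi A x)"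
  by (simp add: twisted_def phi_Alg G_phi)

lemma twisted_scl: "twisted A y \<Longrightarrow> twisted A (scl s y)"
  by (simp add: twisted_def Alg_scl mult.commute)

lemma twisted_mult_central:
  assumes "finite A" "twisted A y" "twisted A z" "x \<in> Alg A"
  shows "x * (y * z) = (y * z) * x"
  using assms(1,4)
proof (induction rule: Alg_induct)
  case (G g)
  have "G g * (y * z) = (G g * y) * z" by (simp add: mult.assoc)
  also have "\<dots> = scl (sg g) (y * (G g * z))" using assms(2) G by (simp add: twisted_def mult.assoc)
  also have "\<dots> = y * z * G g" using assms(3) G by (simp add: twisted_def mult.assoc)
  finally show ?case .
qed (simp_all add: distrib_left distrib_right)

lemma lk_twisted:
  assumes "twisted A y" "g \<in> Sym A"
  shows "lk y (g + h + - g) = sg g * lk y h"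
proof -
  have "lk (G g * y) (g + h) = lk (scl (sg g) (y * G g)) (g + h)"
    using assms by (simp add: twisted_def)
  then have "lk y h = sg g * lk y (g + h + - g)"
    by (simp flip: add.assoc)
  then show ?thesis by simp
qed

text \<open>\<open>phi_commute\<close> carries \<open>asum K\<close> to the right end as
  \<open>ssum K\<close>; there \<open>conj\<close> moves it across \<open>G w\<close> as another
  \<open>ssum H\<close>, which is absorbed.\<close>

lemma phi_alternating:
  assumes H: "subgrp A H" and K: "subgrp A K" and w: "w \<in> Sym A" and conj: "ssum H * G w = G w * ssum K"
  shows "phi A (asum K * ssum H * G w) = scl (of_nat (card H)) (phi A (ssum H * G w))"
proof -
  have "phi A (asum K * ssum H * G w) = phi A (asum K * (ssum H * G w))" by (simp add: mult.assoc)
  also have "\<dots> = phi A (ssum H * G w * eps (asum K))"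
    by (rule phi_commute[OF subgrpD(1)[OF H] asum_Alg[OF K]])
  also have "ssum H * G w * eps (asum K) = ssum H * (ssum H * G w)"
    by (simp only: eps_asum mult.assoc conj[symmetric])
  also have "\<dots> = scl (of_nat (card H)) (ssum H * G w)"
    by (simp add: ssum_ssum[OF H] flip: mult.assoc)
  finally show ?thesis by (simp add: phi_scl)
qed

section \<open>Symmetric diagrams and the element \<open>Y\<close>\<close>

locale sym_tableau = tableau +
  assumes sym: "(i, j) \<in> D \<Longrightarrow> (j, i) \<in> D"
begin

lemma ex_w: "\<exists>w\<in>Sym A. \<forall>x\<in>A. r (ap w x) = k x \<and> k (ap w x) = r x"
proof -
  have "bij_betw prod.swap D D"
    by (rule bij_betw_byWitness[of _ prod.swap]) (auto intro: sym)
  then have "bij_betw (inv_into A (\<lambda>x. (r x, k x)) \<circ> (prod.swap \<circ> (\<lambda>x. (r x, k x)))) A A"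
    by (intro bij_betw_trans[OF bij_betw_trans[OF bij] bij_betw_inv_into[OF bij]])
  from fperm_of_bij[OF finite_atLeastLessThan this]
  obtain w where w: "w \<in> Sym A" "\<And>x. x \<in> A \<Longrightarrow> ap w x = inv_into A (\<lambda>x. (r x, k x)) (k x, r x)"
    unfolding comp_apply swap_simp by blast
  have "(r (ap w x), k (ap w x)) = (k x, r x)" if "x \<in> A" for x
    using bij_betw_inv_into_right[OF bij, of "(k x, r x)"] in_D[of x] that w(2)[OF that] sym by auto
  then show ?thesis by (intro bexI[OF _ w(1)]) simp
qed

definition w :: fperm where "w = (SOME w. w \<in> Sym A \<and> (\<forall>x\<in>A. r (ap w x) = k x \<and> k (ap w x) = r x))"

lemma w: "w \<in> Sym A" "x < n \<Longrightarrow> r (ap w x) = k x" "x < n \<Longrightarrow> k (ap w x) = r x"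
proof -
  have "w \<in> Sym A \<and> (\<forall>x\<in>A. r (ap w x) = k x \<and> k (ap w x) = r x)"
    unfolding w_def by (rule someI_ex) (use ex_w in blast)
  then show "w \<in> Sym A" "x < n \<Longrightarrow> r (ap w x) = k x" "x < n \<Longrightarrow> k (ap w x) = r x" by auto
qed

lemma w_lt [simp]: "ap w x < n \<longleftrightarrow> x < n"
  using Sym_in[OF w(1), of x] by simp

lemma w_w: "w + w = 0"
  by (rule Sym_eqI[of _ A]) (auto intro: cell_eq simp: Sym_plus w)

lemma G_w_w [simp]: "G w * G w = 1" "G w * (G w * x) = x"
  using w_w by (simp_all add: G_mult_assoc flip: G_plus)

lemma R_w: "g \<in> Sym A \<Longrightarrow> w + g + w \<in> C \<longleftrightarrow> g \<in> R"
proof -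
  assume g: "g \<in> Sym A"
  have lt: "ap g x < n \<longleftrightarrow> x < n" for x using Sym_in[OF g, of x] by simp
  have "w + g + w \<in> C \<longleftrightarrow> (\<forall>x\<in>A. r (ap g (ap w x)) = r (ap w x))"
    using g by (auto simp: Stab_def Sym_plus w lt)
  also have "\<dots> \<longleftrightarrow> (\<forall>x\<in>A. r (ap g x) = r x)"
  proof (intro iffI ballI)
    fix x assume *: "\<forall>x\<in>A. r (ap g (ap w x)) = r (ap w x)" "x \<in> A"
    have "ap w (ap w x) = x" using w_w by (metis ap_plus_apply ap_zero id_apply)
    then show "r (ap g x) = r x" using bspec[OF *(1), of "ap w x"] *(2) by simp
  qed simp
  finally show ?thesis using g by (simp add: Stab_def)
qed

lemma a_w: "a * G w = G w * ssum C"
proof -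
  have 1: "w + h + w \<in> R" if "h \<in> C" for h
  proof -
    have "w + (w + h + w) + w = h" using w_w by (metis add.assoc add_0_left add_0_right)
    then show ?thesis using R_w[of "w + h + w"] that w(1) by (simp add: Stab_def Sym_plus)
  qed
  have "(\<Sum>g\<in>R. G (g + w)) = (\<Sum>h\<in>C. G (w + h))"
  proof (rule sum.reindex_bij_witness[of _ "\<lambda>h. w + h + w" "\<lambda>g. w + g + w"])
    fix g assume "g \<in> R"
    then show "w + g + w \<in> C" using R_w by (auto simp: Stab_def)
    show "w + (w + g + w) + w = g" using w_w by (metis add.assoc add_0_left add_0_right)
    have "w + (w + g + w) = g + w" using w_w by (metis add.assoc add_0_left)
    then show "G (w + (w + g + w)) = G (g + w)" by simp
  next
    fix h assume "h \<in> C"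
    then show "w + h + w \<in> R" by (rule 1)
    show "w + (w + h + w) + w = h" using w_w by (metis add.assoc add_0_left add_0_right)
  qed
  then show ?thesis by (simp add: ssum_def sum_distrib_left sum_distrib_right G_plus)
qed

lemma w_b: "G w * b = asum R * G w"
proof -
  have "eps (a * G w) = eps (G w * ssum C)" by (simp add: a_w)
  then have "scl (sg w) (asum R * G w) = scl (sg w) (G w * b)"
    by (simp add: eps_mult)
  then show ?thesis using scl_cancel[OF sg_nonzero] by metis
qed

definition Y :: ga where "Y = phi A (a * G w)"

lemma w_Alg: "G w \<in> Alg A"
  by (rule Alg_G[OF w(1)])

lemma twisted_Y: "twisted A Y"
  unfolding Y_def by (intro twisted_phi Alg_mult a_Alg w_Alg)

lemma phi_baw: "phi A (b * a * G w) = scl (of_nat (card R)) Y"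
  unfolding Y_def by (rule phi_alternating[OF R C w(1) a_w])

lemma card_R_nonzero: "(of_nat (card R) :: complex) \<noteq> 0"
  using subgrpD(8)[OF R] by simp

text \<open>\<open>X_ba\<close> provides the eigenvalue on \<open>b * a\<close>, whereas
  \<open>Y\<close> is built from \<open>a\<close> alone; \<open>phi_baw\<close> inserts the missing
  \<open>b\<close> at the price of a nonzero factor.\<close>

lemma X_Y: "X * Y = scl kap Y"
proof -
  have "X * phi A (b * a * G w) = phi A (X * (b * a * G w))"
    by (rule phi_mult_central[symmetric]) (simp_all add: X_central)
  also have "X * (b * a * G w) = scl kap (b * a * G w)"
    using X_ba by (metis mult.assoc scl_mult)
  finally have "scl (of_nat (card R)) (X * Y) = scl (of_nat (card R)) (scl kap Y)"
    by (simp add: phi_baw phi_scl mult.commute)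
  then show ?thesis using scl_cancel[OF card_R_nonzero] by blast
qed

text \<open>Multiply \<open>phi A (b * a * G w)\<close> by \<open>a\<close> on the left and by
  \<open>G w * b\<close> on the right. Every summand becomes a product of two von Neumann scalars
  that are complex conjugates of each other, so the result is \<open>kap\<close> times a sum of
  squares times \<open>c\<close>, and the square at the identity is 1.\<close>

lemma Y_nonzero: "Y \<noteq> 0"
proof
  assume Y0: "Y = 0"
  define l where "l t = tau (a * G t * b)" for t
  have l: "a * G t * b = scl (l t) c" if "t \<in> Sym A" for t
    unfolding l_def using that by (intro von_Neumann Alg_G)
  \<comment> \<open>The adjoint of \<open>l\<close> has the symmetrizers in the wrong order.
    Conjugation by \<open>w\<close> exchanges rows and columns, and the sign automorphism then
    restores \<open>a\<close> and \<open>b\<close>, leaving the factor \<open>sg t\<close>.\<close>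
  have l': "scl (sg t) (a * (G w * G (- t) * G w) * b) = scl (cnj (l t)) c" if "t \<in> Sym A" for t
  proof -
    have "star (a * G t * b) = b * G (- t) * a"
      by (simp add: star_mult star_ssum[OF R] star_asum[OF C] mult.assoc)
    then have "G w * (b * G (- t) * a) * G w = G w * scl (cnj (l t)) (b * a) * G w"
      by (simp add: l[OF that] star_c)
    moreover have "G w * (b * x * a) * G w = asum R * (G w * x * G w) * ssum C" for x
    proof -
      have "G w * (b * x * a) * G w = (G w * b) * x * (a * G w)" by (simp add: mult.assoc)
      then show ?thesis by (simp add: w_b a_w mult.assoc)
    qed
    from this[of "G (- t)"] this[of 1]
    have "G w * (b * G (- t) * a) * G w = asum R * (G w * G (- t) * G w) * ssum C"
      "G w * (b * a) * G w = asum R * ssum C" by simp_all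
    ultimately have "asum R * (G w * G (- t) * G w) * ssum C = scl (cnj (l t)) (asum R * ssum C)"
      by simp
    then have "eps (asum R * (G w * G (- t) * G w) * ssum C) = eps (scl (cnj (l t)) (asum R * ssum C))"
      by simp
    moreover have "sg w * (sg t * sg w) = sg t" by (metis mult.commute sg_mult_self(2))
    ultimately show ?thesis by (simp add: eps_mult)
  qed
  have term_eq: "a * scl (sg t) (G t * (b * a * G w) * G (- t)) * (G w * b)
      = scl (of_real ((cmod (l t))\<^sup>2) * kap) c" if "t \<in> Sym A" for t
  proof -
    have "a * scl (sg t) (G t * (b * a * G w) * G (- t)) * (G w * b)
        = (a * G t * b) * scl (sg t) (a * (G w * G (- t) * G w) * b)" by (simp add: mult.assoc)
    also have "\<dots> = scl (l t * cnj (l t)) (c * c)" by (simp only: l[OF that] l'[OF that]) (simp add: mult.commute)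
    also have "\<dots> = scl (of_real ((cmod (l t))\<^sup>2) * kap) c"
      by (simp only: c_c scl_scl complex_norm_square)
    finally show ?thesis .
  qed
  have "a * phi A (b * a * G w) * (G w * b)
      = (\<Sum>t\<in>Sym A. a * scl (sg t) (G t * (b * a * G w) * G (- t)) * (G w * b))"
    unfolding phi_def by (simp only: sum_distrib_left sum_distrib_right)
  also have "\<dots> = (\<Sum>t\<in>Sym A. scl (of_real ((cmod (l t))\<^sup>2) * kap) c)"
    by (rule sum.cong[OF refl term_eq])
  also have "\<dots> = scl ((\<Sum>t\<in>Sym A. of_real ((cmod (l t))\<^sup>2) * kap)) c"
    by (simp only: scl_sum_left)
  finally have "scl ((\<Sum>t\<in>Sym A. of_real ((cmod (l t))\<^sup>2) * kap)) c = 0"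
    by (simp add: phi_baw Y0)
  then have "tau (scl ((\<Sum>t\<in>Sym A. of_real ((cmod (l t))\<^sup>2) * kap)) c) = 0" by simp
  then have "of_real (\<Sum>t\<in>Sym A. (cmod (l t))\<^sup>2) * kap = 0"
    by (simp add: sum_distrib_right)
  then have "(\<Sum>t\<in>Sym A. (cmod (l t))\<^sup>2) = 0"
    using kap_nonzero by (metis mult_eq_0_iff of_real_eq_0_iff)
  then have "\<forall>t\<in>Sym A. (cmod (l t))\<^sup>2 = 0"
    by (subst (asm) sum_nonneg_eq_0_iff) auto
  then have "l 0 = 0" by (metis Sym_zero norm_eq_zero power2_eq_iff_nonneg zero_power2 power_eq_0_iff)
  moreover have "l 0 = 1" by (simp add: l_def)
  ultimately show False by simp
qed

end

section \<open>Garnir relations and hooks\<close>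

lemma Sym_less: "g \<in> Sym {0..<n} \<Longrightarrow> ap g x < n \<longleftrightarrow> x < n"
  using Sym_in[of g "{0..<n}" x] by simp

context tableau
begin

lemma asum_transp:
  assumes "x < n" "y < n" "x \<noteq> y" "k x = k y"
  shows "b * G (transp x y) = - b"
proof -
  have "transp x y \<in> C" using assms by (intro transp_Stab) auto
  then show ?thesis using G_asum(2)[OF C] assms(3) by (simp add: sg_transp scl_minus1)
qed

lemma bij_betw_row: "h \<in> R \<Longrightarrow> bij_betw (ap h) (row i) (row i)"
proof -
  assume h: "h \<in> R"
  have "ap g ` row i \<subseteq> row i" if "g \<in> R" for g
    using StabD[OF that] by (auto simp: row_def Sym_less)
  then have "ap h ` row i \<subseteq> row i" "ap (- h) ` row i \<subseteq> row i"
    using h subgrpD(6)[OF R h] by blast+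
  then show ?thesis by (intro bij_betw_byWitness[of _ "ap (- h)"]) auto
qed

text \<open>A one-box Garnir relation: moving a box to a longer row symmetrises one box too many.\<close>

lemma garnir:
  assumes x0: "x0 < n" and ij: "i < r x0"
  shows "b * a * (1 + (\<Sum>x\<in>row i. G (transp x0 x))) = 0"
proof -
  define top where "top u = (SOME y. y < n \<and> r y = i \<and> k y = k u)" for u
  have top: "top u < n \<and> r (top u) = i \<and> k (top u) = k u" if "u < n" "r u = r x0" for u
  proof -
    have "(i, k u) \<in> D" using col_down[OF in_D[OF that(1)]] that(2) ij by simp
    then show ?thesis unfolding top_def by (intro someI_ex[of "\<lambda>y. y < n \<and> r y = i \<and> k y = k u"] D_cell)
  qed
  have hx0: "ap h x0 < n" "r (ap h x0) = r x0" if "h \<in> R" for h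
    using that x0 Sym_in[of h A x0] StabD[OF that] by auto
  have htop: "top (ap h x0) \<in> row i" "k (top (ap h x0)) = k (ap h x0)" "top (ap h x0) \<noteq> ap h x0" if "h \<in> R" for h
    using top[OF hx0[OF that]] hx0[OF that] ij by (auto simp: row_def)
  define f where "f = (\<lambda>(h, y). b * G (transp (ap h x0) y) * G h)"
  \<comment> \<open>The point \<open>top (ap h x0)\<close> lies in the column of
    \<open>ap h x0\<close>, so its summand equals \<open>- (b * G h)\<close> and cancels the leading
    1.\<close>
  have step: "b * G h * (1 + (\<Sum>x\<in>row i. G (transp x0 x)))
      = (\<Sum>y\<in>row i - {top (ap h x0)}. f (h, y))" if h: "h \<in> R" for h
  proof -
    have "G h * (\<Sum>x\<in>row i. G (transp x0 x)) = (\<Sum>x\<in>row i. G (transp (ap h x0) (ap h x)) * G h)"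
      unfolding sum_distrib_left G_plus[symmetric] conj_transp[of h] ..
    also have "\<dots> = (\<Sum>y\<in>row i. G (transp (ap h x0) y) * G h)"
      by (rule sum.reindex_bij_betw[OF bij_betw_row[OF h]])
    finally have "b * G h * (1 + (\<Sum>x\<in>row i. G (transp x0 x))) = b * G h + (\<Sum>y\<in>row i. f (h, y))"
      by (simp add: distrib_left mult.assoc f_def) (simp add: sum_distrib_left mult.assoc)
    also have "(\<Sum>y\<in>row i. f (h, y)) = f (h, top (ap h x0)) + (\<Sum>y\<in>row i - {top (ap h x0)}. f (h, y))"
      by (rule sum.remove) (simp_all add: htop[OF h])
    also have "f (h, top (ap h x0)) = - (b * G h)"
    proof -
      have "b * G (transp (ap h x0) (top (ap h x0))) = - b"
        using htop[OF h] hx0[OF h] by (intro asum_transp) (auto simp: row_def)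
      then show ?thesis by (simp add: f_def)
    qed
    finally show ?thesis by simp
  qed
  define P where "P = Sigma R (\<lambda>h. row i - {top (ap h x0)})"
  \<comment> \<open>A sign-reversing involution on the remaining pairs: with
    \<open>u = ap h x0\<close> and \<open>z = top u\<close>, the factor \<open>transp y z\<close>
    moves across \<open>transp u y\<close> as \<open>transp u z\<close>, which exchanges two points
    of one column and contributes -1.\<close>
  define F where "F = (\<lambda>(h, y). (transp y (top (ap h x0)) + h, y))"
  have F: "F (h, y) \<in> P" "F (F (h, y)) = (h, y)" "f (F (h, y)) = - f (h, y)" if "(h, y) \<in> P" for h y
  proof -
    from that have h: "h \<in> R" and y: "y < n" "r y = i" "y \<noteq> top (ap h x0)"
      by (auto simp: P_def row_def)
    define u where "u = ap h x0"
    define z where "z = top u"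
    have z: "z < n" "r z = i" "k z = k u" "z \<noteq> u" using htop[OF h] by (auto simp: row_def z_def u_def)
    have u: "u < n" "r u = r x0" using hx0[OF h] by (auto simp: u_def)
    have ne: "u \<noteq> y" "u \<noteq> z" "y \<noteq> z" using u y z ij by (auto simp: z_def u_def)
    have fix_u: "ap (transp y z + h) x0 = u"
      using ne by (simp add: ap_transp flip: u_def)
    have "transp y z \<in> R" using y z by (intro transp_Stab) auto
    then have in_R: "transp y z + h \<in> R" using h subgrpD(5)[OF R] by blast
    have F_eq: "F (h, y) = (transp y z + h, y)" by (simp add: F_def z_def u_def)
    have "y \<in> row i - {top (ap (transp y z + h) x0)}"
      unfolding fix_u using y ne(3) by (simp add: row_def z_def)
    then show "F (h, y) \<in> P" unfolding F_eq P_def using in_R by blast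
    have "F (transp y z + h, y) = (transp y z + (transp y z + h), y)"
      unfolding F_def prod.case fix_u unfolding z_def ..
    then show "F (F (h, y)) = (h, y)"
      unfolding F_eq add.assoc[symmetric] by simp
    have "transp u y + transp y z = transp u z + transp u y"
      using conj_transp[of "transp u y" y z] ne by (simp add: ap_transp)
    then have "b * G (transp u y) * G (transp y z) = b * G (transp u z) * G (transp u y)"
      by (simp add: mult.assoc flip: G_plus)
    also have "\<dots> = - (b * G (transp u y))"
      using asum_transp[of u z] u z by simp
    finally have "b * G (transp u y) * G (transp y z) * G h = - (b * G (transp u y) * G h)" by simp
    then have "b * G (transp u y) * (G (transp y z) * G h) = - (b * G (transp u y) * G h)"
      by (simp only: mult.assoc)
    then show "f (F (h, y)) = - f (h, y)"
      unfolding F_eq f_def prod.case fix_u G_plus u_def .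
  qed
  have "sum f P = (\<Sum>p\<in>P. - f p)"
    by (rule sum.reindex_bij_witness[of _ F F]) (simp_all add: split_paired_all F)
  then have "sum f P = - sum f P" by (simp add: sum_negf)
  then have P0: "sum f P = 0" by (rule eq_uminus_zero)
  have "b * a * (1 + (\<Sum>x\<in>row i. G (transp x0 x)))
      = (\<Sum>h\<in>R. b * G h * (1 + (\<Sum>x\<in>row i. G (transp x0 x))))"
    by (simp only: ssum_def sum_distrib_left[of b] sum_distrib_right)
  also have "\<dots> = (\<Sum>h\<in>R. \<Sum>y\<in>row i - {top (ap h x0)}. f (h, y))"
    by (rule sum.cong[OF refl step])
  also have "\<dots> = sum f P" unfolding P_def
    by (subst sum.Sigma) (auto simp: subgrpD(2)[OF R])
  finally show ?thesis using P0 by simp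
qed

end

text \<open>Block \<open>d\<close> stands for a diagonal hook with arm length \<open>al d\<close>: offset 0 is the corner, the odd offsets
  form one arm and the nonzero even offsets the other.\<close>

locale blocks =
  fixes n m :: nat and al :: "nat \<Rightarrow> nat" and blk off :: "nat \<Rightarrow> nat"
  assumes blocks_bij: "bij_betw (\<lambda>s. (blk s, off s)) {0..<n} (SIGMA d:{..<m}. {..2 * al d})"
    and al_decr: "i < j \<Longrightarrow> j < m \<Longrightarrow> al j < al i"
begin

definition CC :: "nat \<Rightarrow> nat set" where "CC d = {s. s < n \<and> blk s = d \<and> (off s = 0 \<or> odd (off s))}"
definition SS :: "nat \<Rightarrow> nat set" where "SS d = {s. s < n \<and> blk s = d \<and> off s > 0 \<and> even (off s)}"

text \<open>Each point outside the distinguished arms gets its own label \<open>Inr s\<close>, so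
  the stabilizer of \<open>Cf\<close> moves only the corner and the odd arm of each block, and that
  of \<open>Sf\<close> only the even arm.\<close>

definition Cf :: "nat \<Rightarrow> nat + nat" where "Cf s = (if off s = 0 \<or> odd (off s) then Inl (blk s) else Inr s)"
definition Sf :: "nat \<Rightarrow> nat + nat" where "Sf s = (if off s > 0 \<and> even (off s) then Inl (blk s) else Inr s)"

lemma blk_less: "s < n \<Longrightarrow> blk s < m" and off_le: "s < n \<Longrightarrow> off s \<le> 2 * al (blk s)"
proof -
  assume "s < n"
  then have "(blk s, off s) \<in> (SIGMA d:{..<m}. {..2 * al d})"
    using bij_betwE[OF blocks_bij] by simp
  then show "blk s < m" "off s \<le> 2 * al (blk s)" by auto
qed

lemma block_eq: "s < n \<Longrightarrow> t < n \<Longrightarrow> blk s = blk t \<Longrightarrow> off s = off t \<Longrightarrow> s = t"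
  using blocks_bij by (auto simp: bij_betw_def inj_on_def)

lemma block_cell: "d < m \<Longrightarrow> i \<le> 2 * al d \<Longrightarrow> \<exists>s<n. blk s = d \<and> off s = i"
proof -
  assume "d < m" "i \<le> 2 * al d"
  then have "(d, i) \<in> (\<lambda>s. (blk s, off s)) ` {0..<n}"
    using blocks_bij by (simp add: bij_betw_def)
  then show ?thesis by auto
qed

lemma finite_SS [simp]: "finite (SS d)"
  by (auto simp: SS_def)

lemma off_inj: "inj_on off {s. s < n \<and> blk s = d}"
  by (auto simp: inj_on_def intro: block_eq)

lemma card_off: 
  assumes "d < m" "T \<subseteq> {..2 * al d}" shows "card {s. s < n \<and> blk s = d \<and> off s \<in> T} = card T"
proof -
  have img: "off ` {s. s < n \<and> blk s = d \<and> off s \<in> T} = T"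
    using block_cell[OF assms(1)] assms(2) by (force simp: image_iff)
  have "inj_on off {s. s < n \<and> blk s = d \<and> off s \<in> T}"
    using off_inj[of d] by (rule inj_on_subset) auto
  from card_image[OF this] show ?thesis unfolding img by (rule sym)
qed

lemma card_SS: "d < m \<Longrightarrow> card (SS d) = al d"
proof -
  assume d: "d < m"
  have even_iff: "o' > 0 \<and> even o' \<longleftrightarrow> o' \<in> (\<lambda>i. 2 * Suc i) ` {..<al d}" if "o' \<le> 2 * al d" for o'
  proof
    assume *: "o' > 0 \<and> even o'"
    then obtain c where c: "o' = 2 * c" by (blast elim: evenE)
    then have "o' = 2 * Suc (c - 1)" "c - 1 < al d" using that * by simp_all
    then show "o' \<in> (\<lambda>i. 2 * Suc i) ` {..<al d}" by blast
  qed auto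
  have "SS d = {s. s < n \<and> blk s = d \<and> off s \<in> (\<lambda>i. 2 * Suc i) ` {..<al d}}"
    unfolding SS_def using even_iff off_le by (intro Collect_cong) blast
  also have "card \<dots> = card ((\<lambda>i. 2 * Suc i) ` {..<al d})"
    by (rule card_off[OF d]) auto
  also have "\<dots> = al d" by (subst card_image) (auto simp: inj_on_def)
  finally show ?thesis .
qed

lemma card_CC: "d < m \<Longrightarrow> card (CC d) = Suc (al d)"
proof -
  assume d: "d < m"
  have "{s. s < n \<and> blk s = d \<and> off s \<in> {..2 * al d}} = CC d \<union> SS d"
    using off_le by (auto simp: CC_def SS_def)
  then have "card (CC d \<union> SS d) = Suc (2 * al d)"
    using card_off[OF d, of "{..2 * al d}"] by simp
  moreover have "card (CC d \<union> SS d) = card (CC d) + card (SS d)"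
    by (rule card_Un_disjoint) (auto simp: CC_def SS_def)
  ultimately show ?thesis using card_SS[OF d] by simp
qed

lemma CC_blk: "s \<in> CC d \<Longrightarrow> blk s = d"
  and CC_not_SS: "s \<in> CC d \<Longrightarrow> s \<notin> SS e"
  by (auto simp: CC_def SS_def)

lemma CC_SS_cases: "s < n \<Longrightarrow> s \<in> CC (blk s) \<or> s \<in> SS (blk s)"
  by (auto simp: CC_def SS_def)

end

text \<open>The abstract properties of an element \<open>asum K * ssum S * x * (b * a)\<close>,
  where \<open>K\<close> permutes the sets \<open>CC d\<close> and \<open>S\<close> the sets
  \<open>SS d\<close>: the left factors give \<open>v_alt\<close> and \<open>v_sym\<close>, the
  right factor \<open>b * a\<close> gives \<open>v_row\<close> and \<open>v_garnir\<close>. The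
  instance is built in \<open>phi_rho_Y\<close>.\<close>

locale block_tableau = sym_tableau + blocks n m al blk off for m al blk off +
  fixes v :: ga
  assumes v_alt: "\<And>y y' d g. y \<in> CC d \<Longrightarrow> y' \<in> CC d \<Longrightarrow> y \<noteq> y' \<Longrightarrow> lk v (transp y y' + g) = - lk v g"
    and v_sym: "\<And>y y' d g. y \<in> SS d \<Longrightarrow> y' \<in> SS d \<Longrightarrow> lk v (transp y y' + g) = lk v g"
    and v_row: "\<And>g h. h \<in> R \<Longrightarrow> lk v (g + h) = lk v g"
    and v_garnir: "\<And>x0 i g. x0 < n \<Longrightarrow> i < r x0 \<Longrightarrow> lk v g + (\<Sum>x\<in>row i. lk v (g + transp x0 x)) = 0"
    and v_Alg: "v \<in> Alg {0..<n}"
begin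

definition nu :: "nat \<Rightarrow> nat" where "nu i = card (row i)"

lemma nu: "j < nu i \<longleftrightarrow> (i, j) \<in> D"
  by (simp add: nu_def row_cell)

lemma nu_sym: "j < nu i \<longleftrightarrow> i < nu j"
  using sym by (auto simp: nu)

lemma nu_mono: "j < nu i \<Longrightarrow> i' \<le> i \<Longrightarrow> j < nu i'"
  using col_down by (auto simp: nu)

text \<open>A permutation is read as a word whose letter at \<open>s\<close> is the row containing \<open>s\<close>. In the words of
  the support of \<open>v\<close>, alternation makes the letters on \<open>CC d\<close> distinct and the Garnir relation
  lets one choose all letters on \<open>SS d\<close> equal to \<open>d\<close>, one block after the other.\<close>

definition wd :: "fperm \<Rightarrow> nat \<Rightarrow> nat" where "wd g s = r (ap (- g) s)"

lemma wd_transp: "wd (transp s y + g) z = wd g (ap (transp s y) z)"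
  by (simp add: wd_def minus_add del: add_uminus_conv_diff)

lemma wd_count: "g \<in> Sym A \<Longrightarrow> card {s. s < n \<and> wd g s = j} = nu j"
proof -
  assume g: "g \<in> Sym A"
  have "{s. s < n \<and> wd g s = j} = ap g ` row j"
  proof
    show "{s. s < n \<and> wd g s = j} \<subseteq> ap g ` row j"
    proof
      fix s assume "s \<in> {s. s < n \<and> wd g s = j}"
      then have "ap (- g) s \<in> row j" using Sym_less[of "- g" n s] g by (simp add: row_def wd_def)
      then have "ap g (ap (- g) s) \<in> ap g ` row j" by (rule imageI)
      then show "s \<in> ap g ` row j" by simp
    qed
    show "ap g ` row j \<subseteq> {s. s < n \<and> wd g s = j}"
      by (auto simp: row_def wd_def Sym_less[OF g])
  qed
  then show ?thesis by (simp add: card_image inj_on_def nu_def)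
qed

text \<open>With equal letters the transposition of \<open>y\<close> and \<open>y'\<close>, carried
  to the other side of \<open>g\<close>, is a row permutation. Row invariance and alternation then
  force the coefficient to vanish.\<close>

lemma wd_inj:
  assumes "g \<in> Sym A" "lk v g \<noteq> 0" "y \<in> CC d" "y' \<in> CC d" "wd g y = wd g y'"
  shows "y = y'"
proof (rule ccontr)
  assume ne: "y \<noteq> y'"
  have "transp y y' + g = g + transp (ap (- g) y) (ap (- g) y')"
    using conj_transp[of g "ap (- g) y" "ap (- g) y'"] by simp
  moreover have "transp (ap (- g) y) (ap (- g) y') \<in> R"
    using assms by (intro transp_Stab) (auto simp: wd_def CC_def Sym_less)
  ultimately have "lk v (transp y y' + g) = lk v g" by (simp add: v_row)
  then show False using v_alt[OF assms(3,4) ne, of g] assms(2) by simp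
qed

text \<open>The first \<open>p\<close> blocks spell the row indices of the first \<open>p\<close>
  diagonal hooks of the diagram: the arm, all in row \<open>i\<close>, on \<open>SS i\<close>, and
  the corner with the leg, in rows \<open>i\<close> to \<open>nu i - 1\<close>, on
  \<open>CC i\<close>.\<close>

definition good :: "nat \<Rightarrow> fperm \<Rightarrow> bool" where
  "good p g \<longleftrightarrow> g \<in> Sym A \<and> lk v g \<noteq> 0 \<and>
     (\<forall>i<p. (\<forall>s\<in>SS i. wd g s = i) \<and> wd g ` CC i = {i..<nu i})"

text \<open>A count of letters. A letter \<open>j < p\<close> is used once on each
  \<open>CC i\<close> with \<open>i \<le> j\<close> and \<open>al j\<close> times on
  \<open>SS j\<close>, which exhausts its \<open>nu j\<close> occurrences. A letter beyond both
  \<open>p\<close> and \<open>nu p\<close> occurs at most \<open>p\<close> times and is used up by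
  the \<open>CC i\<close> with \<open>i < nu j\<close>.\<close>

lemma letters_left:
  assumes g: "good p g" and eq: "\<forall>i<p. al i + i + 1 = nu i" and p: "p \<le> m" and s: "s < n" "p \<le> blk s"
  shows "p \<le> wd g s \<and> wd g s < nu p"
proof (rule ccontr)
  assume neg: "\<not> ?thesis"
  define j where "j = wd g s"
  have ex: "\<exists>c. c \<in> CC i \<and> wd g c = j" if "i < p" "i \<le> j" "j < nu i" for i
  proof -
    have "j \<in> wd g ` CC i" using g that by (auto simp: good_def)
    then show ?thesis by auto
  qed
  define cf where "cf i = (SOME c. c \<in> CC i \<and> wd g c = j)" for i
  have cf: "cf i \<in> CC i" "wd g (cf i) = j" if "i < p" "i \<le> j" "j < nu i" for i
    using someI_ex[OF ex[OF that]] by (auto simp: cf_def)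
  let ?W = "{s. s < n \<and> wd g s = j}"
  have W: "card ?W = nu j" "finite ?W" using g wd_count by (auto simp: good_def)
  \<comment> \<open>\<open>I\<close> lists blocks whose \<open>CC\<close> contains the letter and
    \<open>T\<close> further places in the first \<open>p\<close> blocks; if they account for all
    occurrences, \<open>s\<close> would be one too many.\<close>
  have *: False if I: "\<And>i. i \<in> I \<Longrightarrow> i < p \<and> i \<le> j \<and> j < nu i" and T: "T \<subseteq> ?W" "\<And>t. t \<in> T \<Longrightarrow> t \<in> SS (blk t) \<and> blk t < p"
    and le: "nu j \<le> card I + card T" for I T
  proof -
    have fin: "finite I" "finite T" using I finite_subset[of I "{..<p}"] finite_subset[OF T(1) W(2)] by auto
    have cfI: "cf i \<in> CC i \<and> wd g (cf i) = j \<and> i < p" if "i \<in> I" for i using cf[of i] I[OF that] by auto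
    have "inj_on cf I" by (rule inj_on_inverseI[of _ blk]) (use cfI CC_blk in blast)
    then have cI: "card (cf ` I) = card I" by (rule card_image)
    have "cf ` I \<inter> T = {}" using cfI T(2) CC_not_SS by blast
    then have "card (cf ` I \<union> T) = card I + card T"
      using card_Un_disjoint[of "cf ` I" T] fin cI by simp
    moreover have "blk t < p" if t: "t \<in> cf ` I \<union> T" for t
    proof (cases "t \<in> T")
      case False
      then obtain i where "i \<in> I" "t = cf i" using t by blast
      then show ?thesis using cfI[of i] CC_blk[of "cf i" i] by simp
    qed (use T(2) in simp)
    then have "s \<notin> cf ` I \<union> T" using s(2) by (metis not_le)
    ultimately have "card (insert s (cf ` I \<union> T)) = Suc (card I + card T)"
      using fin by simp
    moreover have "insert s (cf ` I \<union> T) \<subseteq> ?W"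
      using cfI T(1) s by (auto simp: CC_def j_def)
    ultimately have "Suc (card I + card T) \<le> nu j" using card_mono[OF W(2)] W(1) by metis
    then show False using le by simp
  qed
  show False
  proof (cases "j < p")
    case True
    have jj: "j < nu j" using eq True by force
    show False
    proof (rule *[of "{..j}" "SS j"])
      show "i \<in> {..j} \<Longrightarrow> i < p \<and> i \<le> j \<and> j < nu i" for i
        using True nu_mono[OF jj] by auto
      show "SS j \<subseteq> ?W" using g True by (auto simp: good_def SS_def)
      show "t \<in> SS j \<Longrightarrow> t \<in> SS (blk t) \<and> blk t < p" for t using True by (auto simp: SS_def)
      show "nu j \<le> card {..j} + card (SS j)" using card_SS[of j] True p eq by force
    qed
  next
    case False
    then have "nu j \<le> p" using neg nu_sym[of p j] by (auto simp: j_def)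
    show False
    proof (rule *[of "{..<nu j}" "{}"])
      show "i \<in> {..<nu j} \<Longrightarrow> i < p \<and> i \<le> j \<and> j < nu i" for i
        using False \<open>nu j \<le> p\<close> nu_sym[of i j] by auto
    qed auto
  qed
qed

text \<open>By \<open>wd_inj\<close> the \<open>al p + 1\<close> letters on \<open>CC p\<close> are
  distinct, and by \<open>letters_left\<close> they lie in an interval of length
  \<open>nu p - p\<close>; equality of sizes fills the interval.\<close>

lemma CC_image:
  assumes g: "good p g" and eq: "\<forall>i<p. al i + i + 1 = nu i" and p: "p < m"
  shows "al p + p + 1 \<le> nu p" "al p + p + 1 = nu p \<Longrightarrow> wd g ` CC p = {p..<nu p}"
proof -
  have sub: "wd g ` CC p \<subseteq> {p..<nu p}"
    using letters_left[OF g eq] p by (auto simp: CC_def)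
  have "inj_on (wd g) (CC p)" using g wd_inj by (auto simp: inj_on_def good_def)
  then have card: "card (wd g ` CC p) = Suc (al p)" by (simp add: card_image card_CC[OF p])
  have le: "Suc (al p) \<le> nu p - p" using card_mono[OF _ sub] card by simp
  then show "al p + p + 1 \<le> nu p" by linarith
  show "wd g ` CC p = {p..<nu p}" if "al p + p + 1 = nu p"
    by (rule card_subset_eq[OF _ sub]) (use that card in auto)
qed

text \<open>Take a good word with as many letters \<open>p\<close> on \<open>SS p\<close> as
  possible. If another letter \<open>j\<close> stood there at \<open>s\<close>, the Garnir relation
  moving this box into row \<open>p\<close> would apply. Its terms with \<open>y\<close> in
  \<open>SS p\<close> equal \<open>lk v g\<close> and all others vanish, so a positive integer times
  \<open>lk v g\<close> would be zero.\<close>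

lemma good_Suc:
  assumes g0: "good p g0" and eq: "\<forall>i<p. al i + i + 1 = nu i" and p: "p < m" and eqp: "al p + p + 1 = nu p"
  shows "\<exists>g. good (Suc p) g"
proof -
  define N where "N g = card {s \<in> SS p. wd g s = p}" for g
  have "\<forall>g. good p g \<longrightarrow> N g < Suc (card (SS p))"
    by (auto simp: N_def less_Suc_eq_le intro: card_mono)
  from ex_has_greatest_nat[of "good p", OF g0 this]
  obtain g where g: "good p g" and max: "\<And>g'. good p g' \<Longrightarrow> N g' \<le> N g" by blast
  have gS: "g \<in> Sym A" and v: "lk v g \<noteq> 0" using g by (auto simp: good_def)
  have img: "wd g ` CC i = {i..<nu i}" if "i \<le> p" for i
    using that g CC_image(2)[OF g eq p eqp] by (cases "i = p") (auto simp: good_def)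
  have "wd g s = p" if s: "s \<in> SS p" for s
  proof (rule ccontr)
    assume ne: "wd g s \<noteq> p"
    define j where "j = wd g s"
    have sn: "s < n" "blk s = p" using s by (auto simp: SS_def)
    have j: "p < j" "j < nu p" using letters_left[OF g eq _ sn(1)] p sn ne by (auto simp: j_def)
    define Z where "Z = {y. y < n \<and> wd g y = p}"
    have "ap (- g) s < n" using Sym_in[of "- g" A s] gS sn by simp
    then have "lk v g + (\<Sum>x\<in>row p. lk v (g + transp (ap (- g) s) x)) = 0"
      by (rule v_garnir) (use j in \<open>simp add: j_def wd_def\<close>)
    also have "(\<Sum>x\<in>row p. lk v (g + transp (ap (- g) s) x)) = (\<Sum>y\<in>Z. lk v (transp s y + g))"
    proof (rule sum.reindex_bij_witness[of _ "ap (- g)" "ap g"])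
      fix x assume "x \<in> row p"
      then show "ap g x \<in> Z" by (auto simp: row_def Z_def wd_def Sym_less[OF gS])
      show "lk v (transp s (ap g x) + g) = lk v (g + transp (ap (- g) s) x)"
        using conj_transp[of g "ap (- g) s" x] by simp
    next
      fix y assume "y \<in> Z"
      then show "ap (- g) y \<in> row p" using gS by (auto simp: row_def Z_def wd_def Sym_less)
    qed simp_all
    also have "\<dots> = (\<Sum>y\<in>Z. if y \<in> SS p then lk v g else 0)"
    proof (rule sum.cong[OF refl])
      fix y assume y: "y \<in> Z"
      show "lk v (transp s y + g) = (if y \<in> SS p then lk v g else 0)"
      proof (cases "y \<in> SS p")
        case True
        then show ?thesis using v_sym[OF s] by simp
      next
        case False
        define g' where "g' = transp s y + g"
        have yn: "y < n" "wd g y = p" using y by (auto simp: Z_def)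
        have sy: "s \<noteq> y" using s False by auto
        have g'S: "g' \<in> Sym A" unfolding g'_def using gS yn sn by (intro Sym_plus transp_Sym) auto
        have w's: "wd g' s = p" "wd g' y = j" by (simp_all add: g'_def wd_transp ap_transp yn j_def)
        have w'z: "wd g' z = wd g z" if "z \<noteq> s" "z \<noteq> y" for z
          using that by (simp add: g'_def wd_transp ap_transp)
        \<comment> \<open>If \<open>y\<close> lies in one of the blocks up to \<open>p\<close>, then
          \<open>y\<close> is in its \<open>CC\<close>, where the letter \<open>j\<close> already
          occurs, and the exchange duplicates it. If \<open>y\<close> lies in a later block, the
          exchanged word is good with one more \<open>p\<close> on \<open>SS p\<close>, against
          maximality.\<close>
        have "lk v g' = 0"
        proof (rule ccontr)
          assume nz: "lk v g' \<noteq> 0"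
          show False
          proof (cases "blk y \<le> p")
            case True
            have "y \<in> CC (blk y)"
            proof (rule ccontr)
              assume "y \<notin> CC (blk y)"
              then have "y \<in> SS (blk y)" using CC_SS_cases yn by blast
              then have "blk y < p" "wd g y = blk y" using False True g by (auto simp: good_def le_less)
              then show False using yn by simp
            qed
            moreover have "j \<in> wd g ` CC (blk y)"
              using img[OF True] j nu_mono[OF j(2) True] True by auto
            then obtain y' where y': "y' \<in> CC (blk y)" "wd g y' = j" by auto
            moreover have "y' \<noteq> y" using y' yn j by auto
            moreover have "y' \<noteq> s" using y' s by (auto simp: CC_def SS_def)
            ultimately show False
              using wd_inj[OF g'S nz, of y "blk y" y'] w's w'z by auto
          next
            case blk: False
            have "good p g'"
              unfolding good_def
            proof (intro conjI allI impI ballI g'S nz)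
              fix i assume i: "i < p"
              have same: "wd g' z = wd g z" if "blk z = i" for z
                using that i blk sn by (intro w'z) auto
              show "wd g' z = i" if "z \<in> SS i" for z
                using same[of z] that g i by (auto simp: good_def SS_def)
              have "wd g' ` CC i = wd g ` CC i"
                by (rule image_cong) (auto simp: CC_def same)
              then show "wd g' ` CC i = {i..<nu i}" using img[of i] i by simp
            qed
            moreover have "{t \<in> SS p. wd g' t = p} = insert s {t \<in> SS p. wd g t = p}"
            proof -
              have eqw: "wd g' t = wd g t" if "t \<in> SS p" "t \<noteq> s" for t
                using that False by (intro w'z) auto
              have "t \<in> {t \<in> SS p. wd g' t = p} \<longleftrightarrow> t \<in> insert s {t \<in> SS p. wd g t = p}" for t
                using s w's(1) eqw[of t] by (cases "t = s") auto
              then show ?thesis by blast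
            qed
            then have "N g' = Suc (N g)" using ne by (simp add: N_def)
            ultimately show False using max[of g'] by simp
          qed
        qed
        then show ?thesis using False by (simp add: g'_def)
      qed
    qed
    also have "\<dots> = of_nat (card (Z \<inter> SS p)) * lk v g"
      by (simp add: sum.If_cases Z_def)
    finally have "(1 + of_nat (card (Z \<inter> SS p))) * lk v g = 0" by (simp add: distrib_right)
    moreover have "(1 + of_nat (card (Z \<inter> SS p)) :: complex) \<noteq> 0"
      by (metis of_nat_Suc of_nat_eq_0_iff nat.distinct(1))
    ultimately show False using v by simp
  qed
  then have "good (Suc p) g"
    using g img by (auto simp: good_def less_Suc_eq)
  then show ?thesis ..
qed

text \<open>The equation \<open>al i + i + 1 = nu i\<close> says that block \<open>i\<close> is as
  long as the \<open>i\<close>-th diagonal hook. As long as all earlier blocks match, a good word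
  exists, and \<open>CC_image\<close> allows the next block only to be shorter or equal.\<close>

theorem hooks_bounded:
  assumes "v \<noteq> 0"
  shows "(\<forall>i<m. al i + i + 1 = nu i) \<or> (\<exists>p<m. (\<forall>i<p. al i + i + 1 = nu i) \<and> al p + p + 1 < nu p)"
proof (rule ccontr)
  assume neg: "\<not> ?thesis"
  have "(\<forall>i<p. al i + i + 1 = nu i) \<and> (\<exists>g. good p g)" if "p \<le> m" for p
    using that
  proof (induction p)
    case 0
    obtain g where "lk v g \<noteq> 0" using assms by (metis lookup_zero poly_mapping_eqI)
    then have "good 0 g" using v_Alg by (auto simp: good_def Alg_def)
    then show ?case by auto
  next
    case (Suc p)
    then obtain g where eq: "\<forall>i<p. al i + i + 1 = nu i" and g: "good p g" by auto
    have "al p + p + 1 = nu p"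
      using CC_image(1)[OF g eq] neg eq Suc.prems by (metis Suc_le_lessD le_neq_implies_less)
    then show ?case using good_Suc[OF g eq _] eq Suc.prems by (auto simp: less_Suc_eq)
  qed
  from this[of m] show False using neg by auto
qed

end

section \<open>Block rotations\<close>

lemma phi_conj:
  assumes "g \<in> Sym A" shows "phi A (G (g + h + - g)) = scl (sg g) (phi A (G h))"
proof -
  have "phi A (G (g + h + - g)) = phi A (G g * (G h * G (- g)))" by (simp only: G_plus mult.assoc)
  also have "\<dots> = scl (sg g) (phi A (G h * G (- g) * G g))" by (rule phi_G_mult[OF assms])
  finally show ?thesis by (simp add: mult.assoc)
qed

lemma phi_odd_centralizer:
  assumes "c \<in> Sym A" "sg c = - 1" "c + h = h + c" shows "phi A (G h) = 0"
proof -
  have "c + h + - c = h" using assms(3) by (simp add: add.assoc)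
  then have "phi A (G h) = - phi A (G h)"
    using phi_conj[OF assms(1), of h] assms(2) by (simp add: scl_minus1)
  then show ?thesis by (rule eq_uminus_zero)
qed

lemma commute_disjoint:
  assumes "\<And>x. ap f x = x \<or> ap g x = x" shows "f + g = g + f"
proof (rule fperm_eqI)
  fix x
  show "ap (f + g) x = ap (g + f) x"
    using assms[of x] assms[of "ap f x"] assms[of "ap g x"] by auto
qed

lemma sign_cycle_of_list:
  "distinct cs \<Longrightarrow> cs \<noteq> [] \<Longrightarrow> sign (cycle_of_list cs) = (- 1) ^ (length cs - 1)"
proof (induction cs rule: cycle_of_list.induct)
  case (1 i j cs)
  have "sign (cycle_of_list (i # j # cs)) = sign (Transposition.transpose i j) * sign (cycle_of_list (j # cs))"
    by (simp add: sign_compose permutation_swap_id permutation_of_cycle)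
  moreover have "sign (cycle_of_list (j # cs)) = (- 1) ^ length cs" "i \<noteq> j" using 1 by simp_all
  ultimately show ?case by (simp add: sign_swap_id del: cycle_of_list.simps)
qed auto

text \<open>The witness is the cycle of \<open>g\<close> through \<open>x\<close>, extended by the
  identity: it agrees with \<open>g\<close> on the orbit and fixes everything else.\<close>

lemma cycle_of_orbit:
  assumes A: "finite A" "g \<in> Sym A" "x \<in> A"
  obtains c where "c \<in> Sym A" "c + g = g + c" "sg c = (- 1) ^ (least_power (ap g) x - 1)"
proof
  let ?cs = "support (ap g) x"
  let ?c = "Fperm (cycle_of_list ?cs)"
  have pos: "least_power (ap g) x > 0" by (rule least_power_of_permutation(2)) simp
  have c: "ap ?c = cycle_of_list ?cs" by (rule ap_Fperm[OF permutation_of_cycle])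
  have "(ap g ^^ i) x \<in> A" for i
    by (induction i) (use A in \<open>auto simp: Sym_in\<close>)
  then have sub: "set ?cs \<subseteq> A" by auto
  show "?c \<in> Sym A"
    by (rule Fperm_Sym[OF A(1)]) (rule permutes_subset[OF cycle_permutes sub])
  show "sg ?c = (- 1) ^ (least_power (ap g) x - 1)"
    unfolding sg_def c using sign_cycle_of_list[OF cycle_of_permutation[of "ap g" x]] pos by simp
  have range: "set ?cs = range (\<lambda>i. (ap g ^^ i) x)" by (rule support_set) simp
  have g_in: "ap g y \<in> set ?cs" if "y \<in> set ?cs" for y
  proof -
    from that obtain i where "y = (ap g ^^ i) x" unfolding range by blast
    then have "ap g y = (ap g ^^ Suc i) x" by simp
    then show ?thesis unfolding range by blast
  qed
  have g_in': "y \<in> set ?cs" if "ap g y \<in> set ?cs" for y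
  proof -
    from that obtain i where i: "ap g y = (ap g ^^ i) x" unfolding range by blast
    have "\<exists>j. ap g y = (ap g ^^ Suc j) x"
    proof (cases i)
      case 0
      have "(ap g ^^ Suc (least_power (ap g) x - 1)) x = x"
        using pos least_power_of_permutation(1)[of "ap g" x] by simp
      then show ?thesis using i 0 by (metis funpow_0)
    qed (use i in blast)
    then obtain j where "ap g y = ap g ((ap g ^^ j) x)" by auto
    then have "y = (ap g ^^ j) x" by simp
    then show ?thesis unfolding range by blast
  qed
  have restr: "ap ?c y = ap g y" if "y \<in> set ?cs" for y
    unfolding c by (rule cycle_restrict[OF permutation_ap that, symmetric])
  have out: "ap ?c y = y" if "y \<notin> set ?cs" for y
    unfolding c by (rule id_outside_supp[OF that])
  show "?c + g = g + ?c"
  proof (rule fperm_eqI)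
    fix y
    show "ap (?c + g) y = ap (g + ?c) y"
    proof (cases "y \<in> set ?cs")
      case True
      then show ?thesis using restr[OF True] restr[OF g_in[OF True]] by simp
    next
      case False
      then have "ap g y \<notin> set ?cs" using g_in' by blast
      then show ?thesis using out[OF False] out[of "ap g y"] by simp
    qed
  qed
qed

lemma phi_even_orbit:
  assumes "finite A" "g \<in> Sym A" "x \<in> A" "even (least_power (ap g) x)"
  shows "phi A (G g) = 0"
proof -
  obtain c where c: "c \<in> Sym A" "c + g = g + c" "sg c = (- 1) ^ (least_power (ap g) x - 1)"
    using cycle_of_orbit[OF assms(1-3)] by blast
  have "least_power (ap g) x > 0" by (rule least_power_of_permutation(2)) simp
  then have "odd (least_power (ap g) x - 1)" using assms(4) by simp
  then show ?thesis using c by (intro phi_odd_centralizer[of c]) simp_all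
qed

lemma ssum_conj_Stab:
  assumes A: "finite A" and w: "w \<in> Sym A" "w + w = 0"
    and iff: "\<And>x y. x \<in> A \<Longrightarrow> y \<in> A \<Longrightarrow> f (ap w x) = f (ap w y) \<longleftrightarrow> f' x = f' y"
  shows "ssum (Stab A f) * G w = G w * ssum (Stab A f')"
proof -
  have ww: "ap w (ap w x) = x" for x using w(2) by (metis ap_plus_apply ap_zero id_apply)
  have w_in: "ap w x \<in> A \<longleftrightarrow> x \<in> A" for x by (rule Sym_in[OF w(1)])
  have 1: "w + g + w \<in> Stab A f'" if g: "g \<in> Stab A f" for g
  proof -
    have gS: "g \<in> Sym A" using g by (simp add: Stab_def)
    have "f' (ap w (ap g (ap w x))) = f' x" if x: "x \<in> A" for x
    proof -
      have "f (ap g (ap w x)) = f (ap w x)" using g x w_in by (simp add: Stab_def)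
      then have "f (ap w (ap w (ap g (ap w x)))) = f (ap w x)" by (simp add: ww)
      then show ?thesis
        using x iff[of "ap w (ap g (ap w x))" x] by (simp add: w_in Sym_in[OF gS])
    qed
    then show ?thesis using w(1) gS by (simp add: Stab_def Sym_plus)
  qed
  have 2: "w + h + w \<in> Stab A f" if h: "h \<in> Stab A f'" for h
  proof -
    have hS: "h \<in> Sym A" using h by (simp add: Stab_def)
    have "f (ap w (ap h (ap w x))) = f x" if x: "x \<in> A" for x
    proof -
      have "f' (ap h (ap w x)) = f' (ap w x)" using h x w_in by (simp add: Stab_def)
      then have "f (ap w (ap h (ap w x))) = f (ap w (ap w x))"
        using x iff[of "ap h (ap w x)" "ap w x"] by (simp add: w_in Sym_in[OF hS])
      then show ?thesis by (simp add: ww)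
    qed
    then show ?thesis using w(1) hS by (simp add: Stab_def Sym_plus)
  qed
  have inv: "w + (w + g + w) + w = g" "w + (w + g + w) = g + w" for g
    by (rule fperm_eqI; simp add: ww)+
  have "(\<Sum>g\<in>Stab A f. G (g + w)) = (\<Sum>h\<in>Stab A f'. G (w + h))"
    by (rule sum.reindex_bij_witness[of _ "\<lambda>h. w + h + w" "\<lambda>g. w + g + w"])
      (use 1 2 inv in simp_all)
  then show ?thesis by (simp add: ssum_def sum_distrib_left sum_distrib_right G_plus)
qed

section \<open>Permutations acting block by block, and the twisted class sum of the rotation\<close>

context blocks
begin

abbreviation "A \<equiv> {0..<n}"

text \<open>Block permutations are described by their action on offsets;
  \<open>block_perm_unique\<close> and \<open>block_perm_plus\<close> reduce identities between them
  to arithmetic of offsets.\<close>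

definition is_block_perm :: "(nat \<Rightarrow> nat \<Rightarrow> nat) \<Rightarrow> fperm \<Rightarrow> bool" where
  "is_block_perm f g \<longleftrightarrow> g \<in> Sym A \<and> (\<forall>s<n. blk (ap g s) = blk s \<and> off (ap g s) = f (blk s) (off s))"

lemma is_block_perm_some:
  assumes f: "\<And>d i. d < m \<Longrightarrow> i \<le> 2 * al d \<Longrightarrow> f d i \<le> 2 * al d"
    and inj: "\<And>d. d < m \<Longrightarrow> inj_on (f d) {..2 * al d}"
  shows "is_block_perm f (SOME g. is_block_perm f g)"
proof -
  let ?S = "SIGMA d:{..<m}. {..2 * al d}"
  have fS: "bij_betw (f d) {..2 * al d} {..2 * al d}" if "d < m" for d
    unfolding bij_betw_def
    using f[OF that] inj[OF that] endo_inj_surj[of "{..2 * al d}" "f d"] by (auto simp: image_subset_iff)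
  have "bij_betw (\<lambda>(d, i). (d, f d i)) ?S ?S"
  proof (rule bij_betw_imageI)
    show "inj_on (\<lambda>(d, i). (d, f d i)) ?S"
      using inj by (auto simp: inj_on_def)
    show "(\<lambda>(d, i). (d, f d i)) ` ?S = ?S"
    proof
      show "(\<lambda>(d, i). (d, f d i)) ` ?S \<subseteq> ?S" using f by auto
      show "?S \<subseteq> (\<lambda>(d, i). (d, f d i)) ` ?S"
      proof clarify
        fix d i assume di: "d < m" "i \<le> 2 * al d"
        then have "i \<in> f d ` {..2 * al d}" using bij_betw_imp_surj_on[OF fS[OF di(1)]] by simp
        then obtain i' where "i' \<le> 2 * al d" "f d i' = i" by auto
        then show "(d, i) \<in> (\<lambda>(d, i). (d, f d i)) ` ?S" using di by force
      qed
    qed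
  qed
  then have "bij_betw (inv_into A (\<lambda>s. (blk s, off s)) \<circ> ((\<lambda>(d, i). (d, f d i)) \<circ> (\<lambda>s. (blk s, off s)))) A A"
    by (intro bij_betw_trans[OF bij_betw_trans[OF blocks_bij] bij_betw_inv_into[OF blocks_bij]])
  from fperm_of_bij[OF finite_atLeastLessThan this]
  obtain g where g: "g \<in> Sym A"
    "\<And>s. s \<in> A \<Longrightarrow> ap g s = inv_into A (\<lambda>s. (blk s, off s)) (blk s, f (blk s) (off s))"
    unfolding comp_apply prod.case by blast
  have "(blk (ap g s), off (ap g s)) = (blk s, f (blk s) (off s))" if "s < n" for s
    unfolding g(2)[of s, simplified, OF that]
    using bij_betw_inv_into_right[OF blocks_bij, of "(blk s, f (blk s) (off s))"]
      blk_less[OF that] f off_le[OF that] by simp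
  then have "is_block_perm f g" using g(1) by (auto simp: is_block_perm_def)
  then show ?thesis by (rule someI)
qed

lemma block_perm_unique:
  assumes g: "is_block_perm f g" and g': "is_block_perm f' g'"
    and eq: "\<And>d i. d < m \<Longrightarrow> i \<le> 2 * al d \<Longrightarrow> f d i = f' d i"
  shows "g = g'"
proof (rule Sym_eqI[of _ A])
  show S: "g \<in> Sym A" "g' \<in> Sym A" using g g' by (simp_all add: is_block_perm_def)
  fix s assume "s \<in> A"
  then have s: "s < n" by simp
  show "ap g s = ap g' s"
  proof (rule block_eq)
    show "ap g s < n" "ap g' s < n" using s by (simp_all add: Sym_less S)
    show "blk (ap g s) = blk (ap g' s)" "off (ap g s) = off (ap g' s)"
      using g g' s eq[OF blk_less[OF s] off_le[OF s]] by (simp_all add: is_block_perm_def)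
  qed
qed

lemma block_perm_plus:
  assumes "is_block_perm f g" "is_block_perm f' g'"
  shows "is_block_perm (\<lambda>d i. f d (f' d i)) (g + g')"
  using assms by (simp add: is_block_perm_def Sym_plus Sym_less)

text \<open>\<open>wo\<close> exchanges the two arms of a hook, \<open>ho\<close> rotates the corner and one arm, and their product
  \<open>ro\<close> is a cycle through the whole hook.\<close>

definition wo :: "nat \<Rightarrow> nat \<Rightarrow> nat" where
  "wo d i = (if i = 0 then 0 else if odd i then i + 1 else i - 1)"
definition ho :: "nat \<Rightarrow> nat \<Rightarrow> nat" where
  "ho d i = (if odd i then i else if i = 2 * al d then 0 else i + 2)"
definition ro :: "nat \<Rightarrow> nat \<Rightarrow> nat" where
  "ro d i = (if i = 2 * al d then 0 else i + 1)"

definition w :: fperm where "w = (SOME g. is_block_perm wo g)"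
definition h0 :: fperm where "h0 = (SOME g. is_block_perm ho g)"
definition rho :: fperm where "rho = (SOME g. is_block_perm ro g)"

lemma odd_le: "odd i \<Longrightarrow> i \<le> 2 * (a :: nat) \<Longrightarrow> i + 1 \<le> 2 * a"
  by presburger

lemma even_le: "even i \<Longrightarrow> i \<le> 2 * (a :: nat) \<Longrightarrow> i \<noteq> 2 * a \<Longrightarrow> i + 2 \<le> 2 * a"
  by presburger

lemma is_w: "is_block_perm wo w"
  unfolding w_def
proof (rule is_block_perm_some)
  show "wo d i \<le> 2 * al d" if "i \<le> 2 * al d" for d i
    using that odd_le[of i "al d"] by (auto simp: wo_def)
  show "inj_on (wo d) {..2 * al d}" for d
    by (rule inj_on_inverseI[of _ "wo d"]) (auto simp: wo_def)
qed

lemma is_h0: "is_block_perm ho h0"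
  unfolding h0_def
proof (rule is_block_perm_some)
  show "ho d i \<le> 2 * al d" if "i \<le> 2 * al d" for d i
    using that even_le[of i "al d"] by (auto simp: ho_def)
  show "inj_on (ho d) {..2 * al d}" for d
    by (rule inj_on_inverseI[of _ "\<lambda>i. if odd i then i else if i = 0 then 2 * al d else i - 2"])
      (auto simp: ho_def odd_pos)
qed

lemma is_rho: "is_block_perm ro rho"
  unfolding rho_def
proof (rule is_block_perm_some)
  show "ro d i \<le> 2 * al d" if "i \<le> 2 * al d" for d i
    using that by (auto simp: ro_def)
  show "inj_on (ro d) {..2 * al d}" for d
    by (auto simp: ro_def inj_on_def split: if_splits)
qed

lemma w_Sym: "w \<in> Sym A" and h0_Sym: "h0 \<in> Sym A" and rho_Sym: "rho \<in> Sym A"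
  using is_w is_h0 is_rho by (simp_all add: is_block_perm_def)

lemma w_blk [simp]: "s < n \<Longrightarrow> blk (ap w s) = blk s" and w_off: "s < n \<Longrightarrow> off (ap w s) = wo (blk s) (off s)"
  using is_w by (simp_all add: is_block_perm_def)

lemma h0_blk [simp]: "s < n \<Longrightarrow> blk (ap h0 s) = blk s" and h0_off: "s < n \<Longrightarrow> off (ap h0 s) = ho (blk s) (off s)"
  using is_h0 by (simp_all add: is_block_perm_def)

lemma w_less [simp]: "ap w s < n \<longleftrightarrow> s < n" and h0_less [simp]: "ap h0 s < n \<longleftrightarrow> s < n"
  by (simp_all add: Sym_less w_Sym h0_Sym)

lemma w_w: "w + w = 0"
proof (rule Sym_eqI[of _ A])
  fix s assume "s \<in> A"
  then have s: "s < n" by simp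
  show "ap (w + w) s = ap 0 s"
    by (rule block_eq) (use s in \<open>auto simp: w_off wo_def\<close>)
qed (simp_all add: Sym_plus w_Sym)

lemma ww [simp]: "ap w (ap w s) = s"
  using w_w by (metis ap_plus_apply ap_zero id_apply)

lemma rho_eq: "rho = w + h0"
proof (rule block_perm_unique[OF is_rho block_perm_plus[OF is_w is_h0]])
  show "ro d i = wo d (ho d i)" if "i \<le> 2 * al d" for d i
    using that by (auto simp: ro_def wo_def ho_def odd_pos)
qed

text \<open>Groups the corner with the even arm. Conjugation by \<open>w\<close> carries this to the
  grouping of \<open>Cf\<close>, so \<open>Hg\<close> and \<open>Kg\<close> stand to
  \<open>w\<close> as the row and column groups stand to the transposition of a tableau.\<close>

definition Rf :: "nat \<Rightarrow> nat + nat" where "Rf s = (if even (off s) then Inl (blk s) else Inr s)"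

abbreviation "Kg \<equiv> Stab A Cf"
abbreviation "Hg \<equiv> Stab A Rf"
abbreviation "Sg \<equiv> Stab A Sf"

lemma Kg: "subgrp A Kg" and Hg: "subgrp A Hg" and Sg: "subgrp A Sg"
  by (simp_all add: subgrp_Stab)

lemma Hg_even: "h \<in> Hg \<Longrightarrow> s < n \<Longrightarrow> even (off s) \<Longrightarrow> blk (ap h s) = blk s \<and> even (off (ap h s))"
  using StabD(1)[of h A Rf s] by (auto simp: Rf_def split: if_splits)

lemma Hg_odd: "h \<in> Hg \<Longrightarrow> s < n \<Longrightarrow> odd (off s) \<Longrightarrow> ap h s = s"
  using StabD(1)[of h A Rf s] by (auto simp: Rf_def split: if_splits)

lemma Hg_less: "h \<in> Hg \<Longrightarrow> ap h s < n \<longleftrightarrow> s < n"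
  using StabD(2)[of h A Rf] by (simp add: Sym_less)

lemma h0_Hg: "h0 \<in> Hg"
proof -
  have "ap h0 s = s" if "s < n" "odd (off s)" for s
    by (rule block_eq) (simp_all add: that h0_off ho_def)
  then have "Rf (ap h0 s) = Rf s" if "s < n" for s
    using that by (cases "odd (off s)") (auto simp: Rf_def h0_off ho_def)
  then show ?thesis using h0_Sym by (simp add: Stab_def)
qed

lemma Hg_w: "ssum Hg * G w = G w * ssum Kg"
proof (rule ssum_conj_Stab[OF _ w_Sym w_w])
  fix x y assume xy: "x \<in> A" "y \<in> A"
  have ev: "even (off (ap w z)) \<longleftrightarrow> off z = 0 \<or> odd (off z)" if "z < n" for z
    using that by (auto simp: w_off wo_def)
  show "Rf (ap w x) = Rf (ap w y) \<longleftrightarrow> Cf x = Cf y"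
    using xy by (simp add: Rf_def Cf_def ev)
qed simp

lemma Sg_Hg: "Sg \<subseteq> Hg"
proof
  fix g assume g: "g \<in> Sg"
  have "Rf (ap g s) = Rf s" if s: "s < n" for s
    using StabD(1)[OF g, of s] s by (auto simp: Sf_def Rf_def split: if_splits)
  then show "g \<in> Hg" using g by (simp add: Stab_def)
qed

definition corner :: "nat \<Rightarrow> nat" where "corner d = (SOME s. s < n \<and> blk s = d \<and> off s = 0)"

lemma corner: "d < m \<Longrightarrow> corner d < n" "d < m \<Longrightarrow> blk (corner d) = d" "d < m \<Longrightarrow> off (corner d) = 0"
  using someI_ex[OF block_cell[of d 0]] by (auto simp: corner_def)

definition even_cells :: "nat \<Rightarrow> nat set" where
  "even_cells d = {s. s < n \<and> blk s = d \<and> even (off s)}"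

lemma even_cells_eq: "d < m \<Longrightarrow> even_cells d = insert (corner d) (SS d)"
  using corner[of d] by (auto simp: even_cells_def SS_def intro: block_eq)

lemma card_even_cells: "d < m \<Longrightarrow> card (even_cells d) = Suc (al d)"
  using card_SS[of d] corner[of d] by (simp add: even_cells_eq SS_def)

lemma Hg_even_cells: "h \<in> Hg \<Longrightarrow> s \<in> even_cells d \<Longrightarrow> ap h s \<in> even_cells d"
  using Hg_even[of h s] Hg_less[of h s] by (auto simp: even_cells_def)

lemma Hg_funpow: "h \<in> Hg \<Longrightarrow> s \<in> even_cells d \<Longrightarrow> (ap h ^^ i) s \<in> even_cells d"
  by (induction i) (auto intro: Hg_even_cells)

lemma corner_even_cells: "d < m \<Longrightarrow> corner d \<in> even_cells d"
  by (simp add: even_cells_def corner)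

text \<open>Let \<open>U\<close> be the even cells of the block outside the orbit of the corner. On
  \<open>U\<close> the permutation \<open>h + w\<close> acts as \<open>w\<close>, since
  \<open>h\<close> fixes odd cells, and from the image of \<open>U\<close> under \<open>w\<close> it
  returns to \<open>U\<close>. An orbit starting in \<open>U\<close> alternates between even and odd
  cells and so has even length.\<close>

lemma short_orbit:
  assumes h: "h \<in> Hg" and d: "d < m" and short: "least_power (ap h) (corner d) \<noteq> Suc (al d)"
  shows "phi A (G (h + w)) = 0"
proof -
  let ?T = "set (support (ap h) (corner d))"
  have range: "?T = range (\<lambda>i. (ap h ^^ i) (corner d))" by (rule support_set) simp
  have sub: "?T \<subseteq> even_cells d" unfolding range using Hg_funpow[OF h corner_even_cells[OF d]] by auto
  have "card ?T = least_power (ap h) (corner d)"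
    using distinct_card[OF cycle_of_permutation[of "ap h" "corner d"]] by simp
  then have "?T \<noteq> even_cells d" using short card_even_cells[OF d] by metis
  then obtain x where x: "x \<in> even_cells d" "x \<notin> ?T" using sub by blast
  define U where "U = even_cells d - ?T"
  have corner_T: "corner d \<in> ?T" unfolding range by (rule range_eqI[of _ _ 0]) simp
  have hU: "ap h y \<in> U" if y: "y \<in> U" for y
  proof -
    have "ap h y \<notin> ?T"
    proof
      assume "ap h y \<in> ?T"
      then obtain i where i: "ap h y = (ap h ^^ i) (corner d)" unfolding range by blast
      have "\<exists>j. ap h y = (ap h ^^ Suc j) (corner d)"
      proof (cases i)
        case 0
        have "(ap h ^^ Suc (least_power (ap h) (corner d) - 1)) (corner d) = corner d"
          using least_power_of_permutation[of "ap h" "corner d"] by simp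
        then show ?thesis using i 0 by (metis funpow_0)
      qed (use i in blast)
      then obtain j where "ap h y = ap h ((ap h ^^ j) (corner d))" by auto
      then have "y = (ap h ^^ j) (corner d)" by simp
      then show False using y unfolding U_def range by blast
    qed
    then show ?thesis using y Hg_even_cells[OF h] by (simp add: U_def)
  qed
  have U: "y < n \<and> even (off y) \<and> off y \<noteq> 0" if y: "y \<in> U" for y
  proof -
    have "y \<noteq> corner d" using y corner_T by (auto simp: U_def)
    then show ?thesis using y even_cells_eq[OF d] by (auto simp: U_def SS_def)
  qed
  have step1: "ap (h + w) y = ap w y \<and> odd (off (ap w y))" if y: "y \<in> U" for y
  proof -
    have "odd (off (ap w y))" using U[OF y] by (simp add: w_off wo_def)
    then show ?thesis using Hg_odd[OF h, of "ap w y"] U[OF y] by simp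
  qed
  have x': "x \<in> U" using x by (simp add: U_def)
  define S where "S = ap (h + w)"
  have S: "S y = ap h (ap w y)" "permutation S" for y by (simp_all add: S_def)
  have orbit: "(even i \<longrightarrow> (S ^^ i) x \<in> U) \<and> (odd i \<longrightarrow> ap w ((S ^^ i) x) \<in> U)" for i
  proof (induction i)
    case (Suc i)
    show ?case
    proof (cases "even i")
      case True
      then have "(S ^^ i) x \<in> U" using Suc by blast
      then have "S ((S ^^ i) x) = ap w ((S ^^ i) x)" using step1 unfolding S_def by blast
      then show ?thesis using Suc True by simp
    next
      case False
      then have "S ((S ^^ i) x) \<in> U" using Suc hU unfolding S(1)[of "(S ^^ i) x"] by blast
      then show ?thesis using False by simp
    qed
  qed (simp add: x')
  have "even (least_power S x)"
  proof (rule ccontr)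
    assume "odd (least_power S x)"
    then have "ap w x \<in> U"
      using orbit[of "least_power S x"] least_power_of_permutation(1)[OF S(2), of x] by simp
    then show False using step1[OF x'] U by blast
  qed
  moreover have "h + w \<in> Sym A" using h w_Sym by (simp add: Stab_def Sym_plus)
  ultimately show ?thesis using x(1) unfolding S_def by (intro phi_even_orbit[of A "h + w" x]) (auto simp: even_cells_def)
qed

text \<open>Sending the cell of offset 2i to the i-th iterate of \<open>h\<close> on the corner
  defines a \<open>g\<close> that conjugates \<open>h0\<close> to \<open>h\<close>. Combined with
  its mirror image on the odd arms it also commutes with \<open>w\<close>.\<close>

lemma full_orbits:
  assumes h: "h \<in> Hg" and full: "\<And>d. d < m \<Longrightarrow> least_power (ap h) (corner d) = Suc (al d)"
  shows "\<exists>g\<in>Sym A. sg g = 1 \<and> h + w = g + (h0 + w) + - g"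
proof -
  define gf where "gf s = (if odd (off s) then s else (ap h ^^ (off s div 2)) (corner (blk s)))" for s
  have gf_even: "gf s \<in> even_cells (blk s)" if "s < n" "even (off s)" for s
    using that Hg_funpow[OF h corner_even_cells[OF blk_less[OF that(1)]]] by (simp add: gf_def)
  have lt: "i < Suc (al d) \<Longrightarrow> j < Suc (al d) \<Longrightarrow> (ap h ^^ i) (corner d) = (ap h ^^ j) (corner d) \<Longrightarrow> i = j"
    if d: "d < m" for i j d
  proof -
    assume ij: "i < Suc (al d)" "j < Suc (al d)" "(ap h ^^ i) (corner d) = (ap h ^^ j) (corner d)"
    have "distinct (support (ap h) (corner d))" by (rule cycle_of_permutation) simp
    then have "inj_on (\<lambda>i. (ap h ^^ i) (corner d)) (set [0..<Suc (al d)])"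
      unfolding full[OF d] distinct_map by blast
    then have "inj_on (\<lambda>i. (ap h ^^ i) (corner d)) {0..<Suc (al d)}" by (simp only: set_upt)
    then show "i = j" using ij by (auto dest: inj_onD)
  qed
  have gf_inj: "inj_on gf A"
  proof (rule inj_onI)
    fix s t assume s: "s \<in> A" and t: "t \<in> A" and eq: "gf s = gf t"
    show "s = t"
    proof (cases "odd (off s) \<or> odd (off t)")
      case True
      then have "odd (off s) \<and> odd (off t)"
        using gf_even[of s] gf_even[of t] s t eq by (auto simp: gf_def even_cells_def split: if_splits)
      then show ?thesis using eq by (simp add: gf_def)
    next
      case False
      then have b: "blk s = blk t" using gf_even[of s] gf_even[of t] s t eq by (auto simp: even_cells_def)
      have "off s div 2 = off t div 2"
      proof (rule lt[of "blk s"])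
        show "blk s < m" using s by (simp add: blk_less)
        show "off s div 2 < Suc (al (blk s))" "off t div 2 < Suc (al (blk s))"
          using off_le[of s] off_le[of t] s t b by auto
        show "(ap h ^^ (off s div 2)) (corner (blk s)) = (ap h ^^ (off t div 2)) (corner (blk s))"
          using eq False b by (simp add: gf_def)
      qed
      then have "off s = off t" using False by (auto elim!: evenE)
      from block_eq[OF _ _ b this] s t show ?thesis by simp
    qed
  qed
  have "gf s \<in> A" if "s \<in> A" for s
    using that gf_even[of s] by (cases "odd (off s)") (auto simp: gf_def even_cells_def)
  then have "gf ` A \<subseteq> A" by auto
  then have "bij_betw gf A A"
    using gf_inj endo_inj_surj[of A gf] by (simp add: bij_betw_def)
  from fperm_of_bij[OF finite_atLeastLessThan this] obtain g where
    g: "g \<in> Sym A" "\<And>s. s < n \<Longrightarrow> ap g s = gf s" by auto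
  have g_odd: "ap g s = s" if "s < n" "odd (off s)" for s using that g(2) by (simp add: gf_def)
  have g_corner: "ap g (corner d) = corner d" if "d < m" for d
    using that g(2) corner by (simp add: gf_def)
  have g_even: "even (off (ap g s))" if "s < n" "even (off s)" for s
    using that g(2) gf_even[of s] by (simp add: even_cells_def)
  have hg: "h + g = g + h0"
  proof (rule Sym_eqI[of _ A])
    show "h + g \<in> Sym A" "g + h0 \<in> Sym A" using g(1) h h0_Sym by (simp_all add: Stab_def Sym_plus)
    fix s assume "s \<in> A"
    then have s: "s < n" by simp
    show "ap (h + g) s = ap (g + h0) s"
    proof (cases "odd (off s)")
      case True
      have "ap h0 s = s" by (rule Hg_odd[OF h0_Hg s True])
      then show ?thesis using Hg_odd[OF h s True] g_odd[OF s True] by simp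
    next
      case even: False
      have d: "blk s < m" by (rule blk_less[OF s])
      show ?thesis
      proof (cases "off s = 2 * al (blk s)")
        case True
        then have off0: "off (ap h0 s) = 0" using s by (simp add: h0_off ho_def)
        have "ap h0 s = corner (blk s)"
          by (rule block_eq) (use off0 s corner[OF d] in simp_all)
        then have "ap (g + h0) s = corner (blk s)" using g_corner[OF d] by simp
        moreover have "ap (h + g) s = (ap h ^^ Suc (al (blk s))) (corner (blk s))"
          using g(2)[OF s] even True by (simp add: gf_def)
        moreover have "(ap h ^^ Suc (al (blk s))) (corner (blk s)) = corner (blk s)"
          using least_power_of_permutation(1)[of "ap h" "corner (blk s)"] full[OF d] by simp
        ultimately show ?thesis by simp
      next
        case False
        then have "off (ap h0 s) = off s + 2" using s even by (simp add: h0_off ho_def)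
        then have "ap (g + h0) s = (ap h ^^ Suc (off s div 2)) (corner (blk s))"
          using g(2)[of "ap h0 s"] s even by (simp add: gf_def)
        then show ?thesis using g(2)[OF s] even by (simp add: gf_def)
      qed
    qed
  qed
  \<comment> \<open>\<open>g\<close> fixes corners and odd cells, so \<open>u\<close> moves only odd
    cells and commutes with \<open>g\<close> and \<open>h0\<close>. Conjugation by \<open>w\<close>
    exchanges \<open>g\<close> and \<open>u\<close>, hence fixes \<open>g + u\<close>, which is even
    because \<open>g\<close> and \<open>u\<close> have equal signs.\<close>
  define u where "u = w + g + w"
  have u_even: "ap u s = s" if s: "s < n" "even (off s)" for s
  proof (cases "off s = 0")
    case True
    have "s = corner (blk s)"
      by (rule block_eq) (use True s corner[OF blk_less[OF s(1)]] in simp_all)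
    moreover have "ap w s = s"
      by (rule block_eq) (use True s in \<open>simp_all add: w_off wo_def\<close>)
    ultimately show ?thesis using g_corner[OF blk_less[OF s(1)]] by (simp add: u_def)
  next
    case False
    then have "odd (off (ap w s))" using s by (simp add: w_off wo_def)
    then have "ap g (ap w s) = ap w s" using g_odd s by simp
    then show ?thesis by (simp add: u_def)
  qed
  have uS: "u \<in> Sym A" using g(1) w_Sym by (simp add: u_def Sym_plus)
  have comm: "u + f = f + u" if f: "f \<in> Sym A" "\<And>s. s < n \<Longrightarrow> odd (off s) \<Longrightarrow> ap f s = s" for f
  proof (rule commute_disjoint)
    fix x show "ap u x = x \<or> ap f x = x"
      using u_even[of x] f(2)[of x] Sym_notin[OF uS, of x] by (cases "x < n") auto
  qed
  have ug: "u + g = g + u" by (rule comm[OF g(1) g_odd])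
  have uh0: "u + h0 = h0 + u" by (rule comm[OF h0_Sym Hg_odd[OF h0_Hg]])
  have wg: "w + (g + u) = (g + u) + w"
  proof -
    have "w + (g + u) = u + g + w" unfolding u_def by (simp add: add.assoc)
    then show ?thesis by (simp add: ug)
  qed
  have "(h + w) + (g + u) = h + ((g + u) + w)" by (simp add: add.assoc wg)
  also have "\<dots> = (h + g) + u + w" by (simp add: add.assoc)
  also have "\<dots> = g + (h0 + u) + w" by (simp add: hg add.assoc)
  also have "\<dots> = (g + u) + (h0 + w)" by (simp add: uh0[symmetric] add.assoc)
  finally have "h + w = (g + u) + (h0 + w) + - (g + u)"
    by (metis add.assoc add_0_right right_minus)
  moreover have "sg (g + u) = 1" using sg_cases[of g] sg_cases[of w] by (auto simp: u_def)
  moreover have "g + u \<in> Sym A" using g(1) uS by (rule Sym_plus)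
  ultimately show ?thesis by blast
qed

text \<open>Unless \<open>h\<close> is a full cycle on the even offsets of every block, \<open>h + w\<close> has a cycle of even
  length; that cycle is an odd permutation in the centralizer and kills the twisted average.\<close>

lemma phi_rho: "\<exists>s. s \<noteq> 0 \<and> phi A (ssum Hg * G w) = scl s (phi A (G rho))"
proof -
  define F where "F = {h \<in> Hg. \<exists>g\<in>Sym A. sg g = 1 \<and> h + w = g + (h0 + w) + - g}"
  have F: "F \<subseteq> Hg" "h0 \<in> F" using h0_Hg by (auto simp: F_def intro!: bexI[of _ 0])
  have "finite F" using F(1) subgrpD(2)[OF Hg] finite_subset by blast
  then have cF: "card F \<noteq> 0" using F(2) by auto
  have "phi A (ssum Hg * G w) = (\<Sum>h\<in>Hg. phi A (G (h + w)))"
    by (simp add: ssum_def sum_distrib_right phi_sum G_plus)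
  also have "\<dots> = (\<Sum>h\<in>F. phi A (G (h + w)))"
  proof (rule sum.mono_neutral_right[OF subgrpD(2)[OF Hg] F(1)], rule ballI)
    fix h assume h: "h \<in> Hg - F"
    then obtain d where "d < m" "least_power (ap h) (corner d) \<noteq> Suc (al d)"
      using full_orbits[of h] unfolding F_def by blast
    then show "phi A (G (h + w)) = 0" using short_orbit h by blast
  qed
  also have "\<dots> = (\<Sum>h\<in>F. scl 1 (phi A (G (h0 + w))))"
  proof (rule sum.cong[OF refl])
    fix h assume "h \<in> F"
    then obtain g where g: "g \<in> Sym A" "sg g = 1" "h + w = g + (h0 + w) + - g" by (auto simp: F_def)
    show "phi A (G (h + w)) = scl 1 (phi A (G (h0 + w)))"
      unfolding g(3) using phi_conj[OF g(1), of "h0 + w"] g(2) by simp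
  qed
  also have "\<dots> = scl (of_nat (card F)) (phi A (G (h0 + w)))"
    by (simp only: scl_sum_left[symmetric]) simp
  also have "h0 + w = w + rho + - w"
    using w_w by (simp add: rho_eq minus_unique[OF w_w] flip: add.assoc)
  then have "phi A (G (h0 + w)) = scl (sg w) (phi A (G rho))"
    using phi_conj[OF w_Sym, of rho] by simp
  finally have "phi A (ssum Hg * G w) = scl (of_nat (card F) * sg w) (phi A (G rho))" by simp
  moreover have "of_nat (card F) * sg w \<noteq> 0" using cF by simp
  ultimately show ?thesis by blast
qed

text \<open>Gives the class sum the left factors that \<open>block_tableau\<close> asks for:
  \<open>phi_alternating\<close> produces \<open>asum Kg\<close>, and \<open>ssum Sg\<close> can be
  inserted up to a factor because \<open>Sg\<close> is a subgroup of \<open>Hg\<close>.\<close>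

lemma phi_rho': "\<exists>s. phi A (G rho) = scl s (phi A (asum Kg * ssum Sg * (ssum Hg * G w)))"
proof -
  obtain s where s: "s \<noteq> 0" "phi A (ssum Hg * G w) = scl s (phi A (G rho))" using phi_rho by blast
  define N where "N = (of_nat (card Hg) :: complex)"
  define M where "M = (of_nat (card Sg) :: complex)"
  have nz: "N \<noteq> 0" "M \<noteq> 0" using subgrpD(8)[OF Hg] subgrpD(8)[OF Sg] by (simp_all add: N_def M_def)
  have "asum Kg * ssum Sg * (ssum Hg * G w) = asum Kg * (ssum Sg * ssum Hg) * G w" by (simp add: mult.assoc)
  also have "\<dots> = scl M (asum Kg * ssum Hg * G w)"
    by (simp add: ssum_ssum_sub[OF Hg Sg Sg_Hg] M_def mult.assoc)
  finally have "phi A (asum Kg * ssum Sg * (ssum Hg * G w)) = scl M (phi A (asum Kg * ssum Hg * G w))"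
    by (simp only: phi_scl)
  also have "\<dots> = scl (M * N * s) (phi A (G rho))"
    unfolding phi_alternating[OF Hg Kg w_Sym Hg_w] s(2) by (simp add: N_def mult.assoc)
  finally have "phi A (asum Kg * ssum Sg * (ssum Hg * G w)) = scl (M * N * s) (phi A (G rho))" .
  then have "scl (1 / (M * N * s)) (phi A (asum Kg * ssum Sg * (ssum Hg * G w))) = phi A (G rho)"
    using nz s(1) by simp
  then show ?thesis by metis
qed

lemma Kg_SS_fix: "g \<in> Kg \<Longrightarrow> y \<in> SS d \<Longrightarrow> ap g y = y"
  using StabD(1)[of g A Cf y] by (auto simp: Cf_def SS_def split: if_splits)

lemma Kg_transp: "y \<in> SS d \<Longrightarrow> y' \<in> SS d \<Longrightarrow> G (transp y y') * asum Kg = asum Kg * G (transp y y')"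
  unfolding asum_def sum_distrib_left sum_distrib_right
  by (rule sum.cong) (simp_all add: conj_transp[of _ y y'] Kg_SS_fix flip: G_plus)

end

text \<open>Both factors are twisted sums, one with \<open>asum Kg * ssum Sg\<close> and one with
  \<open>b * a\<close> in every term. If the product is nonzero, some element \<open>x\<close>
  between these two pieces gives a nonzero \<open>v\<close>, and \<open>hooks_bounded\<close>
  applies to it.\<close>

theorem (in sym_tableau) phi_rho_Y:
  assumes bl: "blocks n m al blk off" and ne: "phi A (G (blocks.rho n al blk off)) * Y \<noteq> 0"
  shows "(\<forall>i<m. al i + i + 1 = card (row i)) \<or>
    (\<exists>p<m. (\<forall>i<p. al i + i + 1 = card (row i)) \<and> al p + p + 1 < card (row p))"
proof -
  interpret B: blocks n m al blk off by (rule bl)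
  have "\<exists>x\<in>Alg A. asum B.Kg * ssum B.Sg * x * (b * a) \<noteq> 0"
  proof (rule ccontr)
    assume "\<not> ?thesis"
    then have zero: "asum B.Kg * ssum B.Sg * x * (b * a) = 0" if "x \<in> Alg A" for x using that by blast
    obtain s where s: "phi A (G B.rho) = scl s (phi A (asum B.Kg * ssum B.Sg * (ssum B.Hg * G B.w)))"
      using B.phi_rho' by blast
    have 1: "asum B.Kg * ssum B.Sg * x * phi A (b * a * G w) = 0" if x: "x \<in> Alg A" for x
    proof -
      have "asum B.Kg * ssum B.Sg * x * (scl (sg g) (G g * (b * a * G w) * G (- g))) = 0"
        if g: "g \<in> Sym A" for g
      proof -
        have "x * G g \<in> Alg A" using x g by (intro Alg_mult Alg_G)
        from zero[OF this] have "asum B.Kg * ssum B.Sg * (x * G g) * (b * a) * (G w * G (- g)) = 0" by simp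
        then show ?thesis by (simp add: mult.assoc)
      qed
      then show ?thesis unfolding phi_def sum_distrib_left by (intro sum.neutral) blast
    qed
    have "scl (sg g) (G g * (asum B.Kg * ssum B.Sg * (ssum B.Hg * G B.w)) * G (- g)) * phi A (b * a * G w) = 0"
      if g: "g \<in> Sym A" for g
    proof -
      have "ssum B.Hg * G B.w * G (- g) \<in> Alg A"
        using g by (intro Alg_mult Alg_G ssum_Alg[OF B.Hg] B.w_Sym Sym_uminus)
      from 1[OF this] have "G g * (asum B.Kg * ssum B.Sg * (ssum B.Hg * G B.w * G (- g)) * phi A (b * a * G w)) = 0" by simp
      then show ?thesis by (simp add: mult.assoc)
    qed
    then have "phi A (asum B.Kg * ssum B.Sg * (ssum B.Hg * G B.w)) * phi A (b * a * G w) = 0"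
      unfolding phi_def[of A "asum B.Kg * ssum B.Sg * _"] sum_distrib_right by (intro sum.neutral) blast
    then have "phi A (G B.rho) * phi A (b * a * G w) = 0" by (simp add: s)
    then have "scl (of_nat (card R)) (phi A (G B.rho) * Y) = 0" by (simp add: phi_baw)
    then show False using ne scl_eq_0_iff[OF card_R_nonzero] by blast
  qed
  then obtain x where x: "x \<in> Alg A" "asum B.Kg * ssum B.Sg * x * (b * a) \<noteq> 0" by blast
  define v where "v = asum B.Kg * ssum B.Sg * x * (b * a)"
  interpret V: block_tableau n D r k m al blk off v
  proof
    fix y y' d g assume y: "y \<in> B.CC d" "y' \<in> B.CC d" "y \<noteq> y'"
    have t: "transp y y' \<in> B.Kg"
      using y by (intro transp_Stab) (auto simp: B.CC_def B.Cf_def)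
    have "G (transp y y') * v = (G (transp y y') * asum B.Kg) * (ssum B.Sg * x * (b * a))"
      by (simp add: v_def mult.assoc)
    also have "\<dots> = - v"
      using G_asum(1)[OF B.Kg t] y(3) by (simp add: sg_transp v_def scl_minus1 mult.assoc)
    finally have "lk (G (transp y y') * v) g = lk (- v) g" by simp
    then show "lk v (transp y y' + g) = - lk v g" by simp
  next
    fix y y' d g assume y: "y \<in> B.SS d" "y' \<in> B.SS d"
    have t: "transp y y' \<in> B.Sg"
      using y by (intro transp_Stab) (auto simp: B.SS_def B.Sf_def)
    have "G (transp y y') * v = (G (transp y y') * asum B.Kg) * (ssum B.Sg * (x * (b * a)))"
      by (simp add: v_def mult.assoc)
    also have "\<dots> = asum B.Kg * (G (transp y y') * ssum B.Sg) * (x * (b * a))"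
      by (simp add: B.Kg_transp[OF y] mult.assoc)
    also have "\<dots> = v" by (simp add: G_ssum(1)[OF B.Sg t] v_def mult.assoc)
    finally have "lk (G (transp y y') * v) g = lk v g" by simp
    then show "lk v (transp y y' + g) = lk v g" by simp
  next
    fix g h assume h: "h \<in> R"
    then have "- h \<in> R" by (rule subgrpD(6)[OF R])
    from G_ssum(2)[OF R this] have "v * G (- h) = v" by (simp add: v_def mult.assoc)
    then have "lk (v * G (- h)) g = lk v g" by simp
    then show "lk v (g + h) = lk v g" by simp
  next
    fix x0 i g assume x0: "x0 < n" "i < r x0"
    have "v * (1 + (\<Sum>y\<in>row i. G (transp x0 y)))
        = asum B.Kg * ssum B.Sg * x * (b * a * (1 + (\<Sum>y\<in>row i. G (transp x0 y))))"
      by (simp only: v_def mult.assoc)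
    also have "\<dots> = 0" unfolding garnir[OF x0] by simp
    finally have "v + (\<Sum>y\<in>row i. v * G (transp x0 y)) = 0"
      by (simp only: distrib_left mult_1_right sum_distrib_left)
    then have "lk (v + (\<Sum>y\<in>row i. v * G (transp x0 y))) g = 0" by simp
    then have "lk v g + (\<Sum>y\<in>row i. lk v (g - transp x0 y)) = 0"
      by (simp only: lookup_add lookup_sum lk_mult_G)
    then show "lk v g + (\<Sum>y\<in>row i. lk v (g + transp x0 y)) = 0"
      by (simp only: diff_conv_add_uminus transp_self)
  next
    show "v \<in> Alg A" unfolding v_def
      by (intro Alg_mult asum_Alg[OF B.Kg] ssum_Alg[OF B.Sg] x(1) a_Alg b_Alg)
  qed
  have "v \<noteq> 0" using x(2) by (simp add: v_def)
  from V.hooks_bounded[OF this] show ?thesis unfolding V.nu_def .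
qed

section \<open>Hook shapes and cycle types\<close>

text \<open>A partition of \<open>n\<close> into distinct odd parts \<open>2 * a + 1\<close>, stored
  by the numbers \<open>a\<close>: the same list describes a cycle type and the arm lengths of a
  self-conjugate diagram.\<close>

definition arms :: "nat \<Rightarrow> nat list \<Rightarrow> bool" where
  "arms n as \<longleftrightarrow> sorted_wrt (>) as \<and> (\<Sum>a\<leftarrow>as. 2 * a + 1) = n"

text \<open>The self-conjugate Young diagram with diagonal hooks of lengths \<open>2 * as ! d + 1\<close>.\<close>

definition hook_shape :: "nat list \<Rightarrow> (nat \<times> nat) set" where
  "hook_shape as = {(i, j). min i j < length as \<and> max i j \<le> min i j + as ! min i j}"

abbreviation labelling :: "nat \<Rightarrow> nat list \<Rightarrow> (nat \<Rightarrow> nat) \<Rightarrow> (nat \<Rightarrow> nat) \<Rightarrow> bool" where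
  "labelling n as blk off \<equiv> blocks n (length as) ((!) as) blk off"

abbreviation rot :: "nat \<Rightarrow> nat list \<Rightarrow> (nat \<Rightarrow> nat) \<Rightarrow> (nat \<Rightarrow> nat) \<Rightarrow> fperm" where
  "rot n as blk off \<equiv> blocks.rho n ((!) as) blk off"

lemma arms_decr: 
  assumes "arms n as" "i < j" "j < length as" shows "as ! j + (j - i) \<le> as ! i"
  using assms(2,3)
proof (induction j)
  case (Suc j)
  have "as ! Suc j < as ! j"
    using assms(1) Suc.prems by (auto simp: arms_def sorted_wrt_iff_nth_less)
  then show ?case using Suc by (cases "i = j") auto
qed simp

lemma hook_row:
  assumes "arms n as"
  shows "(i, j) \<in> hook_shape as \<Longrightarrow> length as \<le> i \<Longrightarrow> j < i"
    and "i < length as \<Longrightarrow> (i, j) \<in> hook_shape as \<longleftrightarrow> j \<le> i + as ! i"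
proof -
  show "(i, j) \<in> hook_shape as \<Longrightarrow> length as \<le> i \<Longrightarrow> j < i"
    by (auto simp: hook_shape_def min_def split: if_splits)
  assume i: "i < length as"
  show "(i, j) \<in> hook_shape as \<longleftrightarrow> j \<le> i + as ! i"
  proof (cases "j < i")
    case True
    then show ?thesis using arms_decr[OF assms True i] i by (simp add: hook_shape_def)
  qed (use i in \<open>simp add: hook_shape_def\<close>)
qed

lemma hook_shape_sym: "(i, j) \<in> hook_shape as \<Longrightarrow> (j, i) \<in> hook_shape as"
  by (simp add: hook_shape_def min.commute max.commute)

lemma hook_row_down:
  assumes as: "arms n as" and ij: "(i, j) \<in> hook_shape as" and j': "j' \<le> j"
  shows "(i, j') \<in> hook_shape as"
proof (cases "i < length as")
  case True
  then show ?thesis using ij j' hook_row(2)[OF as True] by simp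
next
  case False
  have ji: "j < i" using hook_row(1)[OF as ij] False by simp
  have jl: "j < length as" using ij ji by (simp add: hook_shape_def)
  have "i \<le> j + as ! j" using ij ji by (simp add: hook_shape_def)
  moreover have "j + as ! j \<le> j' + as ! j'"
    using arms_decr[OF as _ jl, of j'] j' by (cases "j' = j") auto
  ultimately show ?thesis using ji jl j' by (simp add: hook_shape_def)
qed

lemma card_hook_sigma: "card (SIGMA d:{..<length as}. {..2 * as ! d}) = (\<Sum>a\<leftarrow>as. 2 * a + 1)"
  by (simp add: sum_list_sum_nth atLeast0LessThan)

lemma card_hook_shape: assumes as: "arms n as" shows "finite (hook_shape as)" "card (hook_shape as) = n"
proof -
  \<comment> \<open>Offsets up to \<open>as ! d\<close> run from the corner along row
    \<open>d\<close>, the remaining ones down column \<open>d\<close>.\<close>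
  define f where "f = (\<lambda>(d, i). if i \<le> as ! d then (d, d + i) else (d + (i - as ! d), d))"
  define g where "g = (\<lambda>(i, j). if i \<le> j then (i, j - i) else (j, as ! j + (i - j)))"
  have "bij_betw f (SIGMA d:{..<length as}. {..2 * as ! d}) (hook_shape as)"
  proof (rule bij_betw_byWitness[of _ g])
    show "\<forall>p\<in>SIGMA d:{..<length as}. {..2 * as ! d}. g (f p) = p"
      by (auto simp: f_def g_def)
    show "\<forall>p\<in>hook_shape as. f (g p) = p"
      by (auto simp: f_def g_def hook_shape_def)
    show "f ` (SIGMA d:{..<length as}. {..2 * as ! d}) \<subseteq> hook_shape as"
      by (auto simp: f_def hook_shape_def split: if_splits)
    show "g ` hook_shape as \<subseteq> (SIGMA d:{..<length as}. {..2 * as ! d})"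
      by (auto simp: g_def hook_shape_def min_def split: if_splits)
  qed
  from bij_betw_same_card[OF this] bij_betw_finite[OF this]
  show "finite (hook_shape as)" "card (hook_shape as) = n"
    using as by (simp_all only: card_hook_sigma arms_def) auto
qed

lemma sym_tableau_hook_shape:
  assumes as: "arms n as" and bij: "bij_betw (\<lambda>x. (r x, k x)) {0..<n} (hook_shape as)"
  shows "sym_tableau n (hook_shape as) r k"
proof
  show "bij_betw (\<lambda>x. (r x, k x)) {0..<n} (hook_shape as)" by (rule bij)
  show "(i, j) \<in> hook_shape as \<Longrightarrow> j' \<le> j \<Longrightarrow> (i, j') \<in> hook_shape as" for i j j'
    by (rule hook_row_down[OF as])
  show "(i, j) \<in> hook_shape as \<Longrightarrow> (j, i) \<in> hook_shape as" for i j
    by (rule hook_shape_sym)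
  then show "(i, j) \<in> hook_shape as \<Longrightarrow> i' \<le> i \<Longrightarrow> (i', j) \<in> hook_shape as" for i i' j
    using hook_row_down[OF as] by blast
qed

lemma ex_tableau:
  assumes "arms n as" shows "\<exists>r k. sym_tableau n (hook_shape as) r k"
proof -
  obtain f where "bij_betw f {0..<n} (hook_shape as)"
    using ex_bij_betw_nat_finite[OF card_hook_shape(1)[OF assms]] card_hook_shape(2)[OF assms] by auto
  then have "bij_betw (\<lambda>x. (fst (f x), snd (f x))) {0..<n} (hook_shape as)" by simp
  from sym_tableau_hook_shape[OF assms this] show ?thesis by blast
qed

lemma hook_shape_eq:
  assumes "arms n as" "arms n' as'" "hook_shape as = hook_shape as'" shows "as = as'"
proof -
  have diag: "(i, i) \<in> hook_shape as \<longleftrightarrow> i < length as" for i as by (simp add: hook_shape_def)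
  have len: "length as = length as'"
    using diag[of _ as] diag[of _ as'] assms(3) by (metis linorder_neqE_nat nat_less_le)
  show ?thesis
  proof (rule nth_equalityI[OF len])
    fix i assume i: "i < length as"
    have "j \<le> i + as ! i \<longleftrightarrow> j \<le> i + as' ! i" for j
      using hook_row(2)[OF assms(1) i] hook_row(2)[OF assms(2), of i] i len assms(3) by simp
    from this[of "i + as ! i"] this[of "i + as' ! i"] show "as ! i = as' ! i" by simp
  qed
qed

lemma labelling_conj:
  assumes "labelling n as blk off" "labelling n as blk' off'"
  shows "\<exists>x\<in>Sym {0..<n}. rot n as blk' off' = x + rot n as blk off + - x"
proof -
  interpret L: blocks n "length as" "(!) as" blk off by fact
  interpret M: blocks n "length as" "(!) as" blk' off' by fact
  have "bij_betw (inv_into {0..<n} (\<lambda>s. (blk' s, off' s)) \<circ> (\<lambda>s. (blk s, off s))) {0..<n} {0..<n}"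
    by (rule bij_betw_trans[OF L.blocks_bij bij_betw_inv_into[OF M.blocks_bij]])
  from fperm_of_bij[OF finite_atLeastLessThan this]
  obtain x where x: "x \<in> Sym {0..<n}"
    "\<And>s. s \<in> {0..<n} \<Longrightarrow> ap x s = inv_into {0..<n} (\<lambda>s. (blk' s, off' s)) (blk s, off s)"
    unfolding comp_apply by blast
  have x': "(blk' (ap x s), off' (ap x s)) = (blk s, off s)" if "s < n" for s
    unfolding x(2)[of s, simplified, OF that]
    using bij_betw_inv_into_right[OF M.blocks_bij, of "(blk s, off s)"]
      L.blk_less[OF that] L.off_le[OF that] by simp
  have "M.rho + x = x + L.rho"
  proof (rule Sym_eqI[of _ "{0..<n}"])
    show "M.rho + x \<in> Sym {0..<n}" "x + L.rho \<in> Sym {0..<n}"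
      using x(1) L.rho_Sym M.rho_Sym by (simp_all add: Sym_plus)
    fix s assume "s \<in> {0..<n}"
    then have s: "s < n" by simp
    have xs: "ap x s < n" "ap L.rho s < n" using s by (simp_all add: Sym_less x(1) L.rho_Sym)
    have L: "blk (ap L.rho s) = blk s" "off (ap L.rho s) = L.ro (blk s) (off s)"
      using L.is_rho s by (simp_all add: L.is_block_perm_def)
    have M: "blk' (ap M.rho (ap x s)) = blk s" "off' (ap M.rho (ap x s)) = L.ro (blk s) (off s)"
      using M.is_rho xs(1) x'[OF s] by (simp_all add: M.is_block_perm_def)
    have "ap M.rho (ap x s) = ap x (ap L.rho s)"
    proof (rule M.block_eq)
      show "ap M.rho (ap x s) < n" "ap x (ap L.rho s) < n"
        using xs by (simp_all add: Sym_less x(1) M.rho_Sym)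
      show "blk' (ap M.rho (ap x s)) = blk' (ap x (ap L.rho s))"
        "off' (ap M.rho (ap x s)) = off' (ap x (ap L.rho s))"
        using M L x'[OF xs(2)] by simp_all
    qed
    then show "ap (M.rho + x) s = ap (x + L.rho) s" by simp
  qed
  then have "M.rho = x + L.rho + - x" by (metis add.assoc add_0_right right_minus)
  then show ?thesis using x(1) by blast
qed

context blocks
begin

text \<open>Reversal of every block (fixing the corners) conjugates the rotation to its inverse.\<close>

definition vo :: "nat \<Rightarrow> nat \<Rightarrow> nat" where "vo d i = (if i = 0 then 0 else 2 * al d + 1 - i)"
definition rev_blocks :: fperm where "rev_blocks = (SOME g. is_block_perm vo g)"

lemma is_rev: "is_block_perm vo rev_blocks"
  unfolding rev_blocks_def
proof (rule is_block_perm_some)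
  show "vo d i \<le> 2 * al d" if "i \<le> 2 * al d" for d i using that by (auto simp: vo_def)
  show "inj_on (vo d) {..2 * al d}" for d
    by (rule inj_on_inverseI[of _ "vo d"]) (auto simp: vo_def)
qed

lemma rev_Sym: "rev_blocks \<in> Sym A"
  using is_rev by (simp add: is_block_perm_def)

lemma is_block_perm_id: "is_block_perm (\<lambda>d i. i) 0"
  by (simp add: is_block_perm_def)

lemma rev_rev: "rev_blocks + rev_blocks = 0"
  by (rule block_perm_unique[OF block_perm_plus[OF is_rev is_rev] is_block_perm_id]) (auto simp: vo_def)

lemma uminus_rho: "- rho = rev_blocks + rho + - rev_blocks"
proof -
  have "rho + (rev_blocks + (rho + rev_blocks)) = 0"
    by (rule block_perm_unique[OF block_perm_plus[OF is_rho block_perm_plus[OF is_rev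
            block_perm_plus[OF is_rho is_rev]]] is_block_perm_id])
      (auto simp: vo_def ro_def)
  then have "- rho = rev_blocks + (rho + rev_blocks)" by (rule minus_unique)
  moreover have "- rev_blocks = rev_blocks" using rev_rev by (rule minus_unique)
  ultimately show ?thesis by (simp add: add.assoc del: add_uminus_conv_diff)
qed

end

text \<open>Exchanging the two cycles point by point commutes with \<open>g\<close>. It is a product
  of as many transpositions as the cycles are long, an odd number.\<close>

lemma two_orbits:
  assumes A: "finite A" "g \<in> Sym A" "x \<in> A" "y \<in> A"
    and len: "least_power (ap g) y = least_power (ap g) x" and odd: "odd (least_power (ap g) x)"
    and disj: "\<And>i. (ap g ^^ i) x \<noteq> y"
  shows "phi A (G g) = 0"
proof -
  define l where "l = least_power (ap g) x"
  define X where "X i = (ap g ^^ i) x" for i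
  define Y where "Y i = (ap g ^^ i) y" for i
  have pg: "permutation (ap g)" by simp
  have l: "l > 0" "X l = x" "Y l = y"
    using least_power_of_permutation[OF pg, of x] least_power_of_permutation[OF pg, of y] len
    by (simp_all add: l_def X_def Y_def)
  have inA: "X i \<in> A" "Y i \<in> A" for i
    unfolding X_def Y_def by (induction i) (use A in \<open>auto simp: Sym_in\<close>)
  have step: "ap g (X i) = X (Suc i)" "ap g (Y i) = Y (Suc i)" for i by (simp_all add: X_def Y_def)
  have inj: "X i = X j \<longleftrightarrow> i = j" "Y i = Y j \<longleftrightarrow> i = j" if "i < l" "j < l" for i j
  proof -
    have "inj_on X (set [0..<l])" "inj_on Y (set [0..<l])"
      using cycle_of_permutation[OF pg, of x] cycle_of_permutation[OF pg, of y]
      unfolding distinct_map len X_def[abs_def] Y_def[abs_def] l_def by blast+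
    then show "X i = X j \<longleftrightarrow> i = j" "Y i = Y j \<longleftrightarrow> i = j"
      using that by (simp_all add: inj_on_eq_iff)
  qed
  have XY: "X i \<noteq> Y j" if "i < l" "j < l" for i j
  proof
    assume eq: "X i = Y j"
    have "(ap g ^^ (l - j)) (Y j) = (ap g ^^ (l - j + j)) y" by (simp only: Y_def funpow_add comp_apply)
    then have "(ap g ^^ (l - j)) (Y j) = Y l" using that by (simp add: Y_def)
    then have "(ap g ^^ (l - j)) (X i) = y" using eq l by simp
    then have "(ap g ^^ (l - j + i)) x = y" by (simp add: X_def funpow_add)
    then show False using disj by blast
  qed
  have "\<exists>c\<in>Sym A. sg c = (- 1) ^ p \<and> (\<forall>i<p. ap c (X i) = Y i \<and> ap c (Y i) = X i) \<and>
      (\<forall>z. z \<notin> X ` {..<p} \<union> Y ` {..<p} \<longrightarrow> ap c z = z)" if "p \<le> l" for p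
    using that
  proof (induction p)
    case 0
    show ?case by (intro bexI[of _ 0]) auto
  next
    case (Suc p)
    then obtain c where c: "c \<in> Sym A" "sg c = (- 1) ^ p"
      "\<And>i. i < p \<Longrightarrow> ap c (X i) = Y i \<and> ap c (Y i) = X i"
      "\<And>z. z \<notin> X ` {..<p} \<union> Y ` {..<p} \<Longrightarrow> ap c z = z" by auto
    define c' where "c' = transp (X p) (Y p) + c"
    have p: "p < l" using Suc.prems by simp
    have "X p \<notin> X ` {..<p}" "Y p \<notin> Y ` {..<p}" "X p \<notin> Y ` {..<p}" "Y p \<notin> X ` {..<p}"
    proof -
      have "X p \<noteq> X i" "Y p \<noteq> Y i" "X p \<noteq> Y i" "Y p \<noteq> X i" if "i < p" for i
        using inj[of p i] XY[of p i] XY[of i p] p that by auto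
      then show "X p \<notin> X ` {..<p}" "Y p \<notin> Y ` {..<p}" "X p \<notin> Y ` {..<p}" "Y p \<notin> X ` {..<p}" by blast+
    qed
    then have "ap c (X p) = X p" "ap c (Y p) = Y p" using c(4) by blast+
    then have "ap c' (X i) = Y i \<and> ap c' (Y i) = X i" if "i < Suc p" for i
      using that c(3)[of i] p inj[of i p] XY[of i p] XY[of p i]
      by (cases "i = p") (auto simp: c'_def ap_transp Transposition.transpose_def)
    moreover have "ap c' z = z" if z: "z \<notin> X ` {..<Suc p} \<union> Y ` {..<Suc p}" for z
    proof -
      have "z \<noteq> X p" "z \<noteq> Y p" "z \<notin> X ` {..<p} \<union> Y ` {..<p}" using z by auto
      then show ?thesis using c(4)[of z] by (simp add: c'_def ap_transp)
    qed
    moreover have "c' \<in> Sym A" unfolding c'_def by (intro Sym_plus transp_Sym inA c(1))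
    moreover have "sg c' = (- 1) ^ Suc p" using XY[OF p p] by (simp add: c'_def sg_transp c(2))
    ultimately show ?case by blast
  qed
  from this[of l] obtain c where c: "c \<in> Sym A" "sg c = (- 1) ^ l"
      "\<And>i. i < l \<Longrightarrow> ap c (X i) = Y i \<and> ap c (Y i) = X i"
      "\<And>z. z \<notin> X ` {..<l} \<union> Y ` {..<l} \<Longrightarrow> ap c z = z" by auto
  have next_ex: "\<exists>j<l. X (Suc i) = X j \<and> Y (Suc i) = Y j" if "i < l" for i
  proof (cases "Suc i = l")
    case True
    then show ?thesis using l by (intro exI[of _ 0]) (simp add: X_def Y_def)
  next
    case False
    then show ?thesis using that by (intro exI[of _ "Suc i"]) simp
  qed
  have "c + g = g + c"
  proof (rule fperm_eqI)
    fix z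
    show "ap (c + g) z = ap (g + c) z"
    proof (cases "z \<in> X ` {..<l} \<union> Y ` {..<l}")
      case True
      then obtain i where i: "i < l" "z = X i \<or> z = Y i" by auto
      obtain j where j: "j < l" "X (Suc i) = X j" "Y (Suc i) = Y j" using next_ex[OF i(1)] by blast
      have cj: "ap c (X (Suc i)) = Y (Suc i)" "ap c (Y (Suc i)) = X (Suc i)"
        unfolding j(2,3) using c(3)[OF j(1)] by auto
      show ?thesis
      proof (rule disjE[OF i(2)])
        assume "z = X i"
        then show ?thesis using c(3)[OF i(1)] cj by (simp add: step)
      next
        assume "z = Y i"
        then show ?thesis using c(3)[OF i(1)] cj by (simp add: step)
      qed
    next
      case False
      have "ap g z \<notin> X ` {..<l} \<union> Y ` {..<l}"
      proof
        assume "ap g z \<in> X ` {..<l} \<union> Y ` {..<l}"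
        then obtain i where i: "i < l" "ap g z = X i \<or> ap g z = Y i" by auto
        obtain j where j: "j < l" "X i = X (Suc j)" "Y i = Y (Suc j)"
        proof (cases i)
          case 0
          have "X 0 = X (Suc (l - 1))" "Y 0 = Y (Suc (l - 1))" using l by (simp_all add: X_def Y_def)
          then show ?thesis using that[of "l - 1"] 0 l(1) by simp
        next
          case (Suc j)
          then show ?thesis using that[of j] i(1) by simp
        qed
        then have "ap g z = ap g (X j) \<or> ap g z = ap g (Y j)" using i(2) by (simp add: step)
        then have "z = X j \<or> z = Y j" by simp
        then show False using False j(1) by auto
      qed
      then show ?thesis using c(4)[OF False] c(4)[of "ap g z"] by simp
    qed
  qed
  moreover have "sg c = - 1" using c(2) odd by (simp add: l_def)
  ultimately show ?thesis using c(1) by (intro phi_odd_centralizer) 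
qed

text \<open>\<open>phi_even_orbit\<close> excludes cycles of even length and
  \<open>two_orbits\<close> two cycles of equal odd length. A cycle is thus determined by its
  length: blocks are numbered by decreasing length, and offsets count steps from a chosen base
  point.\<close>

lemma odd_distinct_cycle_type:
  assumes g: "g \<in> Sym {0..<n}" and nz: "phi {0..<n} (G g) \<noteq> 0"
  shows "\<exists>as blk off. arms n as \<and> labelling n as blk off \<and> g = rot n as blk off"
proof -
  define L where "L x = least_power (ap g) x" for x
  define orb where "orb x i = (ap g ^^ i) x" for x i
  have pg: "permutation (ap g)" by simp
  have orb_less: "orb x i < n \<longleftrightarrow> x < n" for x i
    unfolding orb_def by (induction i) (simp_all add: Sym_less[OF g])
  have orb_L: "orb x (L x) = x" "L x > 0" for x
    using least_power_of_permutation[OF pg, of x] by (simp_all add: orb_def L_def)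
  have orb_add: "orb (orb x i) j = orb x (i + j)" for x i j
    by (simp add: orb_def add.commute[of i] funpow_add)
  have dvd: "orb x i = x \<longleftrightarrow> L x dvd i" for x i
    unfolding orb_def L_def using least_power_dvd[OF pg] by blast
  have orb_inj: "orb x i = orb y i \<longleftrightarrow> x = y" for x y i
    unfolding orb_def by (induction i) auto
  have L_O: "L (orb x i) = L x" for x i
  proof (rule dvd_antisym)
    have "orb (orb x i) (L x) = orb (orb x (L x)) i" by (simp add: orb_add add.commute)
    then show "L (orb x i) dvd L x" using dvd orb_L(1) by simp
    have "orb (orb x (L (orb x i))) i = orb (orb x i) (L (orb x i))" by (simp add: orb_add add.commute)
    also have "\<dots> = orb x i" by (rule orb_L)
    finally have "orb x (L (orb x i)) = x" by (simp add: orb_inj)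
    then show "L x dvd L (orb x i)" by (simp add: dvd)
  qed
  have odd: "odd (L x)" if "x < n" for x
    using phi_even_orbit[OF _ g, of x] nz that by (auto simp: L_def)
  have same: "\<exists>i. orb x i = y" if "x < n" "y < n" "L x = L y" for x y
    using two_orbits[OF _ g, of x y] odd[OF that(1)] that nz by (auto simp: L_def orb_def)
  have same': "\<exists>i<L x. orb x i = y" if xy: "x < n" "y < n" "L x = L y" for x y
  proof -
    obtain i where i: "orb x i = y" using same[OF xy] by blast
    have "orb x (i mod L x) = orb x i"
    proof -
      have "orb x i = orb (orb x (L x * (i div L x))) (i mod L x)" by (simp add: orb_add)
      moreover have "orb x (L x * (i div L x)) = x" by (simp add: dvd)
      ultimately show ?thesis by simp
    qed
    then show ?thesis using i orb_L(2)[of x] by (intro exI[of _ "i mod L x"]) simp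
  qed
  have uniq: "i = j" if "orb x i = orb x j" "i < L x" "j < L x" for x i j
  proof -
    have *: "i' = j'" if "i' \<le> j'" "orb x i' = orb x j'" "j' < L x" for i' j'
    proof -
      have "orb (orb x (j' - i')) i' = orb x i'" using that by (simp add: orb_add)
      then have "orb x (j' - i') = x" by (simp add: orb_inj)
      then have "L x dvd j' - i'" by (simp add: dvd)
      then have "j' - i' = 0" using that by (metis dvd_imp_le less_imp_diff_less not_gr_zero not_le)
      then show ?thesis using that by simp
    qed
    show ?thesis using *[of i j] *[of j i] that by (cases "i \<le> j") auto
  qed
  define S where "S = (\<lambda>x. L x div 2) ` {0..<n}"
  define as where "as = rev (sorted_list_of_set S)"
  have set_as: "set as = S" by (simp add: as_def S_def)
  have decr: "sorted_wrt (>) as"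
    unfolding as_def sorted_wrt_rev using strict_sorted_list_of_set[of S] by simp
  have dist: "distinct as" by (simp add: as_def)
  define blk where "blk s = (SOME d. d < length as \<and> as ! d = L s div 2)" for s
  have blk: "blk s < length as" "as ! blk s = L s div 2" if "s < n" for s
  proof -
    have "L s div 2 \<in> set as" using that by (auto simp: set_as S_def)
    then have "\<exists>d. d < length as \<and> as ! d = L s div 2" by (simp add: in_set_conv_nth)
    from someI_ex[OF this] show "blk s < length as" "as ! blk s = L s div 2" by (simp_all add: blk_def)
  qed
  have L_eq: "L s = 2 * (as ! blk s) + 1" if "s < n" for s
    using odd[OF that] blk(2)[OF that] by presburger
  have blk_eq: "blk s = d" if "s < n" "d < length as" "as ! d = L s div 2" for s d
    using nth_eq_iff_index_eq[OF dist, of "blk s" d] blk[OF that(1)] that by simp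
  define base where "base l = (SOME x. x < n \<and> L x = l)" for l
  have base: "base (L s) < n" "L (base (L s)) = L s" if "s < n" for s
    using someI[of "\<lambda>x. x < n \<and> L x = L s" s] that by (simp_all add: base_def)
  define off where "off s = (SOME i. i < L s \<and> orb (base (L s)) i = s)" for s
  have off: "off s < L s" "orb (base (L s)) (off s) = s" if "s < n" for s
    using someI_ex[OF same'[OF base(1)[OF that] that base(2)[OF that], unfolded base(2)[OF that]]]
    by (simp_all add: off_def)
  have off_eq: "off s = i" if "s < n" "i < L s" "orb (base (L s)) i = s" for s i
    by (rule uniq[of "base (L s)"]) (use off[OF that(1)] base[OF that(1)] that in simp_all)
  have bij: "bij_betw (\<lambda>s. (blk s, off s)) {0..<n} (SIGMA d:{..<length as}. {..2 * as ! d})"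
  proof (rule bij_betw_imageI)
    show "inj_on (\<lambda>s. (blk s, off s)) {0..<n}"
    proof (rule inj_onI)
      fix s t assume st: "s \<in> {0..<n}" "t \<in> {0..<n}" "(blk s, off s) = (blk t, off t)"
      then have "L s = L t" using L_eq[of s] L_eq[of t] by simp
      then have "orb (base (L s)) (off s) = orb (base (L t)) (off t)" using st(3) by simp
      moreover have "s < n" "t < n" using st by simp_all
      ultimately show "s = t" using off(2) by metis
    qed
    show "(\<lambda>s. (blk s, off s)) ` {0..<n} = (SIGMA d:{..<length as}. {..2 * as ! d})"
    proof
      show "(\<lambda>s. (blk s, off s)) ` {0..<n} \<subseteq> (SIGMA d:{..<length as}. {..2 * as ! d})"
      proof clarsimp
        fix s assume s: "s < n"
        show "blk s < length as \<and> off s \<le> 2 * as ! blk s"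
          using blk(1)[OF s] off(1)[OF s] L_eq[OF s] by simp
      qed
      show "(SIGMA d:{..<length as}. {..2 * as ! d}) \<subseteq> (\<lambda>s. (blk s, off s)) ` {0..<n}"
      proof clarsimp
        fix d i assume d: "d < length as" and i: "i \<le> 2 * as ! d"
        have "as ! d \<in> S" using nth_mem[OF d] by (simp add: set_as)
        then obtain x where x: "x < n" "as ! d = L x div 2" by (auto simp: S_def)
        define s where "s = orb (base (L x)) i"
        have s: "s < n" "L s = L x" using base[OF x(1)] by (simp_all add: s_def orb_less L_O)
        have "blk s = d" by (rule blk_eq[OF s(1) d]) (simp add: s(2) x(2))
        moreover have "off s = i"
        proof (rule off_eq[OF s(1)])
          show "i < L s" 
            using i odd_two_times_div_two_succ[OF odd[OF x(1)]] unfolding s(2) x(2) by linarith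
          show "orb (base (L s)) i = s" by (simp add: s(2)) (simp add: s_def)
        qed
        ultimately show "(d, i) \<in> (\<lambda>s. (blk s, off s)) ` {0..<n}" using s(1) by force
      qed
    qed
  qed
  have arms: "arms n as"
    using bij_betw_same_card[OF bij] decr by (simp only: card_hook_sigma arms_def) simp
  interpret B: blocks n "length as" "(!) as" blk off
    by unfold_locales (use bij decr in \<open>simp_all add: sorted_wrt_iff_nth_less\<close>)
  have "B.is_block_perm B.ro g"
    unfolding B.is_block_perm_def
  proof (intro conjI g allI impI)
    fix s assume s: "s < n"
    have gs: "ap g s < n" using s by (simp add: Sym_less[OF g])
    have g1: "ap g s = orb s 1" by (simp add: orb_def)
    then have Lg: "L (ap g s) = L s" by (simp only: L_O)
    show "blk (ap g s) = blk s" by (rule blk_eq[OF gs blk(1)[OF s]]) (simp add: Lg blk(2)[OF s])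
    show "off (ap g s) = B.ro (blk s) (off s)"
    proof (rule off_eq[OF gs])
      show "B.ro (blk s) (off s) < L (ap g s)"
        using off(1)[OF s] by (simp add: B.ro_def Lg L_eq[OF s])
      have g2: "ap g s = orb (base (L s)) (off s + 1)"
        unfolding g1 by (subst (1) off(2)[OF s, symmetric]) (simp only: orb_add)
      show "orb (base (L (ap g s))) (B.ro (blk s) (off s)) = ap g s"
      proof (cases "off s = 2 * as ! blk s")
        case True
        then have "off s + 1 = L (base (L s))" using L_eq[OF s] base(2)[OF s] by simp
        then have "ap g s = base (L s)" using g2 orb_L(1)[of "base (L s)"] by simp
        moreover have "B.ro (blk s) (off s) = 0" using True by (simp add: B.ro_def)
        ultimately show ?thesis unfolding Lg by (simp add: orb_def)
      next
        case False
        then have "B.ro (blk s) (off s) = off s + 1" by (simp add: B.ro_def)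
        then show ?thesis unfolding Lg using g2 by simp
      qed
    qed
  qed
  then have "g = B.rho" by (rule B.block_perm_unique[OF _ B.is_rho]) simp
  then show ?thesis using arms B.blocks_axioms by blast
qed

section \<open>The support of the twisted central element\<close>

text \<open>The prefix \<open>as'\<close> already exhausts the sum, while every further entry would
  contribute at least 1.\<close>

lemma sum_list_take_le: "length as' \<le> length as \<Longrightarrow> (\<And>i. i < length as' \<Longrightarrow> as' ! i = as ! i) \<Longrightarrow>
    (\<Sum>a\<leftarrow>as'. 2 * a + 1) = (\<Sum>a\<leftarrow>as. 2 * a + (1 :: nat)) \<Longrightarrow> as' = as"
proof -
  assume len: "length as' \<le> length as" and eq: "\<And>i. i < length as' \<Longrightarrow> as' ! i = as ! i"
    and sum: "(\<Sum>a\<leftarrow>as'. 2 * a + 1) = (\<Sum>a\<leftarrow>as. 2 * a + (1 :: nat))"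
  have take: "take (length as') as = as'" using len eq by (intro nth_equalityI) auto
  then have "(\<Sum>a\<leftarrow>as. 2 * a + (1 :: nat)) = (\<Sum>a\<leftarrow>as'. 2 * a + 1) + (\<Sum>a\<leftarrow>drop (length as') as. 2 * a + 1)"
    by (metis append_take_drop_id map_append sum_list_append)
  then have "(\<Sum>a\<leftarrow>drop (length as') as. 2 * a + (1 :: nat)) = 0" using sum by simp
  then have "drop (length as') as = []" by (cases "drop (length as') as") auto
  then show "as' = as" using take by (metis append_Nil2 append_take_drop_id)
qed

lemma phi_rot_indep:
  assumes "labelling n as blk off" "labelling n as blk' off'"
  shows "\<exists>s. s \<noteq> 0 \<and> phi {0..<n} (G (rot n as blk' off')) = scl s (phi {0..<n} (G (rot n as blk off)))"
proof -
  obtain x where x: "x \<in> Sym {0..<n}" "rot n as blk' off' = x + rot n as blk off + - x"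
    using labelling_conj[OF assms] by blast
  show ?thesis unfolding x(2) using phi_conj[OF x(1)] by (intro exI[of _ "sg x"]) simp
qed

lemma phi_uminus_rot:
  assumes "labelling n as blk off"
  shows "\<exists>s. s \<noteq> 0 \<and> phi {0..<n} (G (- rot n as blk off)) = scl s (phi {0..<n} (G (rot n as blk off)))"
proof -
  interpret blocks n "length as" "(!) as" blk off by fact
  show ?thesis using phi_conj[OF rev_Sym, of rho] unfolding uminus_rho
    by (intro exI[of _ "sg rev_blocks"]) simp
qed

text \<open>Conjugating back under the trace makes all summands equal. A permutation in the support
  of \<open>Y\<close> thereby yields a nonzero product of a twisted class sum with \<open>Y\<close>,
  the form that \<open>phi_rho_Y\<close> and the orthogonality argument use.\<close>

lemma lk_twisted_phi:
  assumes "finite A" and y: "twisted A y"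
  shows "tau (phi A (G (- g)) * y) = of_nat (card (Sym A)) * lk y g"
proof -
  have "tau (scl (sg h) (G h * G (- g) * G (- h)) * y) = lk y g" if h: "h \<in> Sym A" for h
  proof -
    have "G (- h) * y = scl (sg h) (y * G (- h))"
      using y h by (auto simp: twisted_def)
    then have "G (- h) * y * G h = scl (sg h) y" by (simp add: mult.assoc)
    have "tau (scl (sg h) (G h * G (- g) * G (- h)) * y) = sg h * tau (G h * (G (- g) * (G (- h) * y)))"
      by (simp add: mult.assoc)
    also have "tau (G h * (G (- g) * (G (- h) * y))) = tau (G (- g) * (G (- h) * y * G h))"
      by (subst tau_commute) (simp only: mult.assoc)
    also have "\<dots> = sg h * lk y g" unfolding \<open>G (- h) * y * G h = scl (sg h) y\<close> by (simp add: tau_mult_G)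
    finally show ?thesis by simp
  qed
  then have "tau (phi A (G (- g)) * y) = (\<Sum>h\<in>Sym A. lk y g)"
    unfolding phi_def sum_distrib_right tau_sum by (intro sum.cong) auto
  then show ?thesis by simp
qed

lemma twisted_eq_phi:
  assumes A: "finite A" and y: "twisted A y"
  shows "scl (of_nat (card (Sym A))) y = phi A y"
proof -
  have "scl (sg h) (G h * y * G (- h)) = y" if h: "h \<in> Sym A" for h
    using y h by (simp add: twisted_def mult.assoc)
  then have "phi A y = (\<Sum>h\<in>Sym A. scl 1 y)" unfolding phi_def by (intro sum.cong) auto
  then show ?thesis by (simp only: scl_sum_left[symmetric]) simp
qed

text \<open>Each \<open>Y\<close> is an eigenvector of its own \<open>X\<close> with nonzero
  eigenvalue, the two \<open>X\<close> are central, and their product is zero by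
  \<open>blocks_orthogonal\<close>.\<close>

lemma Y_Y_orthogonal:
  assumes t: "sym_tableau n D r k" and t': "sym_tableau n D' r' k'" and "D \<noteq> D'"
  shows "sym_tableau.Y n r k * sym_tableau.Y n r' k' = 0"
proof -
  interpret T: sym_tableau n D r k by fact
  interpret T': sym_tableau n D' r' k' by fact
  have "T.c * x * T'.c = 0" if "x \<in> Alg {0..<n}" for x
    by (rule blocks_orthogonal[OF T.tableau_axioms T'.tableau_axioms assms(3) that])
  then have c: "G g * T.c * G (- g) * (G h * T'.c * G (- h)) = 0" if "g \<in> Sym {0..<n}" "h \<in> Sym {0..<n}" for g h
  proof -
    have "G (- g) * G h \<in> Alg {0..<n}" using that by (intro Alg_mult Alg_G Sym_uminus)
    from \<open>\<And>x. x \<in> Alg {0..<n} \<Longrightarrow> T.c * x * T'.c = 0\<close>[OF this]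
    have "G g * (T.c * (G (- g) * G h) * T'.c) * G (- h) = 0" by simp
    then show ?thesis by (simp only: mult.assoc)
  qed
  have "psi {0..<n} T.c * psi {0..<n} T'.c = 0"
    unfolding psi_def sum_product by (intro sum.neutral ballI c)
  then have XX: "T.X * T'.X = 0" unfolding T.X_eq T'.X_eq by simp
  have "scl (T.kap * T'.kap) (T.Y * T'.Y) = (T.X * T.Y) * (T'.X * T'.Y)"
    unfolding T.X_Y T'.X_Y by (simp add: mult.commute)
  also have "\<dots> = T.X * (T.Y * T'.X) * T'.Y" by (simp only: mult.assoc)
  also have "T.Y * T'.X = T'.X * T.Y" by (rule T'.X_central[OF twisted_Alg[OF T.twisted_Y]])
  also have "T.X * (T'.X * T.Y) * T'.Y = 0" unfolding mult.assoc[symmetric] XX by simp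
  finally show ?thesis
    using scl_eq_0_iff[of "T.kap * T'.kap"] T.kap_nonzero T'.kap_nonzero by simp
qed

lemma card_row_hook_shape:
  assumes as: "arms n as" and t: "tableau n (hook_shape as) r k"
  shows "i < length as \<Longrightarrow> card (tableau.row n r i) = as ! i + i + 1"
    and "length as \<le> i \<Longrightarrow> card (tableau.row n r i) \<le> i"
proof -
  interpret tableau n "hook_shape as" r k by fact
  show "card (row i) = as ! i + i + 1" if i: "i < length as"
  proof -
    have "j < card (row i) \<longleftrightarrow> j < as ! i + i + 1" for j
      using row_cell[of j i] hook_row(2)[OF as i, of j] by auto
    from this[of "card (row i)"] this[of "as ! i + i + 1"] show ?thesis by linarith
  qed
  show "card (row i) \<le> i" if "length as \<le> i"
    using row_cell[of i i] hook_row(1)[OF as _ that, of i] by (metis not_le less_irrefl)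
qed

text \<open>Lexicographic order by the first difference. Proper prefixes need no clause, since by
  \<open>sum_list_take_le\<close> they never have equal sums of hook lengths.\<close>

definition arms_less :: "(nat list \<times> nat list) set" where
  "arms_less = {(xs, ys). \<exists>p < length xs. p < length ys \<and> (\<forall>i<p. xs ! i = ys ! i) \<and> xs ! p < ys ! p}"

lemma wf_arms_less: "wf {(xs, ys) \<in> arms_less. arms n xs \<and> arms n ys}" (is "wf ?r")
proof (rule finite_acyclic_wf)
  have "{xs. arms n xs} \<subseteq> {xs. set xs \<subseteq> {..n} \<and> length xs \<le> n}"
  proof clarify
    fix xs assume "arms n xs"
    then have sum: "(\<Sum>a\<leftarrow>xs. 2 * a + 1) = n" by (simp add: arms_def)
    have "x \<le> n" if "x \<in> set xs" for x
      using member_le_sum_list[of "2 * x + 1" "map (\<lambda>a. 2 * a + 1) xs"] that sum by force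
    moreover have "length xs \<le> (\<Sum>a\<leftarrow>xs. 2 * a + 1)" by (induction xs) auto
    ultimately show "set xs \<subseteq> {..n} \<and> length xs \<le> n" using sum by auto
  qed
  then have "finite {xs. arms n xs}"
    using finite_lists_length_le[of "{..n}" n] finite_subset by blast
  then have "finite ({xs. arms n xs} \<times> {xs. arms n xs})" by blast
  then show "finite ?r" by (rule finite_subset[rotated]) auto
  have "trans ?r"
  proof (rule transI, clarify)
    fix xs ys zs assume a: "arms n xs" "arms n zs" and "(xs, ys) \<in> arms_less" "(ys, zs) \<in> arms_less"
    then obtain p q where p: "p < length xs" "p < length ys" "\<forall>i<p. xs ! i = ys ! i" "xs ! p < ys ! p"
      and q: "q < length ys" "q < length zs" "\<forall>i<q. ys ! i = zs ! i" "ys ! q < zs ! q"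
      by (auto simp: arms_less_def)
    have "min p q < length xs \<and> min p q < length zs \<and> (\<forall>i<min p q. xs ! i = zs ! i) \<and> xs ! min p q < zs ! min p q"
      using p q by (cases p q rule: linorder_cases) (auto simp: min_def)
    then show "(xs, zs) \<in> arms_less \<and> arms n xs \<and> arms n zs" using a unfolding arms_less_def by blast
  qed
  then show "acyclic ?r"
    by (simp add: acyclic_irrefl trancl_id) (auto simp: irrefl_def arms_less_def)
qed

text \<open>Lexicographic induction: orthogonality of the blocks kills the components of \<open>Y\<close> on the
  smaller classes, and \<open>sym_tableau.phi_rho_Y\<close> those on the larger ones.\<close>

theorem Y_eq_phi_rot:
  assumes "arms n as" "sym_tableau n (hook_shape as) r k" "labelling n as blk off"
  shows "\<exists>c. c \<noteq> 0 \<and> sym_tableau.Y n r k = scl c (phi {0..<n} (G (rot n as blk off)))"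
  using wf_arms_less[of n] assms
proof (induction as arbitrary: r k blk off rule: wf_induct_rule)
  case (less as)
  interpret T: sym_tableau n "hook_shape as" r k by fact
  let ?A = "{0..<n}"
  let ?z = "phi ?A (G (rot n as blk off))"
  have supp: "\<exists>s. phi ?A (G g) = scl s ?z" if g: "lk T.Y g \<noteq> 0" for g
  proof -
    have "tau (phi ?A (G (- g)) * T.Y) \<noteq> 0"
      using lk_twisted_phi[OF _ T.twisted_Y, of g] g by (simp add: card_Sym)
    then have ne: "phi ?A (G (- g)) * T.Y \<noteq> 0" by auto
    then have "phi ?A (G (- g)) \<noteq> 0" by auto
    moreover have gS: "g \<in> Sym ?A" using twisted_Alg[OF T.twisted_Y] g by (auto simp: Alg_def)
    ultimately obtain as' blk' off' where as': "arms n as'" "labelling n as' blk' off'" "- g = rot n as' blk' off'"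
      using odd_distinct_cycle_type[of "- g" n] by auto
    have "(\<forall>i<length as'. as' ! i + i + 1 = card (T.row i)) \<or>
       (\<exists>p<length as'. (\<forall>i<p. as' ! i + i + 1 = card (T.row i)) \<and> as' ! p + p + 1 < card (T.row p))"
      using T.phi_rho_Y[OF as'(2)] ne unfolding as'(3) by blast
    then have "as' = as"
    proof
      assume *: "\<forall>i<length as'. as' ! i + i + 1 = card (T.row i)"
      have lt: "i < length as" if "i < length as'" for i
        using card_row_hook_shape(2)[OF less.prems(1) T.tableau_axioms, of i] * that by force
      have "as' ! i = as ! i" if "i < length as'" for i
        using card_row_hook_shape(1)[OF less.prems(1) T.tableau_axioms lt[OF that]] * that by force
      moreover have "length as' \<le> length as" using lt[of "length as"] by force
      ultimately show ?thesis using sum_list_take_le[of as' as] as'(1) less.prems(1) by (simp add: arms_def)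
    next
      assume "\<exists>p<length as'. (\<forall>i<p. as' ! i + i + 1 = card (T.row i)) \<and> as' ! p + p + 1 < card (T.row p)"
      then obtain p where p: "p < length as'" "\<forall>i<p. as' ! i + i + 1 = card (T.row i)"
        "as' ! p + p + 1 < card (T.row p)" by blast
      have pl: "p < length as"
        using card_row_hook_shape(2)[OF less.prems(1) T.tableau_axioms, of p] p(3) by force
      have "as' ! i = as ! i" if "i < p" for i
        using card_row_hook_shape(1)[OF less.prems(1) T.tableau_axioms, of i] p(2) pl that by force
      moreover have "as' ! p < as ! p"
        using card_row_hook_shape(1)[OF less.prems(1) T.tableau_axioms pl] p(3) by simp
      ultimately have al: "(as', as) \<in> arms_less" using p(1) pl by (auto simp: arms_less_def)
      \<comment> \<open>For the smaller class the induction hypothesis makes the twisted class sum a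
        multiple of the \<open>Y\<close> of shape \<open>as'\<close>, which annihilates
        \<open>T.Y\<close>, contrary to \<open>ne\<close>.\<close>
      obtain r' k' where t': "sym_tableau n (hook_shape as') r' k'" using ex_tableau[OF as'(1)] by blast
      obtain c where c: "c \<noteq> 0" "sym_tableau.Y n r' k' = scl c (phi ?A (G (rot n as' blk' off')))"
        using less.IH[of as' r' k' blk' off'] al as' less.prems(1) t' by blast
      have "as' \<noteq> as" using al by (auto simp: arms_less_def)
      then have "hook_shape as' \<noteq> hook_shape as" using hook_shape_eq[OF as'(1) less.prems(1)] by blast
      from Y_Y_orthogonal[OF t' less.prems(2) this]
      have "scl c (phi ?A (G (- g)) * T.Y) = 0" unfolding c(2) as'(3) by simp
      then show ?thesis using ne scl_eq_0_iff[OF c(1)] by blast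
    qed
    then have l': "labelling n as blk' off'" and g': "- g = rot n as blk' off'" using as' by auto
    \<comment> \<open>The trace pairing determined the class of \<open>- g\<close>; block reversal
      leads back to \<open>g\<close>.\<close>
    have "g = - rot n as blk' off'" using g' by (metis minus_minus)
    then obtain s where "phi ?A (G g) = scl s (phi ?A (G (rot n as blk' off')))"
      using phi_uminus_rot[OF l'] by metis
    moreover obtain t where "phi ?A (G (rot n as blk' off')) = scl t ?z"
      using phi_rot_indep[OF less.prems(3) l'] by blast
    ultimately show ?thesis by auto
  qed
  define f where "f g = (SOME s. phi ?A (G g) = scl s ?z)" for g
  have f: "phi ?A (G g) = scl (f g) ?z" if "lk T.Y g \<noteq> 0" for g
    unfolding f_def by (rule someI_ex) (rule supp[OF that])
  have "scl (of_nat (card (Sym ?A))) T.Y = phi ?A T.Y"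
    by (rule twisted_eq_phi[OF _ T.twisted_Y]) simp
  also have "\<dots> = phi ?A (\<Sum>g\<in>Sym ?A. scl (lk T.Y g) (G g))"
    by (subst (1) Alg_expand[OF _ twisted_Alg[OF T.twisted_Y]]) simp_all
  also have "\<dots> = (\<Sum>g\<in>Sym ?A. scl (lk T.Y g * f g) ?z)"
    unfolding phi_sum phi_scl by (rule sum.cong) (use f in \<open>auto, metis mult_zero_left scl_0(1) scl_scl\<close>)
  also have "\<dots> = scl (\<Sum>g\<in>Sym ?A. lk T.Y g * f g) ?z" by (simp only: scl_sum_left)
  finally have eq: "scl (of_nat (card (Sym ?A))) T.Y = scl (\<Sum>g\<in>Sym ?A. lk T.Y g * f g) ?z" .
  have "(of_nat (card (Sym ?A)) :: complex) \<noteq> 0" by (simp add: card_Sym)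
  then have "T.Y = scl ((\<Sum>g\<in>Sym ?A. lk T.Y g * f g) / of_nat (card (Sym ?A))) ?z"
    using arg_cong[OF eq, of "scl (1 / of_nat (card (Sym ?A)))"] by simp
  moreover from this have "(\<Sum>g\<in>Sym ?A. lk T.Y g * f g) / of_nat (card (Sym ?A)) \<noteq> 0"
    using T.Y_nonzero by (metis scl_0(1))
  ultimately show ?case by blast
qed

section \<open>Constants of the class: sign of the block reversal and centralizer of the
  rotation\<close>

lemma sg_involution:
  assumes A: "finite A"
  shows "g \<in> Sym A \<Longrightarrow> g + g = 0 \<Longrightarrow> even (card {x \<in> A. ap g x \<noteq> x}) \<and> sg g = (- 1) ^ (card {x \<in> A. ap g x \<noteq> x} div 2)"
proof (induction "card {x \<in> A. ap g x \<noteq> x}" arbitrary: g rule: less_induct)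
  case less
  let ?M = "\<lambda>g. {x \<in> A. ap g x \<noteq> x}"
  have gg: "ap g (ap g x) = x" for x using less.prems(2) by (metis ap_plus_apply ap_zero id_apply)
  show ?case
  proof (cases "?M g = {}")
    case True
    then have "g = 0" by (intro Sym_eqI[OF less.prems(1) Sym_zero]) auto
    then show ?thesis by simp
  next
    case False
    then obtain x where x: "x \<in> A" "ap g x \<noteq> x" by auto
    define h where "h = transp x (ap g x) + g"
    have gxA: "ap g x \<in> A" using x less.prems(1) by (simp add: Sym_in)
    have hS: "h \<in> Sym A" unfolding h_def by (intro Sym_plus transp_Sym x gxA less.prems(1))
    have h_x: "ap h x = x" "ap h (ap g x) = ap g x"
      by (simp_all add: h_def ap_transp gg)
    have h_other: "ap h z = ap g z" if "z \<noteq> x" "z \<noteq> ap g x" for z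
    proof -
      have "ap g z \<noteq> x" using that gg by metis
      moreover have "ap g z \<noteq> ap g x" using that by simp
      ultimately show ?thesis by (simp add: h_def ap_transp)
    qed
    have M: "?M g = insert x (insert (ap g x) (?M h))"
    proof (rule Set.set_eqI)
      fix z show "z \<in> ?M g \<longleftrightarrow> z \<in> insert x (insert (ap g x) (?M h))"
        using x gxA gg[of x] h_other[of z] by (cases "z = x"; cases "z = ap g x") auto
    qed
    have nin: "x \<notin> insert (ap g x) (?M h)" "ap g x \<notin> ?M h" using x h_x by auto
    have fin: "finite (?M h)" using A by simp
    have card: "card (?M g) = Suc (Suc (card (?M h)))"
      unfolding M using nin fin by simp
    have "h + h = 0"
    proof (rule fperm_eqI)
      fix z
      show "ap (h + h) z = ap 0 z"
      proof (cases "z = x \<or> z = ap g x")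
        case False
        then have "ap g z \<noteq> x" "ap g z \<noteq> ap g x" using gg by (metis, simp)
        then show ?thesis using False h_other[of z] h_other[of "ap g z"] gg by simp
      qed (use h_x in auto)
    qed
    then have IH: "even (card (?M h)) \<and> sg h = (- 1) ^ (card (?M h) div 2)"
      using card hS by (intro less.hyps) simp_all
    have "g = transp x (ap g x) + h" by (simp add: h_def flip: add.assoc)
    then have "sg g = - sg h" using x(2) by (metis sg_plus sg_transp mult_minus1)
    then show ?thesis using IH card by simp
  qed
qed

context blocks
begin

text \<open>The reversal consists of \<open>al d\<close> transpositions in block \<open>d\<close>.
  The exponent is m(\<lambda>), and this sign is what the square of i^m compensates in
  \<open>tw_coeff_sq\<close>.\<close>

lemma sg_rev: "sg rev_blocks = (- 1) ^ (\<Sum>d<m. al d)"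
proof -
  have moved: "{s \<in> A. ap rev_blocks s \<noteq> s} = (\<Union>d<m. {s. s < n \<and> blk s = d \<and> off s \<in> {0<..2 * al d}})"
  proof (rule Set.set_eqI)
    fix s
    show "s \<in> {s \<in> A. ap rev_blocks s \<noteq> s} \<longleftrightarrow> s \<in> (\<Union>d<m. {s. s < n \<and> blk s = d \<and> off s \<in> {0<..2 * al d}})"
    proof (cases "s < n")
      case s: True
      have b: "blk (ap rev_blocks s) = blk s" "off (ap rev_blocks s) = vo (blk s) (off s)"
        using is_rev s by (simp_all add: is_block_perm_def)
      have "ap rev_blocks s = s \<longleftrightarrow> vo (blk s) (off s) = off s"
      proof
        assume "vo (blk s) (off s) = off s"
        then show "ap rev_blocks s = s"
          by (intro block_eq[of "ap rev_blocks s" s]) (use s b in \<open>simp_all add: Sym_less rev_Sym\<close>)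
      qed (use b in simp)
      also have "\<dots> \<longleftrightarrow> off s = 0" 
        by (cases "off s = 0") (simp_all add: vo_def, use off_le[OF s] in presburger)
      finally show ?thesis using s blk_less[OF s] off_le[OF s] by auto
    qed auto
  qed
  have "card (\<Union>d<m. {s. s < n \<and> blk s = d \<and> off s \<in> {0<..2 * al d}})
      = (\<Sum>d<m. card {s. s < n \<and> blk s = d \<and> off s \<in> {0<..2 * al d}})"
    by (rule card_UN_disjoint) auto
  also have "\<dots> = (\<Sum>d<m. 2 * al d)"
  proof (rule sum.cong[OF refl])
    fix d assume "d \<in> {..<m}"
    then show "card {s. s < n \<and> blk s = d \<and> off s \<in> {0<..2 * al d}} = 2 * al d"
      using card_off[of d "{0<..2 * al d}"] by (simp add: subset_iff)
  qed
  finally have "card {s \<in> A. ap rev_blocks s \<noteq> s} = 2 * (\<Sum>d<m. al d)"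
    unfolding moved by (simp add: sum_distrib_left)
  then show ?thesis using sg_involution[OF _ rev_Sym rev_rev] by simp
qed

text \<open>Independent rotations of the blocks; by \<open>shift_centr\<close> and
  \<open>centr_shift\<close> they form the whole centralizer of \<open>rho\<close>.\<close>

definition shift :: "(nat \<Rightarrow> nat) \<Rightarrow> nat \<Rightarrow> nat \<Rightarrow> nat" where
  "shift v d i = (i + v d) mod (2 * al d + 1)"

lemma ro_eq: "i \<le> 2 * al d \<Longrightarrow> ro d i = (i + 1) mod (2 * al d + 1)"
  by (auto simp: ro_def)

lemma is_shift: "is_block_perm (shift v) (SOME g. is_block_perm (shift v) g)"
proof (rule is_block_perm_some)
  show "shift v d i \<le> 2 * al d" for d i by (simp add: shift_def flip: less_Suc_eq_le)
  show "inj_on (shift v d) {..2 * al d}" for d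
  proof (rule inj_onI)
    fix i j assume ij: "i \<in> {..2 * al d}" "j \<in> {..2 * al d}" "shift v d i = shift v d j"
    then have "(int i + int (v d)) mod int (2 * al d + 1) = (int j + int (v d)) mod int (2 * al d + 1)"
      unfolding shift_def by (metis of_nat_add zmod_int)
    then have "(int i) mod int (2 * al d + 1) = (int j) mod int (2 * al d + 1)"
      by (simp only: mod_add_right_eq mod_diff_cong[of "int i + int (v d)" _ "int j + int (v d)" "int (v d)" "int (v d)", simplified])
    then show "i = j" using ij by simp
  qed
qed

definition centr :: "fperm set" where "centr = {g \<in> Sym A. g + rho = rho + g}"

lemma shift_centr: "is_block_perm (shift v) g \<Longrightarrow> g \<in> centr"
proof -
  assume g: "is_block_perm (shift v) g"
  have "g + rho = rho + g"
  proof (rule block_perm_unique[OF block_perm_plus[OF g is_rho] block_perm_plus[OF is_rho g]])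
    fix d i assume "i \<le> 2 * al d"
    moreover have "shift v d i \<le> 2 * al d" by (simp add: shift_def flip: less_Suc_eq_le)
    ultimately show "shift v d (ro d i) = ro d (shift v d i)"
      by (simp add: ro_eq shift_def mod_simps add.commute add.left_commute)
  qed
  then show ?thesis using g by (simp add: centr_def is_block_perm_def)
qed

lemma funpow_rho:
  assumes s: "s < n"
  shows "(ap rho ^^ i) s < n \<and> blk ((ap rho ^^ i) s) = blk s \<and> off ((ap rho ^^ i) s) = (off s + i) mod (2 * al (blk s) + 1)"
proof (induction i)
  case 0
  show ?case using s off_le[OF s] by simp
next
  case (Suc i)
  let ?t = "(ap rho ^^ i) s"
  have t: "?t < n" "blk ?t = blk s" "off ?t = (off s + i) mod (2 * al (blk s) + 1)" using Suc by auto
  have "off (ap rho ?t) = ro (blk s) (off ?t)" "blk (ap rho ?t) = blk s"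
    using is_rho t by (simp_all add: is_block_perm_def)
  moreover have "ap rho ?t < n" using t(1) by (simp add: Sym_less rho_Sym)
  ultimately show ?case using off_le[OF t(1)] t(2,3)
    by (simp add: ro_eq mod_simps del: One_nat_def) (simp add: mod_Suc_eq)
qed

lemma centr_funpow: "g \<in> centr \<Longrightarrow> ap g ((ap rho ^^ i) s) = (ap rho ^^ i) (ap g s)"
proof (induction i)
  case (Suc i)
  have "ap (g + rho) x = ap (rho + g) x" for x using Suc.prems by (simp add: centr_def)
  then show ?case using Suc by simp
qed simp

text \<open>The power of \<open>rho\<close> given by the block length of \<open>t\<close> fixes
  \<open>t\<close>, hence also its image under \<open>h\<close>, so the block length of the image
  divides that of \<open>t\<close>. The same for \<open>- g\<close> gives equality, and distinct
  blocks have distinct lengths.\<close>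

lemma centr_blk:
  assumes g: "g \<in> centr" and s: "s < n" shows "blk (ap g s) = blk s"
proof -
  have dvd: "(2 * al (blk (ap h t)) + 1) dvd (2 * al (blk t) + 1)" if h: "h \<in> centr" and t: "t < n" for h t
  proof -
    let ?l = "2 * al (blk t) + 1"
    have ht: "ap h t < n" using h t by (simp add: centr_def Sym_less)
    have l: "(off t + ?l) mod ?l = off t"
      by (subst mod_add_self2) (use off_le[OF t] in simp)
    have F: "(ap rho ^^ ?l) t < n \<and> blk ((ap rho ^^ ?l) t) = blk t \<and> off ((ap rho ^^ ?l) t) = off t"
      using funpow_rho[OF t, of ?l] unfolding l .
    have "(ap rho ^^ ?l) t = t"
      by (rule block_eq) (use F t in blast)+
    then have "(ap rho ^^ ?l) (ap h t) = ap h t" using centr_funpow[OF h, of ?l t] by simp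
    then have "(off (ap h t) + ?l) mod (2 * al (blk (ap h t)) + 1) = off (ap h t)"
      using funpow_rho[OF ht, of ?l] by simp
    then have "(off (ap h t) + ?l) mod (2 * al (blk (ap h t)) + 1) = (off (ap h t) + 0) mod (2 * al (blk (ap h t)) + 1)"
      using off_le[OF ht] by simp
    then have "(2 * al (blk (ap h t)) + 1) dvd (off (ap h t) + ?l) - (off (ap h t) + 0)"
      by (subst mod_eq_dvd_iff_nat[symmetric]) simp_all
    then show ?thesis by simp
  qed
  have g': "- g \<in> centr"
  proof -
    have "rho = - g + (g + rho)" by (simp flip: add.assoc)
    also have "\<dots> = - g + rho + g" using g by (simp add: centr_def add.assoc)
    finally have "rho + - g = - g + rho" by (metis add.assoc add_0_right right_minus)
    then show ?thesis using g by (simp add: centr_def)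
  qed
  have gs: "ap g s < n" using g s by (simp add: centr_def Sym_less)
  have "2 * al (blk (ap g s)) + 1 = 2 * al (blk s) + 1"
    using dvd[OF g s] dvd[OF g' gs] by (intro dvd_antisym) simp_all
  then have eq: "al (blk (ap g s)) = al (blk s)" by simp
  show ?thesis
    using al_decr[of "blk (ap g s)" "blk s"] al_decr[of "blk s" "blk (ap g s)"] blk_less[OF s] blk_less[OF gs] eq
    by (metis linorder_neqE_nat less_irrefl)
qed

lemma centr_shift: "g \<in> centr \<Longrightarrow> is_block_perm (shift (\<lambda>d. off (ap g (corner d)))) g"
proof -
  assume g: "g \<in> centr"
  have "off (ap g s) = shift (\<lambda>d. off (ap g (corner d))) (blk s) (off s)" if s: "s < n" for s
  proof -
    have d: "blk s < m" by (rule blk_less[OF s])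
    let ?c = "corner (blk s)"
    have gc: "ap g ?c < n" using g corner[OF d] by (simp add: centr_def Sym_less)
    have "(ap rho ^^ off s) ?c = s"
      by (rule block_eq) (use funpow_rho[OF corner(1)[OF d], of "off s"] corner[OF d] s off_le[OF s] in simp_all)
    then have "ap g s = (ap rho ^^ off s) (ap g ?c)" using centr_funpow[OF g, of "off s" ?c] by simp
    then show ?thesis
      using funpow_rho[OF gc, of "off s"] centr_blk[OF g corner(1)[OF d]] corner(2)[OF d]
      by (simp add: shift_def add.commute)
  qed
  then show ?thesis using g centr_blk[OF g] by (simp add: is_block_perm_def centr_def)
qed

lemma centr_even: "g \<in> centr \<Longrightarrow> sg g = 1"
proof -
  assume "g \<in> centr"
  then obtain v where g: "is_block_perm (shift v) g" using centr_shift by blast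
  \<comment> \<open>\<open>al d + 1\<close> is the inverse of 2 modulo the odd length
    \<open>2 * al d + 1\<close>, so \<open>v'\<close> is half of \<open>v\<close> and
    \<open>g\<close> is a square.\<close>
  define v' where "v' d = v d * (al d + 1)" for d
  obtain h where h: "is_block_perm (shift v') h" using is_shift by blast
  have "g = h + h"
  proof (rule block_perm_unique[OF g block_perm_plus[OF h h]])
    fix d i assume "i \<le> 2 * al d"
    have "v' d + v' d = v d + v d * (2 * al d + 1)" by (simp add: v'_def algebra_simps)
    then have "i + v' d + v' d = (i + v d) + v d * (2 * al d + 1)" by simp
    then show "shift v d i = shift v' d (shift v' d i)"
      by (simp only: shift_def mod_add_left_eq mod_mult_self1)
  qed
  then show ?thesis by simp
qed

lemma card_centr: "card centr = (\<Prod>d<m. 2 * al d + 1)"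
proof -
  let ?P = "PiE {..<m} (\<lambda>d. {..2 * al d})"
  define c where "c v = (SOME g. is_block_perm (shift v) g)" for v
  have c: "is_block_perm (shift v) (c v)" for v
    unfolding c_def by (rule is_shift)
  have off_c: "off (ap (c v) (corner d)) = v d" if "v \<in> ?P" "d < m" for v d
  proof -
    have "off (ap (c v) (corner d)) = shift v d 0"
      using c[of v] corner[OF that(2)] by (simp add: is_block_perm_def)
    moreover have "v d \<le> 2 * al d" using that by (auto simp: PiE_def Pi_def)
    ultimately show ?thesis by (simp add: shift_def)
  qed
  have "bij_betw c ?P centr"
  proof (rule bij_betw_imageI)
    show "inj_on c ?P"
    proof (rule inj_onI)
      fix u v assume uv: "u \<in> ?P" "v \<in> ?P" "c u = c v"
      show "u = v"
        by (rule PiE_ext[OF uv(1,2)]) (use off_c[OF uv(1)] off_c[OF uv(2)] uv(3) in auto)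
    qed
    show "c ` ?P = centr"
    proof
      show "c ` ?P \<subseteq> centr" using shift_centr[OF c] by blast
      show "centr \<subseteq> c ` ?P"
      proof
        fix g assume g: "g \<in> centr"
        define v where "v = restrict (\<lambda>d. off (ap g (corner d))) {..<m}"
        have "v \<in> ?P"
          unfolding v_def
        proof (rule restrict_PiE_iff[THEN iffD2], rule ballI)
          fix d assume "d \<in> {..<m}"
          then have d: "d < m" by simp
          have "ap g (corner d) < n" using g corner[OF d] by (simp add: centr_def Sym_less)
          then show "off (ap g (corner d)) \<in> {..2 * al d}"
            using off_le[of "ap g (corner d)"] centr_blk[OF g corner(1)[OF d]] corner(2)[OF d] by simp
        qed
        moreover have "c v = g"
          by (rule block_perm_unique[OF c centr_shift[OF g]]) (simp add: shift_def v_def)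
        ultimately show "g \<in> c ` ?P" by blast
      qed
    qed
  qed
  then have "card centr = card ?P" using bij_betw_same_card by metis
  then show ?thesis by (simp add: card_PiE)
qed

lemma lk_phi_rho: "lk (phi A (G rho)) rho = of_nat (card centr)"
proof -
  have "lk (phi A (G rho)) rho = (\<Sum>g\<in>Sym A. sg g * (if g + rho + - g = rho then 1 else 0))"
    unfolding phi_def lookup_sum lk_scl by (simp only: lk_G flip: G_plus)
  also have "\<dots> = (\<Sum>g\<in>Sym A. if g \<in> centr then 1 else 0)"
  proof (rule sum.cong[OF refl])
    fix g assume g: "g \<in> Sym A"
    have "g + rho + - g = rho \<longleftrightarrow> g + rho = rho + g"
      by (metis add.assoc add_0_right left_minus right_minus)
    then show "sg g * (if g + rho + - g = rho then 1 else 0) = (if g \<in> centr then 1 else 0)"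
      using g centr_even[of g] by (auto simp: centr_def)
  qed
  also have "\<dots> = of_nat (card (Sym A \<inter> centr))" by (simp add: sum.If_cases)
  also have "Sym A \<inter> centr = centr" by (auto simp: centr_def)
  finally show ?thesis .
qed

text \<open>\<open>lk_twisted_phi\<close> reduces the trace to the coefficient at
  \<open>- rho\<close>, and block reversal relates it to the coefficient at \<open>rho\<close> by
  the sign of the reversal.\<close>

lemma tau_phi_rho_sq:
  "tau (phi A (G rho) * phi A (G rho)) = fact n * (- 1) ^ (\<Sum>d<m. al d) * of_nat (card centr)"
proof -
  have tw: "twisted A (phi A (G rho))" by (intro twisted_phi Alg_G rho_Sym)
  have "tau (phi A (G (- (- rho))) * phi A (G rho)) = of_nat (card (Sym A)) * lk (phi A (G rho)) (- rho)"
    by (rule lk_twisted_phi[OF _ tw]) simp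
  also have "lk (phi A (G rho)) (- rho) = sg rev_blocks * lk (phi A (G rho)) rho"
    unfolding uminus_rho by (rule lk_twisted[OF tw rev_Sym])
  finally show ?thesis by (simp add: card_Sym lk_phi_rho sg_rev)
qed

end

section \<open>Cycle notation and the twisted character\<close>

lemma Sym_induct [consumes 2, case_names zero transp]:
  assumes "finite A" "g \<in> Sym A" "P 0"
    "\<And>a b g. a \<in> A \<Longrightarrow> b \<in> A \<Longrightarrow> a \<noteq> b \<Longrightarrow> P g \<Longrightarrow> g \<in> Sym A \<Longrightarrow> P (transp a b + g)"
  shows "P g"
proof -
  have "P (Fperm p)" if "p permutes A" for p
    using that assms(1)
  proof (induction rule: permutes_induct)
    case id
    show ?case using assms(3) unfolding zero_fperm_def .
  next
    case (swap a b p)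
    have p: "ap (Fperm p) = p" by (rule ap_Fperm_permutes[OF assms(1) \<open>p permutes A\<close>])
    have "Fperm p \<in> Sym A" by (rule Fperm_Sym[OF assms(1) \<open>p permutes A\<close>])
    then have "P (transp a b + Fperm p)"
      by (rule assms(4)[OF \<open>a \<in> A\<close> \<open>b \<in> A\<close> \<open>a \<noteq> b\<close> \<open>P (Fperm p)\<close>])
    moreover have "transp a b + Fperm p = Fperm (Transposition.transpose a b \<circ> p)"
      unfolding plus_fperm_def ap_transp p ..
    ultimately show ?case by (simp only:)
  qed
  from this[of "ap g"] show ?thesis using assms(2) by (simp add: Sym_def ap_inverse)
qed

section \<open>The sign as a product over inversions\<close>

definition pairs :: "nat \<Rightarrow> (nat \<times> nat) set" where "pairs n = {(s, t). s < t \<and> t < n}"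
definition inv_factor :: "fperm \<Rightarrow> nat \<times> nat \<Rightarrow> complex" where
  "inv_factor g = (\<lambda>(s, t). if ap g s > ap g t then - 1 else 1)"
text \<open>As a product over pairs the parity of inversions is visibly multiplicative; agreement
  with \<open>sg\<close> then only has to be checked on transpositions.\<close>

definition inv_sign :: "nat \<Rightarrow> fperm \<Rightarrow> complex" where "inv_sign n g = prod (inv_factor g) (pairs n)"

lemma finite_pairs [simp]: "finite (pairs n)"
  by (rule finite_subset[of _ "{0..<n} \<times> {0..<n}"]) (auto simp: pairs_def)

lemma inv_sign_plus:
  assumes h: "h \<in> Sym {0..<n}" shows "inv_sign n (g + h) = inv_sign n g * inv_sign n h"
proof -
  \<comment> \<open>The sorted image of a pair: a bijection of \<open>pairs n\<close> with inverse
    \<open>f (- h)\<close>. Sorting reverses the pair exactly when \<open>h\<close> inverts it,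
    which is the factor \<open>inv_factor h p\<close>.\<close>
  define f where "f h = (\<lambda>(s, t). (min (ap h s) (ap h t), max (ap h s) (ap h t)))" for h
  have f: "f h p \<in> pairs n" if "h \<in> Sym {0..<n}" "p \<in> pairs n" for h p
  proof -
    obtain s t where p: "p = (s, t)" "s < t" "t < n" using \<open>p \<in> pairs n\<close> by (auto simp: pairs_def)
    have "ap h s < n" "ap h t < n" using that(1) p by (simp_all add: Sym_less)
    moreover have "ap h s < ap h t \<or> ap h t < ap h s"
      using p(2) ap_eq_iff[of h s t] by linarith
    ultimately show ?thesis using p(1) by (elim disjE) (simp_all add: f_def pairs_def min_def max_def)
  qed
  have ff: "f (- h) (f h p) = p" "f h (f (- h) p) = p" if "p \<in> pairs n" for h p
    using that by (cases p; auto simp: f_def pairs_def min_def max_def)+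
  have "inv_sign n (g + h) = (\<Prod>p\<in>pairs n. inv_factor g (f h p) * inv_factor h p)"
    unfolding inv_sign_def
  proof (rule prod.cong[OF refl])
    fix p assume p: "p \<in> pairs n"
    obtain s t where st: "p = (s, t)" by (cases p)
    have "ap h s \<noteq> ap h t" "ap g (ap h s) \<noteq> ap g (ap h t)" using p st by (auto simp: pairs_def)
    then show "inv_factor (g + h) p = inv_factor g (f h p) * inv_factor h p"
      by (cases "ap h s < ap h t"; cases "ap g (ap h s) < ap g (ap h t)")
        (simp_all add: st inv_factor_def f_def min_def max_def)
  qed
  also have "\<dots> = (\<Prod>p\<in>pairs n. inv_factor g (f h p)) * inv_sign n h"
    by (simp add: prod.distrib inv_sign_def)
  also have "(\<Prod>p\<in>pairs n. inv_factor g (f h p)) = inv_sign n g"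
    unfolding inv_sign_def
    by (rule prod.reindex_bij_witness[of _ "f (- h)" "f h"]) (use h f ff in auto)
  finally show ?thesis .
qed

lemma inv_sign_zero: "inv_sign n 0 = 1"
  unfolding inv_sign_def by (rule prod.neutral) (auto simp: inv_factor_def pairs_def)

text \<open>All transpositions are conjugate, so multiplicativity reduces the claim to the exchange
  of 0 and 1, which has a single inversion.\<close>

lemma inv_sign_transp:
  assumes xy: "x < n" "y < n" "x \<noteq> y" shows "inv_sign n (transp x y) = - 1"
proof -
  have n: "1 < n" using xy by linarith
  have S01: "transp 0 1 \<in> Sym {0..<n}" using n by (intro transp_Sym) auto
  \<comment> \<open>\<open>z\<close> is where the exchange of 0 and \<open>x\<close> sends 1;
    following it by the exchange of \<open>z\<close> and \<open>y\<close> gives a \<open>g\<close>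
    with 0 going to \<open>x\<close> and 1 to \<open>y\<close>.\<close>
  define z where "z = Transposition.transpose 0 x (1 :: nat)"
  define g where "g = transp z y + transp 0 x"
  have z: "z \<noteq> x" "z < n" using xy n by (auto simp: z_def Transposition.transpose_def)
  have g: "ap g 0 = x" "ap g 1 = y"
  proof -
    show "ap g 0 = x" using z xy by (simp add: g_def ap_transp)
    have "ap g 1 = Transposition.transpose z y z"
      unfolding g_def ap_plus_apply ap_transp z_def ..
    then show "ap g 1 = y" by simp
  qed
  have gS: "g \<in> Sym {0..<n}" unfolding g_def using xy z n by (intro Sym_plus transp_Sym) auto
  have "g + transp 0 1 = transp x y + g" unfolding conj_transp g ..
  then have "inv_sign n g * inv_sign n (transp 0 1) = inv_sign n (transp x y + g)"
    using inv_sign_plus[OF S01, of g] by (simp only:)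
  also have "\<dots> = inv_sign n (transp x y) * inv_sign n g" by (rule inv_sign_plus[OF gS])
  finally have "inv_sign n g * inv_sign n (transp 0 1) = inv_sign n (transp x y) * inv_sign n g" .
  moreover have "inv_sign n g \<noteq> 0" by (auto simp: inv_sign_def inv_factor_def split: if_splits)
  ultimately have "inv_sign n (transp x y) = inv_sign n (transp 0 1)" by simp
  also have "\<dots> = (\<Prod>p\<in>pairs n. if p = (0, 1) then - 1 else 1)"
    unfolding inv_sign_def
    by (rule prod.cong)
      (auto simp: inv_factor_def pairs_def ap_transp Transposition.transpose_def split: if_splits)
  also have "\<dots> = - 1"
  proof -
    have "(0, 1) \<in> pairs n" using n by (simp add: pairs_def)
    then show ?thesis by (subst prod.delta) simp_all
  qed
  finally show ?thesis .
qed

lemma inv_sign_eq_sg: "g \<in> Sym {0..<n} \<Longrightarrow> inv_sign n g = sg g"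
  using finite_atLeastLessThan[of 0 n]
proof (induction rule: Sym_induct)
  case (transp a b g)
  have "inv_sign n (transp a b + g) = inv_sign n (transp a b) * inv_sign n g"
    by (rule inv_sign_plus[OF \<open>g \<in> Sym {0..<n}\<close>])
  then show ?case using transp by (simp add: inv_sign_transp sg_transp)
qed (simp add: inv_sign_zero)

lemma inversions_sg:
  assumes g: "g \<in> Sym {0..<n}" and w: "length w = n" "\<And>s. s < n \<Longrightarrow> ap g s = w ! s"
  shows "(if even (inversions w) then 1 else - 1) = sg g"
proof -
  have "{(s, t). s < t \<and> t < length w \<and> w ! s > w ! t} = {p \<in> pairs n. inv_factor g p = - 1}"
    using w by (auto simp: pairs_def inv_factor_def split: if_splits)
  then have "inversions w = card {p \<in> pairs n. inv_factor g p = - 1}" by (simp add: inversions_def)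
  moreover have "inv_sign n g = (\<Prod>p\<in>pairs n. if inv_factor g p = - 1 then - 1 else 1)"
    unfolding inv_sign_def by (rule prod.cong) (auto simp: inv_factor_def)
  then have "inv_sign n g = (- 1) ^ card {p \<in> pairs n. inv_factor g p = - 1}"
    by (simp add: prod.If_cases Collect_conj_eq[symmetric] Int_def)
  ultimately show ?thesis using inv_sign_eq_sg[OF g] by (auto simp: minus_one_power_iff)
qed

section \<open>Disjoint cycles and their positions in the concatenated word\<close>

lemma cycle_of_list_nth:
  assumes "distinct c" "i < length c"
  shows "cycle_of_list c (c ! i) = c ! (Suc i mod length c)"
proof -
  have "map (cycle_of_list c) c = rotate1 c" using cyclic_rotation[OF assms(1), of 1] by simp
  then have "map (cycle_of_list c) c ! i = rotate1 c ! i" by simp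
  then show ?thesis using assms(2) by (simp add: nth_rotate1)
qed

lemma foldr_cycles_out: "x \<notin> set (concat cs) \<Longrightarrow> foldr (\<circ>) (map cycle_of_list cs) id x = x"
  by (induction cs) (auto simp: id_outside_supp)

lemma foldr_cycles_in:
  "distinct (concat cs) \<Longrightarrow> d < length cs \<Longrightarrow> x \<in> set (cs ! d) \<Longrightarrow>
    foldr (\<circ>) (map cycle_of_list cs) id x = cycle_of_list (cs ! d) x"
proof (induction cs arbitrary: d)
  case (Cons c cs)
  have fold: "foldr (\<circ>) (map cycle_of_list (c # cs)) id x = cycle_of_list c (foldr (\<circ>) (map cycle_of_list cs) id x)"
    by (simp only: list.map foldr.simps comp_apply)
  show ?case
  proof (cases d)
    case 0
    then have "x \<notin> set (concat cs)" using Cons.prems by auto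
    then show ?thesis using foldr_cycles_out[of x cs] 0 unfolding fold by simp
  next
    case (Suc e)
    have e: "e < length cs" "x \<in> set (cs ! e)" using Cons.prems Suc by simp_all
    have "cycle_of_list (cs ! e) x \<in> set (cs ! e)"
      using permutes_in_image[OF cycle_permutes, of "cs ! e" x] e(2) by simp
    then have "cycle_of_list (cs ! e) x \<in> set (concat cs)" using e(1) by auto
    then have "cycle_of_list (cs ! e) x \<notin> set c" using Cons.prems(1) by auto
    moreover have "foldr (\<circ>) (map cycle_of_list cs) id x = cycle_of_list (cs ! e) x"
      by (rule Cons.IH[OF _ e]) (use Cons.prems(1) in simp)
    ultimately show ?thesis unfolding fold using Suc by (simp add: id_outside_supp)
  qed
qed simp

lemma nth_concat_block:
  "d < length cs \<Longrightarrow> i < length (cs ! d) \<Longrightarrow> concat cs ! (sum_list (take d (map length cs)) + i) = cs ! d ! i"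
proof (induction cs arbitrary: d)
  case (Cons c cs)
  show ?case
  proof (cases d)
    case 0
    then show ?thesis using Cons.prems by (simp add: nth_append)
  next
    case (Suc e)
    then show ?thesis using Cons.IH[of e] Cons.prems by (simp add: nth_append add.assoc)
  qed
qed simp

lemma bij_betw_block_positions:
  "bij_betw (\<lambda>(d, i). sum_list (take d l) + i) (SIGMA d:{..<length l}. {..<l ! d}) {0..<sum_list (l :: nat list)}"
proof (induction l)
  case (Cons a l)
  let ?S = "SIGMA d:{..<length l}. {..<l ! d}"
  let ?f = "\<lambda>(d, i). sum_list (take d l) + i"
  let ?F = "\<lambda>(d, i). sum_list (take d (a # l)) + i"
  have S: "(SIGMA d:{..<length (a # l)}. {..<(a # l) ! d})
      = Pair 0 ` {..<a} \<union> (\<lambda>(d, i). (Suc d, i)) ` ?S"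
    by (auto simp: image_iff lessThan_Suc_eq_insert_0)
  have 1: "bij_betw ?F (Pair 0 ` {..<a}) {0..<a}"
    by (rule bij_betw_byWitness[of _ "Pair 0"]) auto
  have "bij_betw (\<lambda>x. a + x) {0..<sum_list l} {a..<a + sum_list l}"
    by (rule bij_betw_byWitness[of _ "\<lambda>x. x - a"]) auto
  from bij_betw_trans[OF Cons.IH this]
  have "bij_betw ((\<lambda>x. a + x) \<circ> ?f) ?S {a..<a + sum_list l}" .
  moreover have "bij_betw (\<lambda>(d, i). (d - 1, i)) ((\<lambda>(d, i). (Suc d, i)) ` ?S) ?S"
    by (rule bij_betw_byWitness[of _ "\<lambda>(d, i). (Suc d, i)"]) auto
  ultimately have "bij_betw ((\<lambda>x. a + x) \<circ> ?f \<circ> (\<lambda>(d, i). (d - 1, i))) ((\<lambda>(d, i). (Suc d, i)) ` ?S) {a..<a + sum_list l}"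
    using bij_betw_trans by blast
  then have 2: "bij_betw ?F ((\<lambda>(d, i). (Suc d, i)) ` ?S) {a..<a + sum_list l}"
    by (rule bij_betw_cong[THEN iffD1, rotated]) auto
  have "bij_betw ?F (Pair 0 ` {..<a} \<union> (\<lambda>(d, i). (Suc d, i)) ` ?S) ({0..<a} \<union> {a..<a + sum_list l})"
    by (rule bij_betw_combine[OF 1 2]) auto
  then show ?case unfolding S by (simp add: ivl_disj_un_two(3))
qed (simp add: bij_betw_def)

lemma ex_block_coordinates:
  fixes l :: "nat list"
  obtains blk off where
    "bij_betw (\<lambda>s. (blk s, off s)) {0..<sum_list l} (SIGMA d:{..<length l}. {..<l ! d})"
    "\<And>d i. d < length l \<Longrightarrow> i < l ! d \<Longrightarrow> blk (sum_list (take d l) + i) = d \<and> off (sum_list (take d l) + i) = i"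
proof -
  let ?S = "SIGMA d:{..<length l}. {..<l ! d}"
  let ?f = "\<lambda>(d, i). sum_list (take d l) + i"
  define g where "g = inv_into ?S ?f"
  have g: "bij_betw g {0..<sum_list l} ?S"
    unfolding g_def by (rule bij_betw_inv_into[OF bij_betw_block_positions])
  have "g (sum_list (take d l) + i) = (d, i)" if "d < length l" "i < l ! d" for d i
    using bij_betw_inv_into_left[OF bij_betw_block_positions, of "(d, i)" l] that by (simp add: g_def)
  then show ?thesis using g that[of "\<lambda>s. fst (g s)" "\<lambda>s. snd (g s)"] by simp
qed

text \<open>The labelling is the consecutive one: block \<open>d\<close> occupies the positions of
  the \<open>d\<close>-th cycle in a concatenated cycle notation. Reading the word as a permutation
  \<open>p\<close>, the notation denotes the conjugate of \<open>rho\<close> by \<open>p\<close>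
  (\<open>cycles_rho\<close>).\<close>

locale cycle_type =
  fixes n :: nat and as :: "nat list" and blk off :: "nat \<Rightarrow> nat"
  assumes arms: "arms n as"
    and std_bij: "bij_betw (\<lambda>s. (blk s, off s)) {0..<n} (SIGMA d:{..<length as}. {..2 * as ! d})"
    and std: "d < length as \<Longrightarrow> i \<le> 2 * as ! d \<Longrightarrow>
       blk (sum_list (take d (map (\<lambda>a. 2 * a + 1) as)) + i) = d \<and>
       off (sum_list (take d (map (\<lambda>a. 2 * a + 1) as)) + i) = i"
begin

sublocale blocks n "length as" "(!) as" blk off
  using std_bij arms by unfold_locales (simp_all add: arms_def sorted_wrt_iff_nth_less)

definition mu :: "nat list" where "mu = map (\<lambda>a. 2 * a + 1) as"

lemma sum_mu: "sum_list mu = n"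
  using arms by (simp add: mu_def arms_def)

lemma cycles_rho:
  assumes cs: "map length cs = mu" "distinct (concat cs)" "set (concat cs) = {0..<n}"
    and p: "p \<in> Sym A" "\<And>s. s < n \<Longrightarrow> ap p s = concat cs ! s"
  shows "foldr (\<circ>) (map cycle_of_list cs) id = ap (p + rho + - p)"
proof
  fix x
  have len: "length cs = length as" using cs(1) by (metis length_map mu_def)
  have lens: "length (cs ! d) = 2 * as ! d + 1" if "d < length as" for d
  proof -
    have "map length cs ! d = mu ! d" using cs(1) by simp
    then show ?thesis using that len by (simp add: mu_def)
  qed
  show "foldr (\<circ>) (map cycle_of_list cs) id x = ap (p + rho + - p) x"
  proof (cases "x < n")
    case True
    define s where "s = ap (- p) x"
    have s: "s < n" "ap p s = x" using True p(1) by (simp_all add: s_def Sym_less)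
    define d i where "d = blk s" and "i = off s"
    have d: "d < length as" and i: "i \<le> 2 * as ! d" using blk_less[OF s(1)] off_le[OF s(1)] by (simp_all add: d_def i_def)
    define pos where "pos j = sum_list (take d mu) + j" for j
    have pos: "blk (pos j) = d \<and> off (pos j) = j \<and> pos j < n \<and> ap p (pos j) = cs ! d ! j" if "j \<le> 2 * as ! d" for j
    proof -
      have 1: "blk (pos j) = d \<and> off (pos j) = j" using std[OF d that] by (simp add: pos_def mu_def)
      have "pos j \<in> (\<lambda>(d, i). sum_list (take d mu) + i) ` (SIGMA d:{..<length mu}. {..<mu ! d})"
        using d that by (force simp: pos_def mu_def)
      then have "pos j < n" using bij_betw_imp_surj_on[OF bij_betw_block_positions[of mu]] sum_mu by simp
      moreover have "concat cs ! pos j = cs ! d ! j"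
        using nth_concat_block[of d cs j] d len lens[OF d] that cs(1) by (simp add: pos_def)
      ultimately show ?thesis using 1 p(2) by simp
    qed
    have "s = pos i" by (rule block_eq) (use s(1) pos[OF i] in \<open>simp_all add: d_def i_def\<close>)
    then have x: "x = cs ! d ! i" using pos[OF i] s(2) by simp
    have ro: "ro d i \<le> 2 * as ! d" using i by (auto simp: ro_def)
    have "ap rho s = pos (ro d i)"
    proof (rule block_eq)
      show "ap rho s < n" using s(1) by (simp add: Sym_less rho_Sym)
      show "pos (ro d i) < n" using pos[OF ro] by simp
      show "blk (ap rho s) = blk (pos (ro d i))" "off (ap rho s) = off (pos (ro d i))"
        using is_rho s(1) pos[OF ro] by (simp_all add: is_block_perm_def d_def i_def)
    qed
    then have "ap (p + rho + - p) x = cs ! d ! ro d i"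
      using pos[OF ro] by (simp add: s_def del: add_uminus_conv_diff)
    moreover have "x \<in> set (cs ! d)" unfolding x using lens[OF d] i by simp
    then have "foldr (\<circ>) (map cycle_of_list cs) id x = cycle_of_list (cs ! d) x"
      using foldr_cycles_in[OF cs(2)] d len by simp
    moreover have "distinct (cs ! d)" using cs(2) d len by (simp add: distinct_concat_iff)
    then have "cycle_of_list (cs ! d) x = cs ! d ! (Suc i mod length (cs ! d))"
      unfolding x using lens[OF d] i by (intro cycle_of_list_nth) simp_all
    moreover have "Suc i mod length (cs ! d) = ro d i" using ro_eq[OF i] lens[OF d] by simp
    ultimately show ?thesis by simp
  next
    case False
    then have "x \<notin> set (concat cs)" using cs(3) by simp
    moreover have "p + rho + - p \<in> Sym A" using p(1) rho_Sym by (simp add: Sym_plus del: add_uminus_conv_diff)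
    from Sym_notin[OF this, of x] have "ap (p + rho + - p) x = x"
      using False by (simp del: add_uminus_conv_diff ap_plus_apply)
    ultimately show ?thesis using foldr_cycles_out by metis
  qed
qed

lemma notation_perm:
  assumes "cycle_notation mu \<sigma> cs"
  obtains p where "p \<in> Sym A" "\<And>s. s < n \<Longrightarrow> ap p s = concat cs ! s" "\<sigma> = ap (p + rho + - p)"
    "(if even (inversions (concat cs)) then 1 else - 1) = sg p"
proof -
  have cs: "map length cs = mu" "distinct (concat cs)" "set (concat cs) = {0..<n}"
    "\<sigma> = foldr (\<circ>) (map cycle_of_list cs) id"
    using assms by (simp_all add: cycle_notation_def sum_mu)
  have len: "length (concat cs) = n" using distinct_card[OF cs(2)] cs(3) by simp
  have "bij_betw ((!) (concat cs)) {0..<n} {0..<n}"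
    using bij_betw_nth[OF cs(2), of "{..<n}" "{0..<n}"] len cs(3) by (simp add: atLeast0LessThan)
  from fperm_of_bij[OF finite_atLeastLessThan this] obtain p where
    p: "p \<in> Sym A" "\<And>s. s < n \<Longrightarrow> ap p s = concat cs ! s" by auto
  show ?thesis
    by (rule that[OF p]) (use cycles_rho[OF cs(1-3) p] cs(4) inversions_sg[OF p(1) len p(2)] in auto)
qed

fun split_at :: "nat list \<Rightarrow> nat list \<Rightarrow> nat list list" where
  "split_at [] xs = []"
| "split_at (l # ls) xs = take l xs # split_at ls (drop l xs)"

lemma split_at: "length xs = sum_list ls \<Longrightarrow> map length (split_at ls xs) = ls \<and> concat (split_at ls xs) = xs"
  by (induction ls xs rule: split_at.induct) auto

lemma ex_notation:
  assumes p: "p \<in> Sym A" shows "\<exists>cs. cycle_notation mu (ap (p + rho + - p)) cs"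
proof -
  define cs where "cs = split_at mu (map (ap p) [0..<n])"
  have cs: "map length cs = mu" "concat cs = map (ap p) [0..<n]"
    using split_at[of "map (ap p) [0..<n]" mu] sum_mu by (simp_all add: cs_def)
  have "ap p ` {0..<n} = {0..<n}" using bij_betw_Sym[OF p] by (simp add: bij_betw_def)
  then have 1: "distinct (concat cs)" "set (concat cs) = {0..<n}"
    unfolding cs(2) by (simp_all add: distinct_map inj_on_def)
  have "foldr (\<circ>) (map cycle_of_list cs) id = ap (p + rho + - p)"
    by (rule cycles_rho[OF cs(1) 1 p]) (simp add: cs(2))
  then have "cycle_notation mu (ap (p + rho + - p)) cs"
    unfolding cycle_notation_def using cs(1) 1 by (simp add: sum_mu)
  then show ?thesis ..
qed

text \<open>Two notations of one permutation correspond to conjugating permutations that differ by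
  an element of the centralizer of \<open>rho\<close>. That element is even, so the choice of
  notation does not affect the sign.\<close>

lemma cycle_sign_conj:
  assumes p: "p \<in> Sym A" shows "cycle_sign mu (ap (p + rho + - p)) = sg p"
proof -
  define cs where "cs = (SOME cs. cycle_notation mu (ap (p + rho + - p)) cs)"
  have "cycle_notation mu (ap (p + rho + - p)) cs"
    unfolding cs_def by (rule someI_ex[OF ex_notation[OF p]])
  then obtain q where q: "q \<in> Sym A" "ap (p + rho + - p) = ap (q + rho + - q)"
    "(if even (inversions (concat cs)) then 1 else - 1) = sg q"
    by (rule notation_perm)
  have "p + rho + - p = q + rho + - q" using q(2) by (metis ap_inverse)
  then have "- q + (p + rho + - p) + p = - q + (q + rho + - q) + p" by simp
  then have "(- q + p) + rho = rho + (- q + p)"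
    by (simp add: add.assoc del: add_uminus_conv_diff)
  then have "- q + p \<in> centr" using p q(1) by (simp add: centr_def Sym_plus)
  then have "sg q * sg p = 1" using centr_even by fastforce
  then have "sg q = sg p" using sg_cases[of p] sg_cases[of q] by auto
  then show ?thesis using q(3) by (simp add: cycle_sign_def cs_def)
qed

lemma has_cycle_type_iff: "has_cycle_type mu \<sigma> \<longleftrightarrow> (\<exists>p\<in>Sym A. \<sigma> = ap (p + rho + - p))"
  using ex_notation notation_perm unfolding has_cycle_type_def by metis

lemma prod_mu: "prod_list mu = card centr"
  unfolding card_centr mu_def by (simp add: prod.list_conv_set_nth atLeast0LessThan)

text \<open>The twisted class sum has coefficient \<open>prod_list mu\<close>, the order of the
  centralizer, at \<open>rho\<close>. Dividing by it leaves the value prescribed for the twisted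
  character.\<close>

definition tw_coeff :: "complex" where
  "tw_coeff = \<i> ^ (\<Sum>d<length as. as ! d) * of_real (sqrt (real (prod_list mu))) / of_nat (prod_list mu)"

lemma twisted_char_eq:
  assumes lam: "diagonal_hooks lam = mu" "sum_list lam = n" "partition_rank lam = length as"
    and g: "g \<in> Sym A"
  shows "twisted_char lam (ap g) = tw_coeff * lk (phi A (G rho)) g"
proof -
  have "2 * (\<Sum>d<length as. as ! d) + length as = n"
    using sum_mu by (simp add: mu_def sum_list_sum_nth atLeast0LessThan sum_Suc sum_distrib_left)
  then have m: "(sum_list lam - partition_rank lam) div 2 = (\<Sum>d<length as. as ! d)"
    unfolding lam by simp
  have pos: "prod_list mu \<noteq> 0" by (auto simp: mu_def prod_list_zero_iff)
  have tw: "twisted A (phi A (G rho))" by (intro twisted_phi Alg_G rho_Sym)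
  show ?thesis
  proof (cases "has_cycle_type mu (ap g)")
    case True
    then obtain p where p: "p \<in> Sym A" "ap g = ap (p + rho + - p)" using has_cycle_type_iff by blast
    then have g': "g = p + rho + - p" by (metis ap_inverse)
    have "lk (phi A (G rho)) g = sg p * of_nat (prod_list mu)"
      unfolding g' lk_twisted[OF tw p(1)] lk_phi_rho prod_mu ..
    moreover have "cycle_sign mu (ap g) = sg p" unfolding p(2) by (rule cycle_sign_conj[OF p(1)])
    ultimately show ?thesis using True pos by (simp add: twisted_char_def lam(1) m tw_coeff_def)
  next
    case False
    have "lk (phi A (G rho)) g = 0"
      unfolding phi_def lookup_sum
    proof (intro sum.neutral ballI)
      fix p assume p: "p \<in> Sym A"
      have "p + rho + - p \<noteq> g" using False has_cycle_type_iff p by blast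
      then show "lk (scl (sg p) (G p * G rho * G (- p))) g = 0"
        by (simp only: lk_scl lk_G flip: G_plus) simp
    qed
    then show ?thesis using False by (simp add: twisted_char_def lam(1))
  qed
qed

text \<open>The square of the coefficient is (-1)^M / N with \<open>N\<close> the order of the
  centralizer, and \<open>tau_phi_rho_sq\<close> contributes the factor n! (-1)^M N.\<close>

lemma tw_coeff_sq: "tau (scl tw_coeff (phi A (G rho)) * scl tw_coeff (phi A (G rho))) = fact n"
proof -
  define N where "N = (of_nat (prod_list mu) :: complex)"
  define M where "M = (\<Sum>d<length as. as ! d)"
  have "prod_list mu \<noteq> 0" by (auto simp: mu_def prod_list_zero_iff)
  then have N: "N \<noteq> 0" by (simp add: N_def)
  define S where "S = complex_of_real (sqrt (real (prod_list mu)))"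
  have S: "S * S = N"
    unfolding N_def S_def by (simp flip: of_real_mult)
  have "tw_coeff = \<i> ^ M * S / N" by (simp add: tw_coeff_def N_def M_def S_def)
  then have "tw_coeff * tw_coeff = (\<i> ^ M * \<i> ^ M) * (S * S) / (N * N)"
    by (simp add: mult.assoc mult.left_commute)
  then have "tw_coeff * tw_coeff = (\<i> ^ M * \<i> ^ M) * N / (N * N)" unfolding S .
  moreover have "\<i> ^ M * \<i> ^ M = (- 1) ^ M" by (simp flip: power_mult_distrib)
  ultimately have c2: "tw_coeff * tw_coeff = (- 1) ^ M / N" using N by simp
  have "tau (scl tw_coeff (phi A (G rho)) * scl tw_coeff (phi A (G rho)))
      = tw_coeff * tw_coeff * tau (phi A (G rho) * phi A (G rho))" by simp
  also have "\<dots> = (- 1) ^ M / N * (fact n * (- 1) ^ M * N)"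
    unfolding c2 tau_phi_rho_sq by (simp add: N_def prod_mu M_def)
  also have "\<dots> = fact n" using N by (simp add: power_mult_distrib[symmetric])
  finally show ?thesis .
qed

end

section \<open>Irreducible characters\<close>

lemma sum_fun_app: "(sum f S :: 'b \<Rightarrow> complex) x = (\<Sum>i\<in>S. f i x)"
  by (induction S rule: infinite_finite_induct) auto

text \<open>\<open>W g\<close> is the image of the delta function at \<open>g\<close> under an
  extension of \<open>T\<close> to all functions supported on \<open>S\<close>. The extension has
  its values in \<open>V\<close>, so its trace, read off in the basis of delta functions, is the
  trace of \<open>T\<close> on \<open>V\<close>.\<close>

lemma trace_on_eq:
  fixes V :: "('b \<Rightarrow> complex) set"
  assumes S: "finite S" and V: "fun_space.subspace V" and supp: "\<And>v x. v \<in> V \<Longrightarrow> x \<notin> S \<Longrightarrow> v x = 0"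
    and W: "\<And>g. g \<in> S \<Longrightarrow> W g \<in> V"
    and T: "\<And>v. v \<in> V \<Longrightarrow> T v = (\<Sum>g\<in>S. (\<lambda>x. v g * W g x))"
  shows "trace_on V T = (\<Sum>g\<in>S. W g g)"
proof -
  define B where "B = (SOME B. fun_space.independent B \<and> fun_space.span B = V)"
  have "\<exists>B. fun_space.independent B \<and> fun_space.span B = V"
    using fun_space.maximal_independent_subset[of V] fun_space.span_minimal[OF _ V] by (metis subset_antisym)
  from someI_ex[OF this] have B: "fun_space.independent B" "fun_space.span B = V" by (simp_all add: B_def)
  have BV: "b \<in> V" if "b \<in> B" for b using that B(2) fun_space.span_base by blast
  define e where "e g = (\<lambda>x. if x = g then 1 else 0 :: complex)" for g :: 'b
  have "B \<subseteq> fun_space.span (e ` S)"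
  proof
    fix b assume b: "b \<in> B"
    have "b = (\<Sum>g\<in>S. (\<lambda>x. b g * e g x))"
    proof
      fix x
      have "(\<Sum>g\<in>S. b g * e g x) = (\<Sum>g\<in>S. if x = g then b g else 0)"
        by (rule sum.cong) (auto simp: e_def)
      also have "\<dots> = b x" using S supp[OF BV[OF b], of x] by (auto simp: sum.delta')
      finally show "b x = (\<Sum>g\<in>S. (\<lambda>x. b g * e g x)) x" by (simp add: sum_fun_app)
    qed
    also have "\<dots> \<in> fun_space.span (e ` S)"
      by (intro fun_space.span_sum fun_space.span_scale fun_space.span_base) auto
    finally show "b \<in> fun_space.span (e ` S)" .
  qed
  then have fB: "finite B"
    using fun_space.independent_span_bound[of "e ` S" B] S B(1) by auto
  have rep: "(\<Sum>b\<in>B. fun_space.representation B v b * b x) = v x" if "v \<in> V" for v x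
  proof -
    have "(\<Sum>b\<in>B. (\<lambda>x. fun_space.representation B v b * b x)) = v"
      using fun_space.sum_representation_eq[OF B(1) _ fB subset_refl, of v] that B(2) by simp
    then have "(\<Sum>b\<in>B. (\<lambda>x. fun_space.representation B v b * b x)) x = v x" by simp
    then show ?thesis by (simp add: sum_fun_app)
  qed
  have repT: "fun_space.representation B (T b) b = (\<Sum>g\<in>S. b g * fun_space.representation B (W g) b)" if b: "b \<in> B" for b
  proof -
    have sW: "(\<lambda>x. b g * W g x) \<in> fun_space.span B" if "g \<in> S" for g
      using W[OF that] B(2) fun_space.span_scale[of "W g" B "b g"] by simp
    have "fun_space.representation B (T b) = fun_space.representation B (\<Sum>g\<in>S. (\<lambda>x. b g * W g x))"
      by (simp only: T[OF BV[OF b]])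
    also have "\<dots> = (\<lambda>c. \<Sum>g\<in>S. fun_space.representation B (\<lambda>x. b g * W g x) c)"
      by (rule fun_space.representation_sum[OF B(1) sW])
    finally have "fun_space.representation B (T b) b = (\<Sum>g\<in>S. fun_space.representation B (\<lambda>x. b g * W g x) b)" by simp
    also have "\<dots> = (\<Sum>g\<in>S. b g * fun_space.representation B (W g) b)"
      by (rule sum.cong) (use fun_space.representation_scale[OF B(1)] W B(2) in auto)
    finally show ?thesis .
  qed
  have "trace_on V T = (\<Sum>b\<in>B. \<Sum>g\<in>S. b g * fun_space.representation B (W g) b)"
    by (simp add: trace_on_def Let_def repT flip: B_def)
  also have "\<dots> = (\<Sum>g\<in>S. \<Sum>b\<in>B. fun_space.representation B (W g) b * b g)"
    by (subst sum.swap) (simp add: mult.commute)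
  also have "\<dots> = (\<Sum>g\<in>S. W g g)"
    by (rule sum.cong[OF refl rep[OF W]])
  finally show ?thesis .
qed

section \<open>Transfer between functions on permutations and \<open>ga\<close>\<close>

definition to_ga :: "nat \<Rightarrow> ((nat \<Rightarrow> nat) \<Rightarrow> complex) \<Rightarrow> ga" where
  "to_ga n f = (\<Sum>g\<in>Sym {0..<n}. scl (f (ap g)) (G g))"
definition of_ga :: "nat \<Rightarrow> ga \<Rightarrow> (nat \<Rightarrow> nat) \<Rightarrow> complex" where
  "of_ga n x = (\<lambda>p. if p permutes {0..<n} then lk x (Fperm p) else 0)"

lemma lk_to_ga: "g \<in> Sym {0..<n} \<Longrightarrow> lk (to_ga n f) g = f (ap g)"
  by (simp add: to_ga_def lookup_sum lk_G if_distrib[of "(*) _"] sum.delta cong: if_cong)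

lemma to_ga_Alg: "to_ga n f \<in> Alg {0..<n}"
  unfolding to_ga_def by (intro Alg_sum Alg_scl Alg_G)

lemma Alg_eqI: "x \<in> Alg A \<Longrightarrow> y \<in> Alg A \<Longrightarrow> (\<And>g. g \<in> Sym A \<Longrightarrow> lk x g = lk y g) \<Longrightarrow> x = y"
  by (rule poly_mapping_eqI) (metis (mono_tags, lifting) Alg_def mem_Collect_eq)

lemma to_ga_of_ga: "x \<in> Alg {0..<n} \<Longrightarrow> to_ga n (of_ga n x) = x"
  by (rule Alg_eqI[OF to_ga_Alg]) (simp_all add: lk_to_ga of_ga_def Sym_def ap_inverse)

lemma of_ga_group_algebra: "of_ga n x \<in> group_algebra n"
  by (simp add: of_ga_def group_algebra_def)

lemma of_ga_sum: "of_ga n (sum f S) = (\<Sum>i\<in>S. of_ga n (f i))"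
  by (rule ext) (simp add: of_ga_def sum_fun_app lookup_sum)

lemma of_ga_scl: "of_ga n (scl c x) = (\<lambda>p. c * of_ga n x p)"
  by (rule ext) (simp add: of_ga_def)

lemma of_ga_add: "of_ga n (x + y) = of_ga n x + of_ga n y"
  by (rule ext) (simp add: of_ga_def lookup_add)

lemma lk_mult:
  assumes "finite A" "x \<in> Alg A"
  shows "lk (x * y) s = (\<Sum>g\<in>Sym A. lk x g * lk y (- g + s))"
proof -
  have "lk (x * y) s = lk ((\<Sum>g\<in>Sym A. scl (lk x g) (G g)) * y) s"
    using Alg_expand[OF assms] by simp
  then show ?thesis by (simp add: sum_distrib_right lookup_sum)
qed

lemma group_algebra_mult_eq: "group_algebra_mult n f h = of_ga n (to_ga n f * to_ga n h)"
proof
  fix p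
  let ?P = "{(t, u). t permutes {0..<n} \<and> u permutes {0..<n} \<and> t \<circ> u = p}"
  show "group_algebra_mult n f h p = of_ga n (to_ga n f * to_ga n h) p"
  proof (cases "p permutes {0..<n}")
    case True
    define s where "s = Fperm p"
    have s: "s \<in> Sym {0..<n}" "ap s = p"
      using Fperm_Sym[OF _ True] ap_Fperm_permutes[OF _ True] by (simp_all add: s_def)
    have "(\<Sum>g\<in>Sym {0..<n}. f (ap g) * h (ap (- g + s))) = (\<Sum>(t, u)\<in>?P. f t * h u)"
    proof (rule sum.reindex_bij_witness[of _ "\<lambda>(t, u). Fperm t" "\<lambda>g. (ap g, ap (- g + s))"])
      fix g assume g: "g \<in> Sym {0..<n}"
      show "(case (ap g, ap (- g + s)) of (t, u) \<Rightarrow> Fperm t) = g" by (simp add: ap_inverse)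
      have "ap g \<circ> ap (- g + s) = p" using s(2) by (simp flip: ap_plus add: add.assoc[symmetric])
      moreover have "- g + s \<in> Sym {0..<n}" using g s(1) by (simp add: Sym_plus)
      ultimately show "(ap g, ap (- g + s)) \<in> ?P" using g by (simp add: Sym_def)
    next
      fix q assume "q \<in> ?P"
      then obtain t u where q: "q = (t, u)" "t permutes {0..<n}" "u permutes {0..<n}" "t \<circ> u = p" by auto
      have t: "ap (Fperm t) = t" "Fperm t \<in> Sym {0..<n}" and u: "ap (Fperm u) = u"
        using ap_Fperm_permutes[OF finite_atLeastLessThan q(2)] ap_Fperm_permutes[OF finite_atLeastLessThan q(3)]
          Fperm_Sym[OF finite_atLeastLessThan q(2)] by blast+
      have "Fperm t + Fperm u = s" by (rule fperm_eqI) (simp add: t u s(2) flip: q(4))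
      then have "- Fperm t + s = Fperm u" by (metis minus_add_cancel)
      then show "(ap (case q of (t, u) \<Rightarrow> Fperm t), ap (- (case q of (t, u) \<Rightarrow> Fperm t) + s)) = q"
        using q(1) t u by simp
      show "(case q of (t, u) \<Rightarrow> Fperm t) \<in> Sym {0..<n}" using q(1) t by simp
    qed simp
    then have "group_algebra_mult n f h p = (\<Sum>g\<in>Sym {0..<n}. f (ap g) * h (ap (- g + s)))"
      by (simp add: group_algebra_mult_def)
    also have "\<dots> = (\<Sum>g\<in>Sym {0..<n}. lk (to_ga n f) g * lk (to_ga n h) (- g + s))"
      by (rule sum.cong) (simp_all add: lk_to_ga Sym_plus s(1))
    also have "\<dots> = lk (to_ga n f * to_ga n h) s" by (rule lk_mult[OF _ to_ga_Alg, symmetric]) simp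
    finally show ?thesis using True by (simp add: of_ga_def s_def)
  next
    case False
    then have E: "?P = {}" using permutes_compose[of _ "{0..<n}"] by auto
    show ?thesis unfolding group_algebra_mult_def E using False by (simp add: of_ga_def)
  qed
qed

lemma to_ga_group_elem: "s \<in> Sym {0..<n} \<Longrightarrow> to_ga n (group_elem (ap s)) = G s"
  by (rule Alg_eqI[OF to_ga_Alg Alg_G]) (auto simp: lk_to_ga group_elem_def lk_G ap_inject)

section \<open>The character of the left ideal generated by \<open>c\<close>\<close>

context tableau
begin

lemma cnj_lk_c: "cnj (lk c h) = lk c h"
proof -
  have "lk c h = (\<Sum>p\<in>R. lk b (- p + h))"
    by (subst ssum_def) (simp add: sum_distrib_right lookup_sum)
  then show ?thesis by (simp add: lk_asum subgrpD(2)[OF C] if_distrib[of cnj] cong: if_cong)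
qed

text \<open>Right multiplication by \<open>scl (1 / kap) c\<close> projects \<open>Alg A\<close>
  onto the left ideal. Composed with left multiplication by \<open>G s\<close> it is the extension
  that \<open>trace_on_eq\<close> asks for, and its diagonal coefficients are those of
  \<open>c\<close> at conjugates of the inverse of \<open>s\<close>.\<close>

lemma trace_left_ideal:
  assumes s: "s \<in> Sym A"
  shows "trace_on {of_ga n (x * c) | x. x \<in> Alg A} (\<lambda>v. of_ga n (G s * to_ga n v)) = lk X s"
proof -
  let ?V = "{of_ga n (x * c) | x. x \<in> Alg A}"
  let ?S = "{p. p permutes A}"
  define W where "W p = of_ga n (G s * G (Fperm p) * scl (1 / kap) c)" for p
  have V: "fun_space.subspace ?V"
  proof (rule fun_space.subspaceI)
    show "0 \<in> ?V"
    proof -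
      have "of_ga n (0 * c) = 0" by (rule ext) (auto simp: of_ga_def)
      then show ?thesis by (intro CollectI exI[of _ 0]) simp
    qed
    fix u v assume "u \<in> ?V" "v \<in> ?V"
    then obtain x y where "x \<in> Alg A" "y \<in> Alg A" "u = of_ga n (x * c)" "v = of_ga n (y * c)" by auto
    then show "u + v \<in> ?V"
      by (intro CollectI exI[of _ "x + y"]) (simp add: of_ga_add distrib_right Alg_add)
  next
    fix t u assume "u \<in> ?V"
    then obtain x where "x \<in> Alg A" "u = of_ga n (x * c)" by auto
    then show "(\<lambda>p. t * u p) \<in> ?V"
      by (intro CollectI exI[of _ "scl t x"]) (simp add: of_ga_scl Alg_scl)
  qed
  have "trace_on ?V (\<lambda>v. of_ga n (G s * to_ga n v)) = (\<Sum>p\<in>?S. W p p)"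
  proof (rule trace_on_eq[OF _ V, where W = W])
    show "finite ?S" by (rule finite_permutations) simp
    show "v p = 0" if "v \<in> ?V" "p \<notin> ?S" for v p using that by (auto simp: of_ga_def)
    show "W p \<in> ?V" if "p \<in> ?S" for p
    proof -
      have "scl (1 / kap) (G s * G (Fperm p)) \<in> Alg A"
        using that s by (intro Alg_scl Alg_mult Alg_G Fperm_Sym) simp_all
      then show ?thesis unfolding W_def
        by (intro CollectI exI[of _ "scl (1 / kap) (G s * G (Fperm p))"]) (simp add: mult.assoc)
    qed
    show "of_ga n (G s * to_ga n v) = (\<Sum>p\<in>?S. (\<lambda>q. v p * W p q))" if v: "v \<in> ?V" for v
    proof -
      obtain x where x: "x \<in> Alg A" "v = of_ga n (x * c)" using v by auto
      define y where "y = x * c"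
      have y: "y \<in> Alg A" "to_ga n v = y" using x by (simp_all add: y_def to_ga_of_ga Alg_mult c_Alg)
      have "y * c = scl kap y" by (simp add: y_def c_c mult.assoc[of x])
      then have "y = y * scl (1 / kap) c" using kap_nonzero by simp
      then have "G s * y = G s * ((\<Sum>g\<in>Sym A. scl (lk y g) (G g)) * scl (1 / kap) c)"
        using Alg_expand[OF _ y(1)] by simp
      also have "\<dots> = (\<Sum>g\<in>Sym A. scl (lk y g) (G s * G g * scl (1 / kap) c))"
        by (simp add: sum_distrib_left sum_distrib_right scl_sum mult.assoc)
      finally have "of_ga n (G s * y) = (\<Sum>g\<in>Sym A. (\<lambda>q. v (ap g) * W (ap g) q))"
        using x(2) by (simp add: of_ga_sum of_ga_scl W_def ap_inverse of_ga_def[of _ "x * c"] Sym_def y_def)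
      also have "\<dots> = (\<Sum>p\<in>?S. (\<lambda>q. v p * W p q))"
        by (rule sum.reindex_bij_betw[OF bij_betw_ap_Sym]) simp
      finally show ?thesis by (simp only: y(2))
    qed
  qed
  also have "\<dots> = (\<Sum>g\<in>Sym A. W (ap g) (ap g))"
    by (rule sum.reindex_bij_betw[OF bij_betw_ap_Sym, symmetric]) simp
  also have "\<dots> = (\<Sum>g\<in>Sym A. 1 / kap * lk c (- g + (- s + g)))"
    by (rule sum.cong) (simp_all add: W_def of_ga_def ap_inverse Sym_def mult.assoc)
  also have "\<dots> = lk X s"
  proof -
    \<comment> \<open>\<open>b * a\<close> is the adjoint of \<open>c\<close>, whose coefficients
      are real, so passing between the two only inverts the argument.\<close>
    have "lk (G g * (b * a) * G (- g)) s = lk c (- g + (- s + g))" for g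
      by (simp add: star_c[symmetric] cnj_lk_c minus_add add.assoc del: add_uminus_conv_diff)
    then show ?thesis by (simp add: X_def psi_def lookup_sum sum_distrib_left del: lk_G_mult lk_mult_G)
  qed
  finally show ?thesis .
qed

end

section \<open>Tableaux of partitions and self-conjugate shapes\<close>

lemma Stab_iff_image:
  assumes p: "p permutes A" shows "(\<forall>i. p ` {x \<in> A. f x = i} = {x \<in> A. f x = i}) \<longleftrightarrow> (\<forall>x\<in>A. f (p x) = f x)"
proof
  assume *: "\<forall>i. p ` {x \<in> A. f x = i} = {x \<in> A. f x = i}"
  show "\<forall>x\<in>A. f (p x) = f x"
  proof
    fix x assume "x \<in> A"
    then have "p x \<in> p ` {y \<in> A. f y = f x}" by blast
    then show "f (p x) = f x" using *[rule_format, of "f x"] by blast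
  qed
next
  assume *: "\<forall>x\<in>A. f (p x) = f x"
  show "\<forall>i. p ` {x \<in> A. f x = i} = {x \<in> A. f x = i}"
  proof (intro allI equalityI subsetI)
    fix i y assume "y \<in> p ` {x \<in> A. f x = i}"
    then show "y \<in> {x \<in> A. f x = i}" using * permutes_in_image[OF p] by auto
  next
    fix i y assume y: "y \<in> {x \<in> A. f x = i}"
    then have "y \<in> p ` A" using permutes_image[OF p] by simp
    then obtain x where x: "x \<in> A" "y = p x" by blast
    then show "y \<in> p ` {x \<in> A. f x = i}" using * y by auto
  qed
qed

locale partition_tableau = tableau n D r k for n D r k +
  fixes lam :: "nat list"
  assumes sum_lam: "sum_list lam = n" and D_lam: "D = (SIGMA i:{..<length lam}. {..<lam ! i})"
    and entry: "i < length lam \<Longrightarrow> j < lam ! i \<Longrightarrow> r (tableau_entry lam i j) = i \<and> k (tableau_entry lam i j) = j"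
begin

lemma entry_less: "i < length lam \<Longrightarrow> j < lam ! i \<Longrightarrow> tableau_entry lam i j < n"
proof -
  assume "i < length lam" "j < lam ! i"
  then have "tableau_entry lam i j \<in> (\<lambda>(d, i). sum_list (take d lam) + i) ` (SIGMA d:{..<length lam}. {..<lam ! d})"
    by (force simp: tableau_entry_def)
  then show ?thesis using bij_betw_imp_surj_on[OF bij_betw_block_positions[of lam]] sum_lam by simp
qed

lemma entry_r_k: "x < n \<Longrightarrow> tableau_entry lam (r x) (k x) = x \<and> r x < length lam \<and> k x < lam ! r x"
proof -
  assume x: "x < n"
  have rk: "r x < length lam" "k x < lam ! r x" using in_D[OF x] by (simp_all add: D_lam)
  have "tableau_entry lam (r x) (k x) = x"
    by (rule cell_eq) (use entry[OF rk] entry_less[OF rk] x in simp_all)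
  then show ?thesis using rk by simp
qed

lemma row_eq: "tableau_row lam i = {x \<in> A. r x = i}"
proof
  show "tableau_row lam i \<subseteq> {x \<in> A. r x = i}"
    using entry entry_less by (auto simp: tableau_row_def)
  show "{x \<in> A. r x = i} \<subseteq> tableau_row lam i"
    unfolding tableau_row_def using entry_r_k by (auto, metis)
qed

lemma column_eq: "tableau_column lam j = {x \<in> A. k x = j}"
proof
  show "tableau_column lam j \<subseteq> {x \<in> A. k x = j}"
    using entry entry_less by (auto simp: tableau_column_def)
  show "{x \<in> A. k x = j} \<subseteq> tableau_column lam j"
    unfolding tableau_column_def using entry_r_k by (auto, metis)
qed

lemma row_group: "g \<in> Sym A \<Longrightarrow> ap g \<in> row_group lam \<longleftrightarrow> g \<in> R"
  using Stab_iff_image[of "ap g" A r] by (simp add: row_group_def row_eq sum_lam Stab_def Sym_def)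

lemma column_group: "g \<in> Sym A \<Longrightarrow> ap g \<in> column_group lam \<longleftrightarrow> g \<in> C"
  using Stab_iff_image[of "ap g" A k] by (simp add: column_group_def column_eq sum_lam Stab_def Sym_def)

lemma to_ga_row: "to_ga n (\<lambda>p. if p \<in> row_group lam then 1 else 0) = a"
proof (rule Alg_eqI[OF to_ga_Alg a_Alg])
  fix g assume g: "g \<in> Sym A"
  have "lk a g = sg g * lk (asum R) g"
    using lk_eps[of "ssum R" g] by simp
  then show "lk (to_ga n (\<lambda>p. if p \<in> row_group lam then 1 else 0)) g = lk a g"
    using g by (simp add: lk_to_ga row_group lk_asum subgrpD(2)[OF R])
qed

lemma to_ga_column: "to_ga n (\<lambda>p. if p \<in> column_group lam then of_int (sign p) else 0) = b"
  by (rule Alg_eqI[OF to_ga_Alg b_Alg])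
    (simp add: lk_to_ga column_group lk_asum subgrpD(2)[OF C] sg_def)

lemma young_symmetrizer: "young_symmetrizer lam = of_ga n c"
  by (simp add: young_symmetrizer_def sum_lam group_algebra_mult_eq to_ga_row to_ga_column)

lemma irr_char: "s \<in> Sym A \<Longrightarrow> irr_char lam (ap s) = lk X s"
proof -
  assume s: "s \<in> Sym A"
  have "specht_module lam = {of_ga n (to_ga n x * c) | x. x \<in> group_algebra n}"
    by (simp add: specht_module_def sum_lam group_algebra_mult_eq young_symmetrizer to_ga_of_ga c_Alg)
  also have "\<dots> = {of_ga n (x * c) | x. x \<in> Alg A}"
    by (rule Collect_cong) (metis of_ga_group_algebra to_ga_Alg to_ga_of_ga)
  finally have "specht_module lam = {of_ga n (x * c) | x. x \<in> Alg A}" .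
  moreover have "group_algebra_mult n (group_elem (ap s)) = (\<lambda>v. of_ga n (G s * to_ga n v))"
    by (rule ext) (simp add: group_algebra_mult_eq to_ga_group_elem[OF s])
  ultimately show ?thesis using trace_left_ideal[OF s] by (simp add: irr_char_def sum_lam)
qed

end

definition lam_arms :: "nat list \<Rightarrow> nat list" where
  "lam_arms lam = map (\<lambda>i. lam ! i - i - 1) [0..<partition_rank lam]"

text \<open>On and above the diagonal the two diagrams agree row by row, because the rows meeting
  the diagonal are those below the rank; symmetry of both diagrams covers the rest.\<close>

lemma self_conjugate_shape:
  assumes part: "is_partition n lam" and conj: "conjugate_partition lam = lam"
  shows "(SIGMA i:{..<length lam}. {..<lam ! i}) = hook_shape (lam_arms lam)" (is "?D = _")
    and "arms n (lam_arms lam)"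
    and "diagonal_hooks lam = map (\<lambda>a. 2 * a + 1) (lam_arms lam)"
    and "partition_rank lam = length (lam_arms lam)"
proof -
  define q where "q = partition_rank lam"
  have mono: "lam ! j \<le> lam ! i" if "i \<le> j" "j < length lam" for i j
    using part that by (cases "i = j") (auto simp: is_partition_def sorted_wrt_iff_nth_less)
  have rank: "i < length lam \<and> i < lam ! i \<longleftrightarrow> i < q" for i
  proof -
    have "{i. i < length lam \<and> i < lam ! i} = {0..<q}"
      unfolding q_def partition_rank_def
    proof (rule initial_segment)
      fix i i' assume "i \<in> {i. i < length lam \<and> i < lam ! i}" "i' \<le> i"
      then show "i' \<in> {i. i < length lam \<and> i < lam ! i}" using mono[of i' i] by auto
    qed simp
    from arg_cong[OF this, of "\<lambda>S. i \<in> S"] show ?thesis by simp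
  qed
  \<comment> \<open>Row \<open>j\<close> of the conjugate counts the rows longer than
    \<open>j\<close>. These form an initial segment, so self-conjugacy identifies that segment with
    the \<open>lam ! j\<close> first rows.\<close>
  have D_sym: "(j, i) \<in> ?D" if "(i, j) \<in> ?D" for i j
  proof -
    have ij: "i < length lam" "j < lam ! i" using that by auto
    then have ne: "lam \<noteq> []" by auto
    have len: "hd lam = length lam" using arg_cong[OF conj, of length] ne by (simp add: conjugate_partition_def)
    have j: "j < length lam" using ij mono[of 0 i] len ne by (simp add: hd_conv_nth)
    let ?S = "{i. i < length lam \<and> j < lam ! i}"
    have "conjugate_partition lam ! j = card ?S"
      using j ne len by (simp add: conjugate_partition_def)
    then have card_S: "lam ! j = card ?S" by (simp add: conj)
    have "?S = {0..<lam ! j}"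
      unfolding card_S
    proof (rule initial_segment)
      fix i i' assume "i \<in> ?S" "i' \<le> i"
      then show "i' \<in> ?S" using mono[of i' i] by auto
    qed simp
    from arg_cong[OF this, of "\<lambda>S. i \<in> S"] have "i < lam ! j" using ij by simp
    then show ?thesis using j by simp
  qed
  let ?as = "lam_arms lam"
  have as: "length ?as = q" "\<And>i. i < q \<Longrightarrow> ?as ! i = lam ! i - i - 1"
    by (simp_all add: lam_arms_def q_def)
  show "partition_rank lam = length ?as" by (simp add: as q_def)
  have upper: "(i, j) \<in> ?D \<longleftrightarrow> (i, j) \<in> hook_shape ?as" if ij: "i \<le> j" for i j
  proof (cases "i < q")
    case True
    then show ?thesis using ij as rank[of i] by (auto simp: hook_shape_def)
  next
    case False
    then show ?thesis using ij as rank[of i] by (auto simp: hook_shape_def)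
  qed
  show D: "?D = hook_shape ?as"
  proof (rule Set.set_eqI, rule prod_cases)
    fix i j
    show "(i, j) \<in> ?D \<longleftrightarrow> (i, j) \<in> hook_shape ?as"
    proof (cases "i \<le> j")
      case True
      then show ?thesis by (rule upper)
    next
      case False
      then have "(j, i) \<in> ?D \<longleftrightarrow> (j, i) \<in> hook_shape ?as" by (intro upper) simp
      then show ?thesis using D_sym[of i j] D_sym[of j i] hook_shape_sym[of i j] hook_shape_sym[of j i] by blast
    qed
  qed
  have decr: "sorted_wrt (>) ?as"
    unfolding sorted_wrt_iff_nth_less
  proof (intro allI impI)
    fix i j assume ij: "i < j" "j < length ?as"
    have "j < length lam" "j < lam ! j" using rank[of j] ij as by auto
    then show "?as ! j < ?as ! i" using mono[of i j] ij as by simp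
  qed
  then have "arms (\<Sum>a\<leftarrow>?as. 2 * a + 1) ?as" by (simp add: arms_def)
  then have "card (hook_shape ?as) = (\<Sum>a\<leftarrow>?as. 2 * a + 1)" by (rule card_hook_shape)
  moreover have "card ?D = n"
    using bij_betw_same_card[OF bij_betw_block_positions[of lam]] part by (simp add: is_partition_def)
  ultimately show "arms n ?as" using decr D by (simp add: arms_def)
  show "diagonal_hooks lam = map (\<lambda>a. 2 * a + 1) ?as"
    unfolding diagonal_hooks_def lam_arms_def map_map
  proof (rule map_cong[OF refl])
    fix i assume "i \<in> set [0..<partition_rank lam]"
    then have "i < lam ! i" using rank[of i] by (simp add: q_def)
    then show "2 * lam ! i - (2 * i + 1) = ((\<lambda>a. 2 * a + 1) \<circ> (\<lambda>i. lam ! i - i - 1)) i" by simp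
  qed
qed

theorem character_convolutions:
  assumes part: "is_partition n lam" and conj: "conjugate_partition lam = lam"
  obtains X Z kap where "kap \<noteq> 0" "irr_char lam id = fact n / kap"
    "X \<in> Alg {0..<n}" "Z \<in> Alg {0..<n}"
    "\<And>g. g \<in> Sym {0..<n} \<Longrightarrow> irr_char lam (ap g) = lk X g"
    "\<And>g. g \<in> Sym {0..<n} \<Longrightarrow> twisted_char lam (ap g) = lk Z g"
    "X * X = scl kap X" "Z * Z = scl kap X" "X * Z = scl kap Z" "Z * X = scl kap Z"
proof -
  define as where "as = lam_arms lam"
  note shape = self_conjugate_shape[OF part conj, folded as_def]
  have sum: "sum_list lam = n" using part by (simp add: is_partition_def)
  obtain r k where rk: "bij_betw (\<lambda>s. (r s, k s)) {0..<sum_list lam} (SIGMA d:{..<length lam}. {..<lam ! d})"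
    "\<And>d i. d < length lam \<Longrightarrow> i < lam ! d \<Longrightarrow> r (sum_list (take d lam) + i) = d \<and> k (sum_list (take d lam) + i) = i"
    using ex_block_coordinates[of lam] by blast
  define mu where "mu = map (\<lambda>a. 2 * a + 1) as"
  obtain blk off where bo: "bij_betw (\<lambda>s. (blk s, off s)) {0..<sum_list mu} (SIGMA d:{..<length mu}. {..<mu ! d})"
    "\<And>d i. d < length mu \<Longrightarrow> i < mu ! d \<Longrightarrow> blk (sum_list (take d mu) + i) = d \<and> off (sum_list (take d mu) + i) = i"
    using ex_block_coordinates[of mu] by blast
  have sum_mu: "sum_list mu = n" using shape(2) by (simp add: mu_def arms_def)
  have sig: "(SIGMA d:{..<length mu}. {..<mu ! d}) = (SIGMA d:{..<length as}. {..2 * as ! d})"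
    by (auto simp: mu_def)
  interpret T: sym_tableau n "hook_shape as" r k
    by (rule sym_tableau_hook_shape[OF shape(2)]) (use rk(1) shape(1) sum in simp)
  interpret P: partition_tableau n "hook_shape as" r k lam
    by unfold_locales (use sum shape(1) rk(2) in \<open>simp_all add: tableau_entry_def\<close>)
  interpret C: cycle_type n as blk off
  proof
    show "arms n as" by (rule shape(2))
    show "bij_betw (\<lambda>s. (blk s, off s)) {0..<n} (SIGMA d:{..<length as}. {..2 * as ! d})"
      using bo(1) sum_mu sig by simp
    fix d i assume "d < length as" "i \<le> 2 * as ! d"
    then show "blk (sum_list (take d (map (\<lambda>a. 2 * a + 1) as)) + i) = d \<and>
        off (sum_list (take d (map (\<lambda>a. 2 * a + 1) as)) + i) = i"
      using bo(2)[of d i] by (simp add: mu_def)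
  qed
  obtain c where c: "c \<noteq> 0" "T.Y = scl c (phi {0..<n} (G C.rho))"
    using Y_eq_phi_rot[OF shape(2) T.sym_tableau_axioms C.blocks_axioms] by blast
  define Z where "Z = scl C.tw_coeff (phi {0..<n} (G C.rho))"
  have ZY: "Z = scl (C.tw_coeff / c) T.Y" using c by (simp add: Z_def)
  have tw: "twisted {0..<n} Z" unfolding ZY by (rule twisted_scl[OF T.twisted_Y])
  have XZ: "T.X * Z = scl T.kap Z" by (simp add: ZY T.X_Y mult.commute)
  have ZX: "Z * T.X = scl T.kap Z" using T.X_central[OF twisted_Alg[OF tw]] XZ by simp
  have "\<exists>s. Z * Z = scl s T.X"
  proof (rule T.central_in_block)
    show "Z * Z \<in> Alg {0..<n}" by (intro Alg_mult twisted_Alg[OF tw])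
    show "x * (Z * Z) = Z * Z * x" if "x \<in> Alg {0..<n}" for x
      by (rule twisted_mult_central[OF _ tw tw that]) simp
    show "T.X * (Z * Z) = scl T.kap (Z * Z)" by (simp add: XZ flip: mult.assoc)
  qed
  then obtain s where s: "Z * Z = scl s T.X" by blast
  \<comment> \<open>\<open>tw_coeff\<close> makes this trace \<open>fact n\<close>, and
    \<open>fact n\<close> is also \<open>kap\<close> times \<open>tau X\<close>; this fixes
    \<open>s\<close>.\<close>
  have "tau (Z * Z) = fact n" unfolding Z_def by (rule C.tw_coeff_sq)
  then have "s * (fact n / T.kap) = fact n" by (simp add: s T.tau_X)
  then have "s = T.kap" using T.kap_nonzero by (simp add: field_simps)
  then have ZZ: "Z * Z = scl T.kap T.X" using s by simp
  have tc: "twisted_char lam (ap g) = lk Z g" if "g \<in> Sym {0..<n}" for g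
    using C.twisted_char_eq[OF _ sum shape(4) that] shape(3) by (simp add: C.mu_def Z_def)
  have id: "irr_char lam id = fact n / T.kap"
    using P.irr_char[of 0] T.tau_X by (simp add: tau_def)
  show ?thesis
    by (rule that[OF T.kap_nonzero id T.X_Alg twisted_Alg[OF tw] P.irr_char tc T.X_X ZZ XZ ZX])
qed

section \<open>Immanants\<close>

lemma ordered_prod_1 [simp]: "ordered_prod (Suc 0) x = x 0"
  by (simp add: ordered_prod_def)

lemma ordered_prod_Suc: "1 \<le> n \<Longrightarrow> ordered_prod (Suc n) x = ordered_prod n x * x n"
  by (simp add: ordered_prod_def)

lemma ordered_prod_cong:
  assumes "1 \<le> n" "\<And>s. s < n \<Longrightarrow> x s = y s" shows "ordered_prod n x = ordered_prod n y"
  using assms by (induction n rule: nat_induct_at_least) (simp_all add: ordered_prod_Suc)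

lemma ordered_prod_commute:
  assumes "1 \<le> n" "\<And>s. s < n \<Longrightarrow> z * y s = y s * z"
  shows "z * ordered_prod n y = ordered_prod n y * z"
  using assms
proof (induction n rule: nat_induct_at_least)
  case (Suc n)
  have IH: "z * ordered_prod n y = ordered_prod n y * z" using Suc by simp
  have "z * (ordered_prod n y * y n) = ordered_prod n y * (z * y n)"
    by (simp only: mult.assoc[symmetric] IH)
  also have "\<dots> = ordered_prod n y * y n * z"
    using Suc.prems[of n] by (simp add: mult.assoc)
  finally show ?case by (simp only: ordered_prod_Suc[OF Suc.hyps])
qed simp

lemma ordered_prod_mult:
  assumes "1 \<le> n" "\<And>s t. s < n \<Longrightarrow> t < n \<Longrightarrow> x s * y t = y t * x s"
  shows "ordered_prod n x * ordered_prod n y = ordered_prod n (\<lambda>s. x s * y s)"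
  using assms
proof (induction n rule: nat_induct_at_least)
  case (Suc n)
  have c: "x n * ordered_prod n y = ordered_prod n y * x n"
    by (rule ordered_prod_commute[OF Suc.hyps]) (use Suc.prems in simp)
  have "ordered_prod n x * x n * (ordered_prod n y * y n) = ordered_prod n x * (x n * ordered_prod n y) * y n"
    by (simp only: mult.assoc)
  also have "\<dots> = (ordered_prod n x * ordered_prod n y) * (x n * y n)"
    unfolding c by (simp only: mult.assoc)
  also have "ordered_prod n x * ordered_prod n y = ordered_prod n (\<lambda>s. x s * y s)"
    using Suc by simp
  finally show ?case by (simp only: ordered_prod_Suc[OF Suc.hyps])
qed simp

text \<open>The algebra has no unit, so the empty product is represented by \<open>None\<close>.\<close>

definition opt_mult :: "'a::ring \<Rightarrow> 'a option \<Rightarrow> 'a option" where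
  "opt_mult x q = (case q of None \<Rightarrow> Some x | Some p \<Rightarrow> Some (p * x))"

lemma fold_opt_mult: "1 \<le> n \<Longrightarrow> fold opt_mult (map x [0..<n]) None = Some (ordered_prod n x)"
  by (induction n rule: nat_induct_at_least) (simp_all add: opt_mult_def ordered_prod_Suc)

lemma ordered_prod_permute:
  assumes n: "1 \<le> n" and p: "p permutes {0..<n}"
    and comm: "\<And>s t. s < n \<Longrightarrow> t < n \<Longrightarrow> x s * x t = x t * x s"
  shows "ordered_prod n (\<lambda>s. x (p s)) = ordered_prod n x"
proof -
  have "image_mset p (mset_set {0..<n}) = mset_set {0..<n}"
    using image_mset_mset_set[of p "{0..<n}"] permutes_inj_on[OF p] permutes_image[OF p] by simp
  then have "mset (map p [0..<n]) = mset [0..<n]" by simp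
  then have "image_mset x (mset (map p [0..<n])) = image_mset x (mset [0..<n])" by (rule arg_cong)
  then have m: "mset (map (\<lambda>s. x (p s)) [0..<n]) = mset (map x [0..<n])"
    by (simp only: mset_map multiset.map_comp comp_def)
  have "fold opt_mult (map (\<lambda>s. x (p s)) [0..<n]) = fold opt_mult (map x [0..<n])"
  proof (rule fold_multiset_equiv[OF _ m])
    fix u v assume uv: "u \<in> set (map (\<lambda>s. x (p s)) [0..<n])" "v \<in> set (map (\<lambda>s. x (p s)) [0..<n])"
    have "u * v = v * u"
      using uv comm permutes_in_image[OF p] by auto
    then show "opt_mult u \<circ> opt_mult v = opt_mult v \<circ> opt_mult u"
      by (intro ext) (simp add: opt_mult_def mult.assoc split: option.split)
  qed
  then have "Some (ordered_prod n (\<lambda>s. x (p s))) = Some (ordered_prod n x)"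
    by (simp only: fold_opt_mult[OF n, symmetric])
  then show ?thesis by simp
qed

section \<open>Sums over index tuples\<close>

lemma index_tuples_nth: "J \<in> index_tuples M n \<Longrightarrow> s < n \<Longrightarrow> J ! s < M"
  unfolding index_tuples_def by (metis (mono_tags, lifting) atLeastLessThan_iff mem_Collect_eq nth_mem subsetD)

lemma index_tuples_Suc:
  "bij_betw (\<lambda>(J, j). J @ [j]) (index_tuples M n \<times> {0..<M}) (index_tuples M (Suc n))"
proof (rule bij_betw_byWitness[of _ "\<lambda>J. (butlast J, last J)"])
  show "\<forall>J\<in>index_tuples M (Suc n). (case (butlast J, last J) of (J, j) \<Rightarrow> J @ [j]) = J"
    by (auto simp: index_tuples_def intro!: append_butlast_last_id)
  show "(\<lambda>J. (butlast J, last J)) ` index_tuples M (Suc n) \<subseteq> index_tuples M n \<times> {0..<M}"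
  proof
    fix q assume "q \<in> (\<lambda>J. (butlast J, last J)) ` index_tuples M (Suc n)"
    then obtain J where J: "q = (butlast J, last J)" "set J \<subseteq> {0..<M}" "length J = Suc n"
      by (auto simp: index_tuples_def)
    then have "J \<noteq> []" by auto
    then have "last J \<in> set J" by simp
    then show "q \<in> index_tuples M n \<times> {0..<M}"
      using J in_set_butlastD[of _ J] by (auto simp: index_tuples_def)
  qed
qed (auto simp: index_tuples_def)

lemma ordered_prod_sum:
  assumes "1 \<le> n"
  shows "ordered_prod n (\<lambda>s. \<Sum>j\<in>{0..<M}. f s j) = (\<Sum>J\<in>index_tuples M n. ordered_prod n (\<lambda>s. f s (J ! s)))"
  using assms
proof (induction n rule: nat_induct_at_least)
  case base
  have "(\<Sum>j\<in>{0..<M}. f 0 j) = (\<Sum>J\<in>index_tuples M 1. f 0 (J ! 0))"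
    by (rule sum.reindex_bij_witness[of _ "\<lambda>J. J ! 0" "\<lambda>j. [j]"])
      (auto simp: index_tuples_def length_Suc_conv)
  then show ?case by simp
next
  case (Suc n)
  have "(\<Sum>J\<in>index_tuples M (Suc n). ordered_prod (Suc n) (\<lambda>s. f s (J ! s)))
      = (\<Sum>(J, j)\<in>index_tuples M n \<times> {0..<M}. ordered_prod (Suc n) (\<lambda>s. f s ((J @ [j]) ! s)))"
    by (subst sum.reindex_bij_betw[OF index_tuples_Suc, symmetric]) (simp add: case_prod_unfold)
  also have "\<dots> = (\<Sum>(J, j)\<in>index_tuples M n \<times> {0..<M}. ordered_prod n (\<lambda>s. f s (J ! s)) * f n j)"
  proof (rule sum.cong[OF refl], clarify)
    fix J j assume "J \<in> index_tuples M n"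
    then have len: "length J = n" by (simp add: index_tuples_def)
    have "ordered_prod n (\<lambda>s. f s ((J @ [j]) ! s)) = ordered_prod n (\<lambda>s. f s (J ! s))"
      by (rule ordered_prod_cong[OF Suc.hyps]) (simp add: nth_append len)
    then show "ordered_prod (Suc n) (\<lambda>s. f s ((J @ [j]) ! s)) = ordered_prod n (\<lambda>s. f s (J ! s)) * f n j"
      by (simp add: ordered_prod_Suc[OF Suc.hyps] nth_append len)
  qed
  also have "\<dots> = (\<Sum>J\<in>index_tuples M n. ordered_prod n (\<lambda>s. f s (J ! s))) * (\<Sum>j\<in>{0..<M}. f n j)"
    by (simp only: sum_product sum.cartesian_product)
  finally show ?case using Suc.IH by (simp add: ordered_prod_Suc[OF Suc.hyps])
qed

lemma index_tuples_permute:
  assumes p: "p permutes {0..<n}"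
  shows "bij_betw (\<lambda>J. map (\<lambda>s. J ! p s) [0..<n]) (index_tuples M n) (index_tuples M n)"
proof -
  define q where "q = inv_into UNIV p"
  have q: "q permutes {0..<n}" unfolding q_def by (rule permutes_inv[OF p])
  have pq: "p (q s) = s" "q (p s) = s" for s unfolding q_def using permutes_inverses[OF p] by auto
  have in_tuples: "map (\<lambda>s. J ! u s) [0..<n] \<in> index_tuples M n"
    if "J \<in> index_tuples M n" "u permutes {0..<n}" for J u
  proof -
    have "J ! u s < M" if "s < n" for s
      using index_tuples_nth[OF \<open>J \<in> _\<close>, of "u s"] permutes_in_image[OF \<open>u permutes _\<close>, of s] that by simp
    then show ?thesis by (auto simp: index_tuples_def)
  qed
  have inv: "map (\<lambda>s. map (\<lambda>s. J ! u s) [0..<n] ! v s) [0..<n] = J"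
    if J: "J \<in> index_tuples M n" and v: "v permutes {0..<n}" and uv: "\<And>s. u (v s) = s" for J u v
  proof (rule nth_equalityI)
    show "length (map (\<lambda>s. map (\<lambda>s. J ! u s) [0..<n] ! v s) [0..<n]) = length J"
      using J by (simp add: index_tuples_def)
    fix s assume "s < length (map (\<lambda>s. map (\<lambda>s. J ! u s) [0..<n] ! v s) [0..<n])"
    then have s: "s < n" by simp
    then have "v s < n" using permutes_in_image[OF v, of s] by simp
    then show "map (\<lambda>s. map (\<lambda>s. J ! u s) [0..<n] ! v s) [0..<n] ! s = J ! s"
      using s uv by simp
  qed
  show ?thesis
  proof (rule bij_betw_byWitness[of _ "\<lambda>J. map (\<lambda>s. J ! q s) [0..<n]"])
    show "\<forall>J\<in>index_tuples M n. map (\<lambda>s. map (\<lambda>s. J ! p s) [0..<n] ! q s) [0..<n] = J"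
      using inv[OF _ q, of _ p] pq by blast
    show "\<forall>J\<in>index_tuples M n. map (\<lambda>s. map (\<lambda>s. J ! q s) [0..<n] ! p s) [0..<n] = J"
      using inv[OF _ p, of _ q] pq by blast
  qed (use in_tuples[OF _ p] in_tuples[OF _ q] in blast)+
qed

context complex_algebra
begin

lemma gen_immanant_Sym:
  assumes "dim_row X = n"
  shows "gen_immanant scale \<chi> X
    = (\<Sum>g\<in>Sym {0..<n}. scale (\<chi> (ap g)) (ordered_prod n (\<lambda>s. X $$ (s, ap g s))))"
  unfolding gen_immanant_def assms
  by (rule sum.reindex_bij_betw[OF bij_betw_ap_Sym, symmetric]) simp

lemma sum_scale_mult:
  "(\<Sum>i\<in>S. scale (f i) (x i)) * (\<Sum>j\<in>T. scale (h j) (y j)) = (\<Sum>i\<in>S. \<Sum>j\<in>T. scale (f i * h j) (x i * y j))"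
  by (simp add: sum_product scale_mult_left scale_mult_right mult.commute)

text \<open>Summing over \<open>J\<close> merges the product over a permutation \<open>u\<close> in the first factor and \<open>v\<close> in
  the second into a product of entries of \<open>A * B\<close> along \<open>v \<circ> u\<close>.\<close>

lemma sum_index_tuples_prod:
  assumes n: "1 \<le> n" and A: "A \<in> carrier_mat L M" and B: "B \<in> carrier_mat M N"
    and comm: "\<And>x y. x \<in> elements_mat A \<union> elements_mat B \<Longrightarrow> y \<in> elements_mat A \<union> elements_mat B \<Longrightarrow> x * y = y * x"
    and I: "I \<in> index_tuples L n" and K: "K \<in> index_tuples N n"
    and u: "u \<in> Sym {0..<n}" and v: "v \<in> Sym {0..<n}"
  shows "(\<Sum>J\<in>index_tuples M n. ordered_prod n (\<lambda>s. A $$ (I ! s, J ! ap u s)) * ordered_prod n (\<lambda>s. B $$ (J ! s, K ! ap v s)))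
    = ordered_prod n (\<lambda>s. (A * B) $$ (I ! s, K ! ap (v + u) s))"
proof -
  have up: "ap u permutes {0..<n}" using u by (simp add: Sym_def)
  have us: "ap u s < n \<longleftrightarrow> s < n" and vs: "ap v s < n \<longleftrightarrow> s < n" for s
    by (simp_all add: Sym_less u v)
  have a: "A $$ (I ! s, j) \<in> elements_mat A \<union> elements_mat B" if "s < n" "j < M" for s j
    using elements_matI[OF A index_tuples_nth[OF I that(1)] that(2) refl] by blast
  have b: "B $$ (j, K ! s) \<in> elements_mat A \<union> elements_mat B" if "s < n" "j < M" for s j
    using elements_matI[OF B that(2) index_tuples_nth[OF K that(1)] refl] by blast
  define f where "f s j = A $$ (I ! s, j) * B $$ (j, K ! ap v (ap u s))" for s j
  have "ordered_prod n (\<lambda>s. A $$ (I ! s, J ! ap u s)) * ordered_prod n (\<lambda>s. B $$ (J ! s, K ! ap v s))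
      = ordered_prod n (\<lambda>s. f s (map (\<lambda>s. J ! ap u s) [0..<n] ! s))" if J: "J \<in> index_tuples M n" for J
  proof -
    have Jm: "J ! s < M" if "s < n" for s using index_tuples_nth[OF J that] .
    have "ordered_prod n (\<lambda>s. B $$ (J ! s, K ! ap v s)) = ordered_prod n (\<lambda>s. B $$ (J ! ap u s, K ! ap v (ap u s)))"
      by (rule ordered_prod_permute[OF n up, of "\<lambda>s. B $$ (J ! s, K ! ap v s)", symmetric])
        (intro comm b; simp add: Jm vs)
    also have "ordered_prod n (\<lambda>s. A $$ (I ! s, J ! ap u s)) * \<dots> = ordered_prod n (\<lambda>s. f s (J ! ap u s))"
      unfolding f_def by (rule ordered_prod_mult[OF n]) (intro comm a b; simp add: Jm vs us)
    also have "\<dots> = ordered_prod n (\<lambda>s. f s (map (\<lambda>s. J ! ap u s) [0..<n] ! s))"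
      by (rule ordered_prod_cong[OF n]) simp
    finally show ?thesis .
  qed
  then have "(\<Sum>J\<in>index_tuples M n. ordered_prod n (\<lambda>s. A $$ (I ! s, J ! ap u s)) * ordered_prod n (\<lambda>s. B $$ (J ! s, K ! ap v s)))
      = (\<Sum>J\<in>index_tuples M n. ordered_prod n (\<lambda>s. f s (map (\<lambda>s. J ! ap u s) [0..<n] ! s)))"
    by (rule sum.cong[OF refl])
  also have "\<dots> = (\<Sum>J\<in>index_tuples M n. ordered_prod n (\<lambda>s. f s (J ! s)))"
    by (rule sum.reindex_bij_betw[OF index_tuples_permute[OF up]])
  also have "\<dots> = ordered_prod n (\<lambda>s. \<Sum>j\<in>{0..<M}. f s j)" by (rule ordered_prod_sum[OF n, symmetric])
  also have "\<dots> = ordered_prod n (\<lambda>s. (A * B) $$ (I ! s, K ! ap (v + u) s))"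
  proof (rule ordered_prod_cong[OF n])
    fix s assume s: "s < n"
    have i: "I ! s < L" "K ! ap v (ap u s) < N"
      using index_tuples_nth[OF I s] index_tuples_nth[OF K, of "ap v (ap u s)"] s by (simp_all add: us vs)
    then show "(\<Sum>j\<in>{0..<M}. f s j) = (A * B) $$ (I ! s, K ! ap (v + u) s)"
      using A B by (simp add: f_def scalar_prod_def)
  qed
  finally show ?thesis .
qed

text \<open>A permutation \<open>u\<close> from \<open>A\<close> and \<open>v\<close> from
  \<open>B\<close> merge into \<open>v + u\<close>. The coefficient collected at \<open>w\<close> is
  therefore that of \<open>y * x\<close>, with the coefficients belonging to \<open>B\<close> in
  front.\<close>

theorem sum_gen_immanant_mult:
  assumes n: "1 \<le> n" and A: "A \<in> carrier_mat L M" and B: "B \<in> carrier_mat M N"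
    and comm: "\<forall>x \<in> elements_mat A \<union> elements_mat B. \<forall>y \<in> elements_mat A \<union> elements_mat B. x * y = y * x"
    and I: "I \<in> index_tuples L n" and K: "K \<in> index_tuples N n"
    and f: "\<forall>g\<in>Sym {0..<n}. f (ap g) = lk x g" and h: "\<forall>g\<in>Sym {0..<n}. h (ap g) = lk y g"
    and e: "\<forall>g\<in>Sym {0..<n}. e (ap g) = lk z g"
    and y: "y \<in> Alg {0..<n}" and yx: "y * x = scl kap z" and kap: "kap \<noteq> 0"
  shows "gen_immanant scale e (multi_index_mat (A * B) I K) = scale (1 / kap)
    (\<Sum>J\<in>index_tuples M n. gen_immanant scale f (multi_index_mat A I J) * gen_immanant scale h (multi_index_mat B J K))"
proof -
  let ?S = "Sym {0..<n}"
  define PA where "PA J u = ordered_prod n (\<lambda>s. A $$ (I ! s, J ! ap u s))" for J u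
  define PB where "PB J v = ordered_prod n (\<lambda>s. B $$ (J ! s, K ! ap v s))" for J v
  define Q where "Q u = ordered_prod n (\<lambda>s. (A * B) $$ (I ! s, K ! ap u s))" for u
  have len: "length I = n" "length K = n" using I K by (simp_all add: index_tuples_def)
  have imm_eq: "gen_immanant scale \<chi> (multi_index_mat X I' J')
      = (\<Sum>g\<in>?S. scale (\<chi> (ap g)) (ordered_prod n (\<lambda>s. X $$ (I' ! s, J' ! ap g s))))"
    if "length I' = n" "length J' = n" for \<chi> X I' J'
  proof -
    have "gen_immanant scale \<chi> (multi_index_mat X I' J')
      = (\<Sum>g\<in>?S. scale (\<chi> (ap g)) (ordered_prod n (\<lambda>s. multi_index_mat X I' J' $$ (s, ap g s))))"
      by (rule gen_immanant_Sym) (simp add: multi_index_mat_def that)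
    also have "\<dots> = (\<Sum>g\<in>?S. scale (\<chi> (ap g)) (ordered_prod n (\<lambda>s. X $$ (I' ! s, J' ! ap g s))))"
      by (intro sum.cong[OF refl] arg_cong[of _ _ "scale _"] ordered_prod_cong[OF n])
        (simp add: multi_index_mat_def that Sym_less)
    finally show ?thesis .
  qed
  have "(\<Sum>J\<in>index_tuples M n. gen_immanant scale f (multi_index_mat A I J) * gen_immanant scale h (multi_index_mat B J K))
      = (\<Sum>J\<in>index_tuples M n. \<Sum>u\<in>?S. \<Sum>v\<in>?S. scale (lk x u * lk y v) (PA J u * PB J v))"
  proof (rule sum.cong[OF refl])
    fix J assume "J \<in> index_tuples M n"
    then have "length J = n" by (simp add: index_tuples_def)
    then show "gen_immanant scale f (multi_index_mat A I J) * gen_immanant scale h (multi_index_mat B J K)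
        = (\<Sum>u\<in>?S. \<Sum>v\<in>?S. scale (lk x u * lk y v) (PA J u * PB J v))"
      by (simp add: imm_eq len sum_scale_mult f h PA_def PB_def cong: sum.cong)
  qed
  also have "\<dots> = (\<Sum>u\<in>?S. \<Sum>J\<in>index_tuples M n. \<Sum>v\<in>?S. scale (lk x u * lk y v) (PA J u * PB J v))"
    by (rule sum.swap)
  also have "\<dots> = (\<Sum>u\<in>?S. \<Sum>v\<in>?S. \<Sum>J\<in>index_tuples M n. scale (lk x u * lk y v) (PA J u * PB J v))"
    by (rule sum.cong[OF refl sum.swap])
  also have "\<dots> = (\<Sum>u\<in>?S. \<Sum>v\<in>?S. scale (lk x u * lk y v) (Q (v + u)))"
  proof (intro sum.cong refl)
    fix u v assume "u \<in> ?S" "v \<in> ?S"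
    then have "(\<Sum>J\<in>index_tuples M n. PA J u * PB J v) = Q (v + u)"
      unfolding PA_def PB_def Q_def using sum_index_tuples_prod[OF n A B _ I K] comm by blast
    then show "(\<Sum>J\<in>index_tuples M n. scale (lk x u * lk y v) (PA J u * PB J v)) = scale (lk x u * lk y v) (Q (v + u))"
      by (simp flip: scale_sum_right)
  qed
  also have "\<dots> = (\<Sum>v\<in>?S. \<Sum>u\<in>?S. scale (lk x u * lk y v) (Q (v + u)))"
    by (rule sum.swap)
  also have "\<dots> = (\<Sum>v\<in>?S. \<Sum>w\<in>?S. scale (lk x (- v + w) * lk y v) (Q w))"
  proof (rule sum.cong[OF refl])
    fix v assume v: "v \<in> ?S"
    show "(\<Sum>u\<in>?S. scale (lk x u * lk y v) (Q (v + u))) = (\<Sum>w\<in>?S. scale (lk x (- v + w) * lk y v) (Q w))"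
      using sum_Sym_left[OF v, of "\<lambda>w. scale (lk x (- v + w) * lk y v) (Q w)"] by (simp flip: add.assoc)
  qed
  also have "\<dots> = (\<Sum>w\<in>?S. \<Sum>v\<in>?S. scale (lk x (- v + w) * lk y v) (Q w))"
    by (rule sum.swap)
  also have "\<dots> = (\<Sum>w\<in>?S. scale (lk (y * x) w) (Q w))"
    by (rule sum.cong[OF refl])
      (simp add: lk_mult[OF finite_atLeastLessThan y] scale_sum_left mult.commute)
  also have "\<dots> = scale kap (\<Sum>w\<in>?S. scale (lk z w) (Q w))"
    by (simp add: yx scale_sum_right)
  also have "(\<Sum>w\<in>?S. scale (lk z w) (Q w)) = gen_immanant scale e (multi_index_mat (A * B) I K)"
    by (simp add: imm_eq len e Q_def cong: sum.cong)
  finally show ?thesis using kap by simp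
qed

end

theorem theorem1p1:
  fixes scale :: "complex \<Rightarrow> 'a::ring \<Rightarrow> 'a"
    and A B :: "'a mat"
    and n L M N :: nat
    and lam I K :: "nat list"
  assumes "complex_algebra scale"
    and "n \<ge> 1"
    and "is_partition n lam"
    and "conjugate_partition lam = lam"
    and "A \<in> carrier_mat L M"
    and "B \<in> carrier_mat M N"
    and "\<forall>x \<in> elements_mat A \<union> elements_mat B. \<forall>y \<in> elements_mat A \<union> elements_mat B. x * y = y * x"
    and "I \<in> index_tuples L n"
    and "K \<in> index_tuples N n"
  shows
    "imm scale lam (multi_index_mat (A * B) I K) =
       scale (irr_char lam id / fact n)
         (\<Sum>J\<in>index_tuples M n.
            imm scale lam (multi_index_mat A I J) * imm scale lam (multi_index_mat B J K)) \<and>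
     imm scale lam (multi_index_mat (A * B) I K) =
       scale (irr_char lam id / fact n)
         (\<Sum>J\<in>index_tuples M n.
            twisted_imm scale lam (multi_index_mat A I J) * twisted_imm scale lam (multi_index_mat B J K)) \<and>
     twisted_imm scale lam (multi_index_mat (A * B) I K) =
       scale (irr_char lam id / fact n)
         (\<Sum>J\<in>index_tuples M n.
            imm scale lam (multi_index_mat A I J) * twisted_imm scale lam (multi_index_mat B J K)) \<and>
     twisted_imm scale lam (multi_index_mat (A * B) I K) =
       scale (irr_char lam id / fact n)
         (\<Sum>J\<in>index_tuples M n.
            twisted_imm scale lam (multi_index_mat A I J) * imm scale lam (multi_index_mat B J K))"
proof -
  interpret complex_algebra scale by fact
  obtain X Z kap where kap: "kap \<noteq> 0" and id: "irr_char lam id = fact n / kap"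
    and Alg: "X \<in> Alg {0..<n}" "Z \<in> Alg {0..<n}"
    and X: "\<And>g. g \<in> Sym {0..<n} \<Longrightarrow> irr_char lam (ap g) = lk X g"
    and Z: "\<And>g. g \<in> Sym {0..<n} \<Longrightarrow> twisted_char lam (ap g) = lk Z g"
    and conv: "X * X = scl kap X" "Z * Z = scl kap X" "X * Z = scl kap Z" "Z * X = scl kap Z"
    by (rule character_convolutions[OF assms(3,4)]) (rule that)
  have coeff: "\<forall>g\<in>Sym {0..<n}. irr_char lam (ap g) = lk X g" "\<forall>g\<in>Sym {0..<n}. twisted_char lam (ap g) = lk Z g"
    using X Z by simp_all
  have quotient: "irr_char lam id / fact n = 1 / kap" using id by simp
  note product = sum_gen_immanant_mult[OF assms(2,5,6,7,8,9)]
  \<comment> \<open>Because the factor for \<open>B\<close> comes first in the convolution, the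
    mixed identity with the plain immanant of \<open>A\<close> uses \<open>Z * X\<close>, and the
    other one uses \<open>X * Z\<close>.\<close>
  show ?thesis
    unfolding imm_def twisted_imm_def quotient
    by (intro conjI product[OF coeff(1,1,1) Alg(1) conv(1) kap] product[OF coeff(2,2,1) Alg(2) conv(2) kap]
      product[OF coeff(1,2,2) Alg(2) conv(4) kap] product[OF coeff(2,1,2) Alg(1) conv(3) kap])
qed

end
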